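(* Let $g\in H$, $g\ne0$, be an eigenvector of the Stokes operator, $Ag=\lambda g$ with $\lambda>0$. Then $0\notin\mathcal{A}_g$, where $\mathcal{A}_g$ is the global attractor of the 2D periodic Navier-Stokes equations $\frac{du}{dt}+\nu Au+B(u,u)=g$.
   Context: Fix $L>0$, $\nu>0$, $\Omega=[0,L]^2$. $H$ is the closure in $[L^2(\Omega)]^2$ of the $\Omega$-periodic $\mathbb{R}^2$-valued trigonometric polynomials $v$ with $\nabla\cdot v=0$ and $\int_\Omega v\,dx=0$; $|\cdot|$ denotes the $L^2$ norm. $\mathcal{P}$ is the orthogonal (Helmholtz-Leray) projection of $[L^2(\Omega)]^2$ onto $H$; $A=-\mathcal{P}\Delta$ $(=-\Delta)$ is the Stokes operator; $B(u,v)=\mathcal{P}((u\cdot\nabla)v)$. The global attractor $\mathcal{A}_g$ is the set of all $u_0\in H$ for which there exists a solution $u(t)$ of $\frac{du}{dt}+\nu Au+B(u,u)=g$ defined for all $t\in\mathbb{R}$ with $u(0)=u_0$ and $\sup_{t\in\mathbb{R}}|u(t)|<\infty$. *)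

theory Defs
  imports "HOL-Analysis.Analysis"
begin

text \<open>
  Elements of \<open>[L\<^sup>2(\<Omega>)]\<^sup>2\<close> are represented by functions \<open>real^2 \<Rightarrow> real^2\<close> of which only the
  restriction to \<open>\<Omega>\<close> matters, up to null sets. Operators on \<open>L\<^sup>2\<close>-classes are therefore given by
  their graphs, each of which is invariant under changing the functions on null sets.
\<close>

definition Omega :: "real \<Rightarrow> (real^2) set" where
  "Omega L = cbox 0 (\<chi> i. L)"

abbreviation Omega_measure :: "real \<Rightarrow> (real^2) measure" where
  "Omega_measure L \<equiv> lebesgue_on (Omega L)"

definition L2_space :: "real \<Rightarrow> (real^2 \<Rightarrow> 'a::euclidean_space) set" where
  "L2_space L = {f. f \<in> borel_measurable (Omega_measure L) \<and>
                    integrable (Omega_measure L) (\<lambda>x. (norm (f x))\<^sup>2)}"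

definition L2_inner :: "real \<Rightarrow> (real^2 \<Rightarrow> 'a::euclidean_space) \<Rightarrow> (real^2 \<Rightarrow> 'a) \<Rightarrow> real" where
  "L2_inner L f h = (LINT x|Omega_measure L. f x \<bullet> h x)"

definition L2_norm :: "real \<Rightarrow> (real^2 \<Rightarrow> 'a::euclidean_space) \<Rightarrow> real" where
  "L2_norm L f = sqrt (LINT x|Omega_measure L. (norm (f x))\<^sup>2)"

definition phase :: "real \<Rightarrow> int^2 \<Rightarrow> real^2 \<Rightarrow> real" where
  "phase L k x = 2 * pi / L * (\<Sum>i\<in>UNIV. of_int (k $ i) * x $ i)"

definition trig_poly :: "real \<Rightarrow> (real^2 \<Rightarrow> real^2) \<Rightarrow> bool" where
  "trig_poly L v \<longleftrightarrow> (\<exists>K a b. finite K \<and>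
     v = (\<lambda>x. \<Sum>k\<in>K. cos (phase L k x) *\<^sub>R a k + sin (phase L k x) *\<^sub>R b k))"

definition divergence :: "(real^2 \<Rightarrow> real^2) \<Rightarrow> real^2 \<Rightarrow> real" where
  "divergence v x = trace (jacobian v (at x))"

definition laplacian :: "(real^2 \<Rightarrow> real^2) \<Rightarrow> real^2 \<Rightarrow> real^2" where
  "laplacian v x =
     (\<Sum>e\<in>Basis. frechet_derivative (\<lambda>y. frechet_derivative v (at y) e) (at x) e)"

definition test_fields :: "real \<Rightarrow> (real^2 \<Rightarrow> real^2) set" where
  "test_fields L = {v. trig_poly L v \<and> (\<forall>x. divergence v x = 0) \<and>
                       (LINT x|Omega_measure L. v x) = 0}"

definition H_space :: "real \<Rightarrow> (real^2 \<Rightarrow> real^2) set" where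
  "H_space L = {u \<in> L2_space L. \<forall>\<epsilon>>0. \<exists>v\<in>test_fields L. L2_norm L (\<lambda>x. u x - v x) < \<epsilon>}"

text \<open>\<open>leray_proj L f h\<close> states \<open>\<P>f = h\<close>.\<close>

definition leray_proj :: "real \<Rightarrow> (real^2 \<Rightarrow> real^2) \<Rightarrow> (real^2 \<Rightarrow> real^2) \<Rightarrow> bool" where
  "leray_proj L f h \<longleftrightarrow> f \<in> L2_space L \<and> h \<in> H_space L \<and>
     (\<forall>v\<in>H_space L. L2_inner L (\<lambda>x. f x - h x) v = 0)"

text \<open>
  \<open>has_laplacian L u f\<close> states \<open>\<Delta>u = f\<close> in the sense of periodic distributions, with \<open>f\<close> in \<open>L\<^sup>2\<close>;
  this describes the periodic \<open>H\<^sup>2\<close> functions \<open>u\<close>. Accordingly \<open>stokes_op L u w\<close> states that \<open>u\<close>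
  is in \<open>D(A) = H \<inter> H\<^sup>2\<close> and \<open>Au = -\<P>\<Delta>u = w\<close>.
\<close>

definition has_laplacian :: "real \<Rightarrow> (real^2 \<Rightarrow> real^2) \<Rightarrow> (real^2 \<Rightarrow> real^2) \<Rightarrow> bool" where
  "has_laplacian L u f \<longleftrightarrow> u \<in> L2_space L \<and> f \<in> L2_space L \<and>
     (\<forall>\<phi>. trig_poly L \<phi> \<longrightarrow> L2_inner L u (laplacian \<phi>) = L2_inner L f \<phi>)"

definition stokes_op :: "real \<Rightarrow> (real^2 \<Rightarrow> real^2) \<Rightarrow> (real^2 \<Rightarrow> real^2) \<Rightarrow> bool" where
  "stokes_op L u w \<longleftrightarrow> u \<in> H_space L \<and>
     (\<exists>f. has_laplacian L u f \<and> leray_proj L (\<lambda>x. - f x) w)"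

text \<open>
  \<open>has_gradient L u G\<close> states that \<open>u\<close> belongs to \<open>V\<close>, the \<open>H\<^sup>1\<close>-closure of the divergence-free
  mean-zero trigonometric polynomials, and that its Jacobian matrix \<open>\<nabla>u\<close> is \<open>G\<close>, where
  \<open>G x $ i $ j\<close> is the derivative of \<open>u\<^sub>i\<close> in direction \<open>j\<close>.
\<close>

definition has_gradient :: "real \<Rightarrow> (real^2 \<Rightarrow> real^2) \<Rightarrow> (real^2 \<Rightarrow> real^2^2) \<Rightarrow> bool" where
  "has_gradient L u G \<longleftrightarrow> u \<in> L2_space L \<and> G \<in> L2_space L \<and>
     (\<forall>\<epsilon>>0. \<exists>v\<in>test_fields L. L2_norm L (\<lambda>x. u x - v x) < \<epsilon> \<and>
                             L2_norm L (\<lambda>x. G x - jacobian v (at x)) < \<epsilon>)"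

text \<open>\<open>advection u G = (u \<cdot> \<nabla>)v\<close> where \<open>G = \<nabla>v\<close>.\<close>

definition advection :: "(real^2 \<Rightarrow> real^2) \<Rightarrow> (real^2 \<Rightarrow> real^2^2) \<Rightarrow> real^2 \<Rightarrow> real^2" where
  "advection u G x = G x *v u x"

text \<open>
  For \<open>u, v\<close> in \<open>V\<close> the field \<open>(u \<cdot> \<nabla>)v\<close> need not be in \<open>L\<^sup>2\<close>, and \<open>B(u, v) = \<P>((u \<cdot> \<nabla>)v)\<close> is
  understood as the element of \<open>V'\<close> whose pairing with a test field \<open>\<phi> = \<P>\<phi>\<close> is the following
  number; lemma \<open>B_pairing_eq\<close> below shows agreement with the \<open>L\<^sup>2\<close> projection where that applies.
\<close>

definition B_pairing ::
  "real \<Rightarrow> (real^2 \<Rightarrow> real^2) \<Rightarrow> (real^2 \<Rightarrow> real^2^2) \<Rightarrow> (real^2 \<Rightarrow> real^2) \<Rightarrow> real" where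
  "B_pairing L u G \<phi> = L2_inner L (advection u G) \<phi>"

text \<open>\<open>\<langle>Au, \<phi>\<rangle> = \<integral> \<nabla>u : \<nabla>\<phi>\<close> for \<open>u\<close> in \<open>V\<close> with \<open>G = \<nabla>u\<close>.\<close>

definition A_pairing :: "real \<Rightarrow> (real^2 \<Rightarrow> real^2^2) \<Rightarrow> (real^2 \<Rightarrow> real^2) \<Rightarrow> real" where
  "A_pairing L G \<phi> = L2_inner L G (\<lambda>x. jacobian \<phi> (at x))"

text \<open>
  A solution on the whole line is a function in \<open>C(\<real>; H) \<inter> L\<^sup>2\<^sub>l\<^sub>o\<^sub>c(\<real>; V)\<close> that satisfies
  \<open>du/dt + \<nu>Au + B(u, u) = g\<close> in \<open>V'\<close>, in the sense of distributions in time; since \<open>u\<close> is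
  continuous this is the same as the equation integrated over compact time intervals.
\<close>

definition nse_solution ::
  "real \<Rightarrow> real \<Rightarrow> (real^2 \<Rightarrow> real^2) \<Rightarrow> (real \<Rightarrow> real^2 \<Rightarrow> real^2) \<Rightarrow> bool" where
  "nse_solution L \<nu> g u \<longleftrightarrow>
     (\<forall>t. u t \<in> H_space L) \<and>
     (\<forall>t. ((\<lambda>s. L2_norm L (\<lambda>x. u s x - u t x)) \<longlongrightarrow> 0) (at t)) \<and>
     (\<exists>G. (AE t in lborel. has_gradient L (u t) (G t)) \<and>
          (\<forall>a b. set_integrable lebesgue {a..b} (\<lambda>t. (L2_norm L (G t))\<^sup>2)) \<and>
          (\<forall>\<phi>\<in>test_fields L. \<forall>s t. s \<le> t \<longrightarrow>
             ((\<lambda>\<tau>. L2_inner L g \<phi> - \<nu> * A_pairing L (G \<tau>) \<phi> - B_pairing L (u \<tau>) (G \<tau>) \<phi>)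
                has_integral (L2_inner L (u t) \<phi> - L2_inner L (u s) \<phi>)) {s..t}))"

definition global_attractor ::
  "real \<Rightarrow> real \<Rightarrow> (real^2 \<Rightarrow> real^2) \<Rightarrow> (real^2 \<Rightarrow> real^2) set" where
  "global_attractor L \<nu> g = {u0 \<in> H_space L. \<exists>u. nse_solution L \<nu> g u \<and>
     (AE x in Omega_measure L. u 0 x = u0 x) \<and>
     bdd_above (range (\<lambda>t. L2_norm L (u t)))}"

lemma trig_poly_continuous:
  assumes "trig_poly L v"
  shows "continuous_on S v"
proof -
  obtain K a b where v: "v = (\<lambda>x. \<Sum>k\<in>K. cos (phase L k x) *\<^sub>R a k + sin (phase L k x) *\<^sub>R b k)"
    using assms unfolding trig_poly_def by blast
  show ?thesis
    unfolding v phase_def by (intro continuous_intros)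
qed

lemma L2_space_continuous:
  fixes v :: "real^2 \<Rightarrow> 'a::euclidean_space"
  assumes "continuous_on (Omega L) v"
  shows "v \<in> L2_space L"
proof -
  have 1: "v \<in> borel_measurable (Omega_measure L)"
    using assms by (intro continuous_imp_measurable_on_sets_lebesgue) (auto simp: Omega_def)
  have "continuous_on (Omega L) (\<lambda>x. (norm (v x))\<^sup>2)"
    by (intro continuous_intros assms)
  then have "(\<lambda>x. (norm (v x))\<^sup>2) absolutely_integrable_on Omega L"
    unfolding Omega_def by (rule absolutely_integrable_continuous)
  then have "integrable (Omega_measure L) (\<lambda>x. (norm (v x))\<^sup>2)"
    by (subst integrable_restrict_space) (auto simp: Omega_def set_integrable_def)
  with 1 show ?thesis
    by (simp add: L2_space_def)
qed

lemma L2_inner_integrable: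
  assumes "f \<in> L2_space L" "h \<in> L2_space L"
  shows "integrable (Omega_measure L) (\<lambda>x. f x \<bullet> h x)"
proof (rule Bochner_Integration.integrable_bound)
  show "integrable (Omega_measure L) (\<lambda>x. (norm (f x))\<^sup>2 + (norm (h x))\<^sup>2)"
    using assms by (intro Bochner_Integration.integrable_add) (auto simp: L2_space_def)
  show "(\<lambda>x. f x \<bullet> h x) \<in> borel_measurable (Omega_measure L)"
    using assms by (intro borel_measurable_inner) (auto simp: L2_space_def)
  have "norm (f x \<bullet> h x) \<le> norm ((norm (f x))\<^sup>2 + (norm (h x))\<^sup>2)" for x
  proof -
    have "\<bar>f x \<bullet> h x\<bar> \<le> norm (f x) * norm (h x)"
      by (rule Cauchy_Schwarz_ineq2)
    also have "\<dots> \<le> (norm (f x))\<^sup>2 + (norm (h x))\<^sup>2"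
      using sum_squares_bound[of "norm (f x)" "norm (h x)"]
        mult_nonneg_nonneg[of "norm (f x)" "norm (h x)", OF norm_ge_zero norm_ge_zero]
      by linarith
    finally show ?thesis by simp
  qed
  then show "AE x in Omega_measure L.
      norm (f x \<bullet> h x) \<le> norm ((norm (f x))\<^sup>2 + (norm (h x))\<^sup>2)"
    by simp
qed

lemma test_fields_subset_H: "test_fields L \<subseteq> H_space L"
proof
  fix v assume v: "v \<in> test_fields L"
  then have "v \<in> L2_space L"
    by (auto intro: L2_space_continuous trig_poly_continuous simp: test_fields_def)
  moreover have "L2_norm L (\<lambda>x. v x - v x) = 0"
    by (simp add: L2_norm_def)
  ultimately show "v \<in> H_space L"
    unfolding H_space_def using v by force
qed

lemma B_pairing_eq:
  assumes "leray_proj L (advection u G) h" "\<phi> \<in> test_fields L"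
  shows "B_pairing L u G \<phi> = L2_inner L h \<phi>"
proof -
  let ?f = "advection u G"
  have \<phi>: "\<phi> \<in> H_space L"
    using assms(2) test_fields_subset_H by blast
  then have "integrable (Omega_measure L) (\<lambda>x. ?f x \<bullet> \<phi> x)"
    "integrable (Omega_measure L) (\<lambda>x. h x \<bullet> \<phi> x)"
    using assms(1) by (auto intro!: L2_inner_integrable simp: leray_proj_def H_space_def)
  moreover have "L2_inner L (\<lambda>x. ?f x - h x) \<phi> = 0"
    using assms(1) \<phi> by (simp add: leray_proj_def)
  ultimately show ?thesis
    by (simp add: B_pairing_def L2_inner_def inner_diff_left)
qed

end

theory Submission
  imports Defs
begin

text \<open>
  Write the solution as \<open>u = \<Sum> \<i> k\<^sup>\<bottom> \<psi>\<^sub>k exp(\<i> \<kappa> k\<cdot>x)\<close> with \<open>\<kappa> = 2\<pi>/L\<close> and \<open>k\<^sup>\<bottom> = (-k\<^sub>2, k\<^sub>1)\<close>. Since \<open>Ag = \<lambda>g\<close>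
  and both energy and enstrophy are conserved by the nonlinearity, \<open>\<Phi> = |A\<^sup>1\<^sup>/\<^sup>2u|\<^sup>2 - \<lambda>|u|\<^sup>2\<close> satisfies
  \<open>\<Phi>' = -2\<nu>\<lambda>\<Phi> - 2\<nu>|(A - \<lambda>)u|\<^sup>2\<close>. If \<open>u(0) = 0\<close>, then \<open>exp(2\<nu>\<lambda>t) \<Phi>(t)\<close> is nonincreasing, vanishes at
  \<open>t = 0\<close>, and tends to \<open>0\<close> at \<open>-\<infinity>\<close> because \<open>u\<close> is bounded. Hence \<open>Au = \<lambda>u\<close> for \<open>t \<le> 0\<close>; on the
  eigenspace the nonlinearity vanishes, so \<open>u' + \<nu>\<lambda>u = g\<close>, and boundedness as \<open>t \<rightarrow> -\<infinity>\<close> forces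
  \<open>u = g/(\<nu>\<lambda>)\<close>, which contradicts \<open>u(0) = 0 \<noteq> g\<close>.

  The enstrophy balance needs more regularity than a weak solution has by definition. It is
  obtained on the Fourier side. Put \<open>U\<^sub>k = |k| |\<psi>\<^sub>k|\<close>. Energy estimates for single modes with the time
  weight \<open>t - s\<close> give first \<open>sup U\<^sub>k = o(1/|k|)\<close>, and then, by absorbing the convolution into the left
  side in a truncated weighted norm, \<open>U\<^sub>k = O(|k|\<^sup>-\<^sup>4)\<close> locally uniformly in time.
\<close>

text \<open>What shapes the regularity part is that in two dimensions the quadratic term is exactly
  critical. If only \<open>U m \<le> e / lnorm m\<close> is known, the sum of
  \<open>1 / lnorm m\<close> over a ball of radius comparable to \<open>lnorm k\<close> is of order
  \<open>lnorm k\<close>, so the convolution loses precisely what the dissipation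
  \<open>\<alpha> * (lnorm k)\<^sup>2\<close> regains. A weighted supremum is then bounded by data
  plus a multiple of itself, and the estimate closes only if that multiple is below 1 and the
  supremum is finite beforehand. Smallness at high modes is taken from the tail of the
  time-integrated enstrophy, finiteness from the truncated weight. The second obstacle is the limit
  at \<open>-\<infinity>\<close>: a bound on \<open>|u|\<close> does not bound
  \<open>\<Phi>\<close>, which is of enstrophy type. The energy balance bounds only its integral
  over unit time; since \<open>\<Phi>\<close> turns out to be nonnegative and nonincreasing for
  \<open>t \<le> 0\<close>, this bounds its value at the end of the unit interval. Stream-function
  coefficients are used because they encode zero divergence and give interaction coefficients
  bounded by \<open>lnorm l * lnorm m\<close>, so that the nonlinearity is majorised by the
  convolution of \<open>U\<close> with itself.\<close>

section \<open>Energy estimate for indefinite integrals\<close>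

text \<open>\<open>F\<close> and \<open>H\<close> are given only as indefinite integrals, so
  differentiability is guaranteed merely almost everywhere. The product rule is therefore proved
  without derivatives: on a fine partition the defect \<open>P\<close> of the rule changes by an
  arbitrarily small amount in total.\<close>

lemma bilinear_indefinite_integral:
  fixes prod :: "'a::euclidean_space \<Rightarrow> 'b::euclidean_space \<Rightarrow> 'c::euclidean_space"
    and f F :: "real \<Rightarrow> 'a" and h H :: "real \<Rightarrow> 'b"
  assumes bil: "bounded_bilinear prod" and "s \<le> T"
    and f: "f absolutely_integrable_on {s..T}" and h: "h absolutely_integrable_on {s..T}"
    and F: "\<And>t. t \<in> {s..T} \<Longrightarrow> F t = F s + integral {s..t} f"
    and H: "\<And>t. t \<in> {s..T} \<Longrightarrow> H t = H s + integral {s..t} h"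
  shows "((\<lambda>\<tau>. prod (f \<tau>) (H \<tau>) + prod (F \<tau>) (h \<tau>))
           has_integral (prod (F T) (H T) - prod (F s) (H s))) {s..T}"
proof -
  interpret bounded_bilinear prod by fact
  obtain K where K: "K > 0" "\<And>a b. norm (prod a b) \<le> norm a * norm b * K"
    using pos_bounded by blast
  have fi: "f integrable_on {s..T}" and hi: "h integrable_on {s..T}"
    using f h absolutely_integrable_on_def by auto
  have cF: "continuous_on {s..T} F"
    by (subst continuous_on_cong[OF refl F]) (auto intro!: continuous_intros indefinite_integral_continuous_1 fi)
  have cH: "continuous_on {s..T} H"
    by (subst continuous_on_cong[OF refl H]) (auto intro!: continuous_intros indefinite_integral_continuous_1 hi)
  have Fd: "(f has_integral F y - F x) {x..y}" if "s \<le> x" "x \<le> y" "y \<le> T" for x y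
  proof -
    have "integral {s..x} f + integral {x..y} f = integral {s..y} f"
      using that by (intro Henstock_Kurzweil_Integration.integral_combine integrable_on_subinterval[OF fi]) auto
    then have "integral {x..y} f = F y - F x" using F[of x] F[of y] that by (simp add: algebra_simps)
    moreover have "f integrable_on {x..y}" using that by (intro integrable_on_subinterval[OF fi]) auto
    ultimately show ?thesis by (metis has_integral_integral)
  qed
  have Hd: "(h has_integral H y - H x) {x..y}" if "s \<le> x" "x \<le> y" "y \<le> T" for x y
  proof -
    have "integral {s..x} h + integral {x..y} h = integral {s..y} h"
      using that by (intro Henstock_Kurzweil_Integration.integral_combine integrable_on_subinterval[OF hi]) auto
    then have "integral {x..y} h = H y - H x" using H[of x] H[of y] that by (simp add: algebra_simps)
    moreover have "h integrable_on {x..y}" using that by (intro integrable_on_subinterval[OF hi]) auto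
    ultimately show ?thesis by (metis has_integral_integral)
  qed
  define g where "g = (\<lambda>\<tau>. prod (f \<tau>) (H \<tau>) + prod (F \<tau>) (h \<tau>))"
  have bil': "bilinear prod" "bilinear (\<lambda>x y. prod y x)"
    using bil bilinear_conv_bounded_bilinear bounded_bilinear.flip by blast+
  have cm: "u \<in> borel_measurable (lebesgue_on {s..T})" "bounded (u ` {s..T})"
    if "continuous_on {s..T} u" for u :: "real \<Rightarrow> 'd::euclidean_space"
    using that by (auto intro!: continuous_imp_measurable_on_sets_lebesgue compact_imp_bounded compact_continuous_image)
  have g1: "(\<lambda>\<tau>. prod (f \<tau>) (H \<tau>)) absolutely_integrable_on {s..T}"
    by (rule absolutely_integrable_bounded_measurable_product[OF bil'(2) cm(1)[OF cH] _ cm(2)[OF cH] f, simplified])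
  have g2: "(\<lambda>\<tau>. prod (F \<tau>) (h \<tau>)) absolutely_integrable_on {s..T}"
    by (rule absolutely_integrable_bounded_measurable_product[OF bil'(1) cm(1)[OF cF] _ cm(2)[OF cF] h, simplified])
  have gi: "g integrable_on {s..T}"
    unfolding g_def by (rule set_lebesgue_integral_eq_integral(1)[OF set_integral_add(1)[OF g1 g2]])
  define m where "m = (\<lambda>\<tau>. norm (f \<tau>) + norm (h \<tau>))"
  have mi: "m integrable_on {s..T}"
    unfolding m_def by (intro Henstock_Kurzweil_Integration.integrable_add absolutely_integrable_on_def[THEN iffD1, THEN conjunct2] f h)
  define P where "P = (\<lambda>t. prod (F t) (H t) - integral {s..t} g)"
  have step: "norm (P y - P x) \<le> K * e * integral {x..y} m"
    if xy: "s \<le> x" "x \<le> y" "y \<le> T" and e: "\<And>\<sigma>. \<sigma> \<in> {x..y} \<Longrightarrow> norm (H y - H \<sigma>) \<le> e"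
       "\<And>\<sigma>. \<sigma> \<in> {x..y} \<Longrightarrow> norm (F x - F \<sigma>) \<le> e" for x y e
  proof -
    have sub: "u integrable_on {x..y}" if "u integrable_on {s..T}" for u :: "real \<Rightarrow> 'd::euclidean_space"
      using xy by (intro integrable_on_subinterval[OF that]) auto
    have "integral {s..x} g + integral {x..y} g = integral {s..y} g"
      using xy by (intro Henstock_Kurzweil_Integration.integral_combine integrable_on_subinterval[OF gi]) auto
    then have PP: "P y - P x = prod (F y) (H y) - prod (F x) (H x) - integral {x..y} g"
      by (simp add: P_def algebra_simps)
    \<comment> \<open>Freezing \<open>H\<close> at the right end and \<open>F\<close> at the left
      end makes the two frozen integrals add up to the exact increment of
      \<open>prod (F t) (H t)\<close>. What remains involves only oscillations of \<open>F\<close>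
      and \<open>H\<close> over the short interval.\<close>
    have a: "((\<lambda>\<sigma>. prod (f \<sigma>) (H y)) has_integral prod (F y - F x) (H y)) {x..y}"
      using has_integral_linear[OF Fd[OF xy] bounded_linear_left] by (simp add: o_def)
    have b: "((\<lambda>\<sigma>. prod (F x) (h \<sigma>)) has_integral prod (F x) (H y - H x)) {x..y}"
      using has_integral_linear[OF Hd[OF xy] bounded_linear_right] by (simp add: o_def)
    have gxy: "(g has_integral integral {x..y} g) {x..y}" using sub[OF gi] by (rule integrable_integral)
    have "((\<lambda>\<sigma>. prod (f \<sigma>) (H y) + prod (F x) (h \<sigma>) - g \<sigma>) has_integral
        prod (F y - F x) (H y) + prod (F x) (H y - H x) - integral {x..y} g) {x..y}"
      by (intro has_integral_diff has_integral_add a b gxy)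
    moreover have "prod (F y - F x) (H y) + prod (F x) (H y - H x) - integral {x..y} g = P y - P x"
      unfolding PP by (simp add: diff_left diff_right)
    moreover have "(\<lambda>\<sigma>. prod (f \<sigma>) (H y) + prod (F x) (h \<sigma>) - g \<sigma>) =
        (\<lambda>\<sigma>. prod (f \<sigma>) (H y - H \<sigma>) + prod (F x - F \<sigma>) (h \<sigma>))"
      by (auto simp: g_def diff_left diff_right)
    ultimately have D: "((\<lambda>\<sigma>. prod (f \<sigma>) (H y - H \<sigma>) + prod (F x - F \<sigma>) (h \<sigma>)) has_integral P y - P x) {x..y}"
      by simp
    have bd: "norm (prod (f \<sigma>) (H y - H \<sigma>) + prod (F x - F \<sigma>) (h \<sigma>)) \<le> (K * e) * m \<sigma>" if "\<sigma> \<in> {x..y}" for \<sigma>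
    proof -
      have "norm (prod (f \<sigma>) (H y - H \<sigma>)) \<le> norm (f \<sigma>) * norm (H y - H \<sigma>) * K" by (rule K)
      also have "\<dots> \<le> norm (f \<sigma>) * e * K" using e(1)[OF that] K(1) by (intro mult_right_mono mult_left_mono) auto
      finally have 1: "norm (prod (f \<sigma>) (H y - H \<sigma>)) \<le> norm (f \<sigma>) * e * K" .
      have "norm (prod (F x - F \<sigma>) (h \<sigma>)) \<le> norm (F x - F \<sigma>) * norm (h \<sigma>) * K" by (rule K)
      also have "\<dots> \<le> e * norm (h \<sigma>) * K" using e(2)[OF that] K(1) by (intro mult_right_mono) auto
      finally have 2: "norm (prod (F x - F \<sigma>) (h \<sigma>)) \<le> e * norm (h \<sigma>) * K" .
      show ?thesis using norm_triangle_mono[OF 1 2] by (simp add: m_def algebra_simps)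
    qed
    have "norm (P y - P x) \<le> integral {x..y} (\<lambda>\<sigma>. (K * e) * m \<sigma>)"
      using integral_norm_bound_integral[OF has_integral_integrable[OF D] _ bd] integral_unique[OF D]
        integrable_on_cmult_left[OF sub[OF mi]] by simp
    then show ?thesis by simp
  qed
  txt \<open>The defect in the product rule over a short interval is small compared to its \<open>m\<close>-mass.\<close>
  have "norm (P T - P s) \<le> \<epsilon>" if "\<epsilon> > 0" for \<epsilon>
  proof -
    define I where "I = integral {s..T} m"
    have I0: "I \<ge> 0" unfolding I_def by (rule integral_nonneg[OF mi]) (simp add: m_def)
    \<comment> \<open>The \<open>+ 1\<close> covers the case \<open>I = 0\<close>.\<close>
    define e where "e = \<epsilon> / (K * (I + 1))"
    have e0: "e > 0" using that K I0 by (simp add: e_def)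
    have "uniformly_continuous_on {s..T} F" "uniformly_continuous_on {s..T} H"
      using cF cH compact_uniformly_continuous by blast+
    then obtain d1 d2 where d: "d1 > 0" "d2 > 0"
      "\<And>x y. x \<in> {s..T} \<Longrightarrow> y \<in> {s..T} \<Longrightarrow> dist y x < d1 \<Longrightarrow> dist (F y) (F x) < e"
      "\<And>x y. x \<in> {s..T} \<Longrightarrow> y \<in> {s..T} \<Longrightarrow> dist y x < d2 \<Longrightarrow> dist (H y) (H x) < e"
      unfolding uniformly_continuous_on_def using e0 by metis
    define d0 where "d0 = min d1 d2"
    have d0: "d0 > 0" using d by (simp add: d0_def)
    obtain n :: nat where n: "(T - s) / d0 < real n" using reals_Archimedean2 by blast
    then have n0: "n > 0" using d0 \<open>s \<le> T\<close> by (cases n) (auto simp: field_simps divide_nonneg_pos not_less)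
    define x where "x i = s + real i * ((T - s) / n)" for i
    have xm: "x i \<le> x (Suc i)" "s \<le> x i" for i using \<open>s \<le> T\<close> by (auto simp: x_def intro!: divide_right_mono mult_right_mono mult_nonneg_nonneg)
    have xT: "x i \<le> T" if "i \<le> n" for i
    proof -
      have "real i * (T - s) \<le> real n * (T - s)" using that \<open>s \<le> T\<close> by (intro mult_right_mono) auto
      then show ?thesis using n0 by (simp add: x_def field_simps)
    qed
    have xd: "x (Suc i) - x i < min d1 d2" for i
    proof -
      have "x (Suc i) - x i = (T - s) / n" by (simp add: x_def algebra_simps add_divide_distrib diff_divide_distrib)
      also have "\<dots> < d0" using n n0 d0 by (simp add: field_simps)
      finally show ?thesis unfolding d0_def .
    qed
    have mono: "norm (P (x i) - P s) \<le> K * e * integral {s..x i} m" if "i \<le> n" for i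
      using that
    proof (induction i)
      case 0 then show ?case by (simp add: x_def)
    next
      case (Suc i)
      have "norm (P (x (Suc i)) - P (x i)) \<le> K * e * integral {x i..x (Suc i)} m"
      proof (rule step)
        show "s \<le> x i" "x i \<le> x (Suc i)" by (rule xm)+
        show "x (Suc i) \<le> T" using Suc xT by blast
        fix \<sigma> assume \<sigma>: "\<sigma> \<in> {x i..x (Suc i)}"
        have in': "\<sigma> \<in> {s..T}" "x i \<in> {s..T}" "x (Suc i) \<in> {s..T}"
          using \<sigma> xm[of i] xm[of "Suc i"] xT[OF Suc(2)] by auto
        show "norm (H (x (Suc i)) - H \<sigma>) \<le> e"
          using d(4)[of \<sigma> "x (Suc i)"] in' \<sigma> xd[of i] by (auto simp: dist_norm)
        show "norm (F (x i) - F \<sigma>) \<le> e"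
          using d(3)[of \<sigma> "x i"] in' \<sigma> xd[of i] by (auto simp: dist_norm)
      qed
      moreover have "integral {s..x i} m + integral {x i..x (Suc i)} m = integral {s..x (Suc i)} m"
        using xm[of i] xT[OF Suc(2)] by (intro Henstock_Kurzweil_Integration.integral_combine integrable_on_subinterval[OF mi]) auto
      moreover have "norm (P (x i) - P s) \<le> K * e * integral {s..x i} m" using Suc by auto
      moreover have "norm (P (x (Suc i)) - P s) \<le> norm (P (x (Suc i)) - P (x i)) + norm (P (x i) - P s)"
        using norm_triangle_ineq[of "P (x (Suc i)) - P (x i)" "P (x i) - P s"] by simp
      ultimately show ?case by (smt (verit, best) distrib_left)
    qed
    have "x n = T" using n0 by (simp add: x_def)
    then have "norm (P T - P s) \<le> K * e * I" using mono[of n] I_def by simp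
    also have "\<dots> \<le> K * e * (I + 1)" using K e0 by (intro mult_left_mono) auto
    also have "\<dots> = \<epsilon>" using K I0 by (simp add: e_def)
    finally show ?thesis .
  qed
  then have "P T = P s" by (metis dense_ge eq_iff_diff_eq_0 norm_le_zero_iff)
  then have "integral {s..T} g = prod (F T) (H T) - prod (F s) (H s)" by (simp add: P_def algebra_simps)
  then show ?thesis using gi unfolding g_def by (metis has_integral_integral)
qed

text \<open>For \<open>v \<tau> = (\<tau> - s) *\<^sub>R z \<tau>\<close> the equation reads
  \<open>v' = q - a v\<close> with \<open>q = z + (\<tau> - s) h\<close>, and \<open>bd\<close>
  bounds \<open>q\<close> by \<open>H\<close>. Pairing with \<open>v\<close> and splitting
  \<open>2 |v| H\<close> into \<open>a |v|^2 + H^2 / a\<close> leaves half of the dissipation. The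
  weight vanishes at \<open>s\<close>, so the value of \<open>z\<close> there does not enter the
  bound.\<close>

lemma weighted_energy:
  fixes z h :: "real \<Rightarrow> complex" and H :: "real \<Rightarrow> real"
  assumes "s \<le> T" "a > 0"
    and eq: "\<And>t. t \<in> {s..T} \<Longrightarrow> ((\<lambda>\<tau>. h \<tau> - a *\<^sub>R z \<tau>) has_integral (z t - z s)) {s..t}"
    and h: "h absolutely_integrable_on {s..T}"
    and cz: "continuous_on {s..T} z"
    and Hi: "(\<lambda>\<tau>. (H \<tau>)\<^sup>2) integrable_on {s..T}"
    and bd: "\<And>\<tau>. \<tau> \<in> {s..T} \<Longrightarrow> norm (z \<tau>) + (\<tau> - s) * norm (h \<tau>) \<le> H \<tau>"
  shows "((T - s) * norm (z T))\<^sup>2 + a * integral {s..T} (\<lambda>\<tau>. ((\<tau> - s) * norm (z \<tau>))\<^sup>2)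
         \<le> (1 / a) * integral {s..T} (\<lambda>\<tau>. (H \<tau>)\<^sup>2)"
proof -
  have zi: "z absolutely_integrable_on {s..T}"
    using cz absolutely_integrable_continuous_real by blast
  have fi: "(\<lambda>\<tau>. h \<tau> - a *\<^sub>R z \<tau>) absolutely_integrable_on {s..T}"
    by (intro set_integral_diff h absolutely_integrable_scaleR_left zi)
  define v where "v \<tau> = (\<tau> - s) *\<^sub>R z \<tau>" for \<tau>
  define v' where "v' \<tau> = 1 *\<^sub>R z \<tau> + (\<tau> - s) *\<^sub>R (h \<tau> - a *\<^sub>R z \<tau>)" for \<tau>
  have vint: "(v' has_integral v t - v s) {s..t}" if "t \<in> {s..T}" for t
  proof -
    have "{s..t} \<subseteq> {s..T}" using that by auto
    then have "(\<lambda>\<tau>. h \<tau> - a *\<^sub>R z \<tau>) absolutely_integrable_on {s..t}"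
      using fi absolutely_integrable_on_subinterval by blast
    then show ?thesis
      unfolding v'_def v_def
      using that eq[THEN integral_unique]
      by (intro bilinear_indefinite_integral[OF bounded_bilinear_scaleR, where f="\<lambda>_. 1"])
        (auto simp: algebra_simps)
  qed
  have v'i: "v' absolutely_integrable_on {s..T}"
  proof -
    have "(\<lambda>\<tau>. (\<tau> - s) *\<^sub>R (h \<tau> - a *\<^sub>R z \<tau>)) absolutely_integrable_on {s..T}"
      by (rule absolutely_integrable_bounded_measurable_product[OF _ _ _ _ fi])
        (auto intro!: continuous_imp_measurable_on_sets_lebesgue continuous_intros compact_imp_bounded compact_continuous_image
          bounded_bilinear_scaleR[THEN bilinear_conv_bounded_bilinear[THEN iffD2]])
    then show ?thesis unfolding v'_def using zi by (simp add: set_integral_add(1))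
  qed
  have "((\<lambda>\<tau>. v' \<tau> \<bullet> v \<tau> + v \<tau> \<bullet> v' \<tau>) has_integral v T \<bullet> v T - v s \<bullet> v s) {s..T}"
    using \<open>s \<le> T\<close> vint[THEN integral_unique]
    by (intro bilinear_indefinite_integral[OF bounded_bilinear_inner _ v'i v'i]) (auto simp: algebra_simps)
  then have E: "((\<lambda>\<tau>. v' \<tau> \<bullet> v \<tau> + v \<tau> \<bullet> v' \<tau>) has_integral (norm (v T))\<^sup>2) {s..T}"
    by (simp add: v_def[of s] dot_square_norm)
  have cv: "(\<lambda>\<tau>. (norm (v \<tau>))\<^sup>2) integrable_on {s..T}"
    unfolding v_def by (intro integrable_continuous_real continuous_intros cz)
  have i1: "(\<lambda>\<tau>. (1/a) * (H \<tau>)\<^sup>2) integrable_on {s..T}"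
    using integrable_on_cmult_left[OF Hi, of "1/a"] by simp
  have i2: "(\<lambda>\<tau>. a * (norm (v \<tau>))\<^sup>2) integrable_on {s..T}"
    using integrable_on_cmult_left[OF cv, of a] by simp
  have "(norm (v T))\<^sup>2 \<le> integral {s..T} (\<lambda>\<tau>. (1/a) * (H \<tau>)\<^sup>2 - a * (norm (v \<tau>))\<^sup>2)"
  proof (rule has_integral_le[OF E])
    show "((\<lambda>\<tau>. (1/a) * (H \<tau>)\<^sup>2 - a * (norm (v \<tau>))\<^sup>2) has_integral
       integral {s..T} (\<lambda>\<tau>. (1/a) * (H \<tau>)\<^sup>2 - a * (norm (v \<tau>))\<^sup>2)) {s..T}"
      by (intro integrable_integral integrable_diff i1 i2)
    fix \<tau> assume \<tau>: "\<tau> \<in> {s..T}"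
    define q where "q = z \<tau> + (\<tau> - s) *\<^sub>R h \<tau>"
    have v'q: "v' \<tau> = q - a *\<^sub>R v \<tau>" by (simp add: v'_def q_def v_def algebra_simps)
    have "norm q \<le> norm (z \<tau>) + (\<tau> - s) * norm (h \<tau>)"
      unfolding q_def using \<tau> norm_triangle_ineq[of "z \<tau>" "(\<tau> - s) *\<^sub>R h \<tau>"] by simp
    then have qH: "norm q \<le> H \<tau>" using bd[OF \<tau>] by simp
    have "v \<tau> \<bullet> q \<le> norm (v \<tau>) * H \<tau>"
      using norm_cauchy_schwarz[of "v \<tau>" q] mult_left_mono[OF qH, of "norm (v \<tau>)"] by simp
    moreover have "2 * (norm (v \<tau>) * H \<tau>) \<le> a * (norm (v \<tau>))\<^sup>2 + (1/a) * (H \<tau>)\<^sup>2"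
    proof -
      have "0 \<le> (1/a) * (a * norm (v \<tau>) - H \<tau>)\<^sup>2" using \<open>a > 0\<close> by simp
      also have "\<dots> = a * (norm (v \<tau>))\<^sup>2 + (1/a) * (H \<tau>)\<^sup>2 - 2 * (norm (v \<tau>) * H \<tau>)"
        using \<open>a > 0\<close> by (simp add: power2_eq_square field_simps)
      finally show ?thesis by simp
    qed
    moreover have "v' \<tau> \<bullet> v \<tau> + v \<tau> \<bullet> v' \<tau> = 2 * (v \<tau> \<bullet> q) - 2 * a * (norm (v \<tau>))\<^sup>2"
      by (simp add: v'q inner_diff_left inner_diff_right inner_commute power2_norm_eq_inner)
    ultimately show "v' \<tau> \<bullet> v \<tau> + v \<tau> \<bullet> v' \<tau> \<le> (1/a) * (H \<tau>)\<^sup>2 - a * (norm (v \<tau>))\<^sup>2" by linarith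
  qed
  also have "\<dots> = (1/a) * integral {s..T} (\<lambda>\<tau>. (H \<tau>)\<^sup>2) - a * integral {s..T} (\<lambda>\<tau>. (norm (v \<tau>))\<^sup>2)"
    by (subst Henstock_Kurzweil_Integration.integral_diff[OF i1 i2]) simp
  finally have "(norm (v T))\<^sup>2 + a * integral {s..T} (\<lambda>\<tau>. (norm (v \<tau>))\<^sup>2) \<le> (1/a) * integral {s..T} (\<lambda>\<tau>. (H \<tau>)\<^sup>2)" by simp
  moreover have "integral {s..T} (\<lambda>\<tau>. (norm (v \<tau>))\<^sup>2) = integral {s..T} (\<lambda>\<tau>. ((\<tau> - s) * norm (z \<tau>))\<^sup>2)"
    by (simp add: v_def power_mult_distrib)
  moreover have "norm (v T) = (T - s) * norm (z T)" using \<open>s \<le> T\<close> by (simp add: v_def)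
  ultimately show ?thesis by simp
qed

section \<open>Lattice sums\<close>

definition lnorm :: "int \<times> int \<Rightarrow> real" where
  "lnorm k = norm (real_of_int (fst k), real_of_int (snd k))"

lemma lnorm_power2: "(lnorm k)\<^sup>2 = (real_of_int (fst k))\<^sup>2 + (real_of_int (snd k))\<^sup>2"
  by (simp add: lnorm_def norm_Pair)

lemma lnorm_nonneg [simp]: "0 \<le> lnorm k"
  by (simp add: lnorm_def)

lemma lnorm_zero [simp]: "lnorm 0 = 0"
  by (simp add: lnorm_def)

lemma lnorm_minus [simp]: "lnorm (- k) = lnorm k"
  by (simp add: lnorm_def norm_Pair)

lemma lnorm_triangle: "lnorm (k + l) \<le> lnorm k + lnorm l"
  unfolding lnorm_def using norm_triangle_ineq[of "(real_of_int (fst k), real_of_int (snd k))" "(real_of_int (fst l), real_of_int (snd l))"]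
  by simp

lemma lnorm_triangle_diff: "lnorm k \<le> lnorm l + lnorm (k - l)"
  using lnorm_triangle[of l "k - l"] by simp

lemma lnorm_diff_commute: "lnorm (k - l) = lnorm (l - k)"
  using lnorm_minus[of "k - l"] by simp

lemma lnorm_ge_1: assumes "k \<noteq> 0" shows "1 \<le> lnorm k"
proof -
  have "fst k \<noteq> 0 \<or> snd k \<noteq> 0" using assms by (cases k) (auto simp: zero_prod_def)
  then have "0 < (fst k)\<^sup>2 + (snd k)\<^sup>2" by (simp add: sum_power2_gt_zero_iff)
  then have "1 \<le> (fst k)\<^sup>2 + (snd k)\<^sup>2" by linarith
  then have "1 \<le> (lnorm k)\<^sup>2" unfolding lnorm_power2 by (metis of_int_1_le_iff of_int_add of_int_power)
  then show ?thesis by (metis lnorm_nonneg one_power2 power2_le_imp_le)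
qed

lemma lnorm_pos: "k \<noteq> 0 \<Longrightarrow> 0 < lnorm k"
  using lnorm_ge_1[of k] by simp

text \<open>Square boxes have shells of exactly known size (\<open>card_shell\<close>), which turns
  lattice sums into sums over shells; the comparison with \<open>lnorm\<close> costs at most a
  factor 2.\<close>

definition lbox :: "nat \<Rightarrow> (int \<times> int) set" where
  "lbox n = {- int n..int n} \<times> {- int n..int n}"

lemma finite_lbox [simp]: "finite (lbox n)" by (simp add: lbox_def)

lemma lbox_mono: "m \<le> n \<Longrightarrow> lbox m \<subseteq> lbox n" by (auto simp: lbox_def)

lemma card_lbox: "card (lbox n) = (2 * n + 1)\<^sup>2"
  by (simp add: lbox_def power2_eq_square card_cartesian_product nat_add_distrib nat_mult_distrib)

lemma lnorm_le_imp_lbox: assumes "lnorm k \<le> real n" shows "k \<in> lbox n"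
proof -
  have "\<bar>real_of_int (fst k)\<bar> \<le> lnorm k" "\<bar>real_of_int (snd k)\<bar> \<le> lnorm k"
    unfolding lnorm_def using norm_fst_le[of "real_of_int (fst k)" "real_of_int (snd k)"]
      norm_snd_le[of "real_of_int (snd k)" "real_of_int (fst k)"] by (auto simp: real_norm_def)
  then have "\<bar>fst k\<bar> \<le> int n" "\<bar>snd k\<bar> \<le> int n" using assms by linarith+
  then show ?thesis by (cases k) (auto simp: lbox_def)
qed

lemma not_lbox_imp_lnorm: "k \<notin> lbox n \<Longrightarrow> real n < lnorm k"
  using lnorm_le_imp_lbox not_le by blast

lemma lbox_imp_lnorm: assumes "k \<in> lbox n" shows "lnorm k \<le> 2 * real n"
proof -
  have "\<bar>fst k\<bar> \<le> int n" "\<bar>snd k\<bar> \<le> int n" using assms by (auto simp: lbox_def)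
  then have "\<bar>real_of_int (fst k)\<bar> \<le> n" "\<bar>real_of_int (snd k)\<bar> \<le> n" by linarith+
  moreover have "lnorm k \<le> \<bar>real_of_int (fst k)\<bar> + \<bar>real_of_int (snd k)\<bar>"
    unfolding lnorm_def norm_Pair using sqrt_sum_squares_le_sum_abs by simp
  ultimately show ?thesis by linarith
qed

lemma finite_lnorm_le: "finite {k. lnorm k \<le> R}"
proof -
  obtain n where "R \<le> real n" using real_arch_simple by blast
  then have "{k. lnorm k \<le> R} \<subseteq> lbox n" using lnorm_le_imp_lbox by fastforce
  then show ?thesis by (rule finite_subset) simp
qed

lemma card_shell: "card (lbox (Suc n) - lbox n) = 8 * (n + 1)"
  by (subst card_Diff_subset) (auto simp: card_lbox lbox_mono power2_eq_square algebra_simps)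

lemma finite_subset_lbox: assumes "finite F" obtains n where "F \<subseteq> lbox n"
proof -
  have "\<exists>n. F \<subseteq> lbox n"
    using assms
  proof (induction F rule: finite_induct)
    case (insert x F)
    then obtain n where n: "F \<subseteq> lbox n" by auto
    obtain m where "lnorm x \<le> real m" using real_arch_simple by blast
    then have "insert x F \<subseteq> lbox (max m n)"
      using n lbox_mono[of n "max m n"] lbox_mono[of m "max m n"] lnorm_le_imp_lbox by auto
    then show ?case by blast
  qed auto
  then show ?thesis using that by blast
qed

lemma filterlim_lbox: "filterlim lbox (finite_subsets_at_top UNIV) sequentially"
  unfolding filterlim_iff
proof (intro allI impI)
  fix P assume "eventually P (finite_subsets_at_top (UNIV :: (int \<times> int) set))"
  then obtain X :: "(int \<times> int) set" where X: "finite X" "\<And>Y. finite Y \<Longrightarrow> X \<subseteq> Y \<Longrightarrow> P Y"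
    unfolding eventually_finite_subsets_at_top by auto
  obtain n where n: "X \<subseteq> lbox n" using finite_subset_lbox X by blast
  show "eventually (\<lambda>n. P (lbox n)) sequentially"
    unfolding eventually_sequentially
  proof (intro exI[of _ n] allI impI)
    fix m assume "n \<le> m"
    then have "X \<subseteq> lbox m" using n lbox_mono[of n m] by simp
    then show "P (lbox m)" using X(2) by simp
  qed
qed

text \<open>A shell has \<open>8 * (n + 1)\<close> points, each contributing at most
  \<open>2 / (n + 1)\<close>, so every shell adds at most 16. This linear growth in \<open>R\<close>
  is the critical loss in the convolution estimate.\<close>

lemma sum_inverse_lnorm_ball:
  assumes "R \<ge> 0" "F \<subseteq> {k. k \<noteq> 0 \<and> lnorm k \<le> R}"
  shows "(\<Sum>k\<in>F. 1 / lnorm k) \<le> 16 * (R + 1)"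
proof -
  have *: "(\<Sum>k\<in>lbox n - {0}. 1 / lnorm k) \<le> 16 * real n" for n
  proof (induction n)
    case 0
    have "lbox 0 - {0} = {}" by (auto simp: lbox_def zero_prod_def)
    then show ?case by (simp only: sum.empty)
  next
    case (Suc n)
    have b: "1 / lnorm k \<le> 2 / (real n + 1)" if "k \<noteq> 0" "lnorm k > real n" for k
      using that lnorm_ge_1[OF that(1)] by (simp add: field_simps)
    have z: "0 \<in> lbox n" by (simp add: lbox_def zero_prod_def)
    have "(\<Sum>k\<in>lbox (Suc n) - lbox n. 1 / lnorm k) \<le> of_nat (card (lbox (Suc n) - lbox n)) * (2 / (real n + 1))"
      using z by (intro sum_bounded_above b) (auto intro: not_lbox_imp_lnorm)
    also have "\<dots> = 16" by (simp add: card_shell field_simps)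
    finally have "(\<Sum>k\<in>lbox (Suc n) - lbox n. 1 / lnorm k) \<le> 16" .
    moreover have "lbox (Suc n) - {0} = (lbox n - {0}) \<union> (lbox (Suc n) - lbox n)"
      using z lbox_mono[of n "Suc n"] by auto
    then have "(\<Sum>k\<in>lbox (Suc n) - {0}. 1 / lnorm k) = (\<Sum>k\<in>lbox n - {0}. 1 / lnorm k) + (\<Sum>k\<in>lbox (Suc n) - lbox n. 1 / lnorm k)"
      by (simp only:) (rule sum.union_disjoint; auto)
    ultimately show ?case using Suc by (simp add: algebra_simps)
  qed
  define n where "n = nat \<lceil>R\<rceil>"
  have n: "R \<le> real n" "real n \<le> R + 1" using assms(1) unfolding n_def by linarith+
  have "F \<subseteq> lbox n - {0}" using assms(2) n lnorm_le_imp_lbox by fastforce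
  then have "(\<Sum>k\<in>F. 1 / lnorm k) \<le> (\<Sum>k\<in>lbox n - {0}. 1 / lnorm k)"
    by (intro sum_mono2) auto
  also have "\<dots> \<le> 16 * real n" by (rule *)
  finally show ?thesis using n by simp
qed

text \<open>With \<open>x\<close> the index of a shell, \<open>8 * x\<close> points of size at most
  \<open>8 / x ^ 3\<close> give \<open>64 / x\<^sup>2\<close>, which is dominated by the telescoping
  difference \<open>128 * (1 / x - 1 / (x + 1))\<close>.\<close>

lemma sum_inverse_lnorm_cube_tail:
  assumes "R \<ge> 1" "finite F" "F \<subseteq> {k. lnorm k \<ge> R}"
  shows "(\<Sum>k\<in>F. 1 / lnorm k ^ 3) \<le> 512 / R"
proof -
  \<comment> \<open>The induction over shells starts from a box of half side about
    \<open>R / 2\<close>. Its points beyond \<open>R\<close> are counted crudely as at most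
    \<open>(2 * R)\<^sup>2\<close> terms of size at most \<open>1 / R ^ 3\<close>; this is the
    origin of the summand \<open>128 / R\<close>.\<close>
  define n0 where "n0 = nat \<lfloor>R / 2\<rfloor>"
  have n0: "real n0 \<le> R / 2" "R / 2 < real n0 + 1" using assms(1) unfolding n0_def by linarith+
  have *: "(\<Sum>k\<in>lbox (n0 + j) - {k. lnorm k < R}. 1 / lnorm k ^ 3) \<le> 128 * (1 / (real n0 + 1) - 1 / (real n0 + j + 1)) + 128 / R" for j
  proof (induction j)
    case 0
    have "(\<Sum>k\<in>lbox n0 - {k. lnorm k < R}. 1 / lnorm k ^ 3) \<le> (\<Sum>k\<in>lbox n0 - {k. lnorm k < R}. 1 / R ^ 3)"
      using assms(1) by (intro sum_mono divide_left_mono power_mono mult_pos_pos zero_less_power) auto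
    also have "\<dots> = card (lbox n0 - {k. lnorm k < R}) / R ^ 3" by simp
    also have "\<dots> \<le> card (lbox n0) / R ^ 3" using assms(1) by (intro divide_right_mono) (auto intro: card_mono)
    also have "(1 + 2 * real n0)\<^sup>2 \<le> (2 * R)\<^sup>2" using n0 assms(1) by (intro power_mono) auto
    then have "real (card (lbox n0)) \<le> (2 * R)\<^sup>2" by (simp add: card_lbox)
    then have "card (lbox n0) / R ^ 3 \<le> (2 * R)\<^sup>2 / R ^ 3" using assms(1) by (intro divide_right_mono) auto
    also have "\<dots> \<le> 128 / R" using assms(1) by (simp add: field_simps power2_eq_square power3_eq_cube)
    finally show ?case by simp
  next
    case (Suc j)
    let ?n = "real n0 + real j + 1"
    have n1: "?n \<ge> 1" by simp
    have b: "1 / lnorm k ^ 3 \<le> 8 / ?n ^ 3" if "real (n0 + j) < lnorm k" "R \<le> lnorm k" for k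
    proof -
      have "?n / 2 \<le> lnorm k" using that assms(1) by simp
      then have "(?n / 2) ^ 3 \<le> lnorm k ^ 3" using n1 by (intro power_mono) auto
      then have "1 / lnorm k ^ 3 \<le> 1 / (?n / 2) ^ 3" using n1 by (intro divide_left_mono mult_pos_pos zero_less_power) (auto intro: less_le_trans[of 0 "?n/2"])
      also have "\<dots> = 8 / ?n ^ 3" by (simp add: power_divide)
      finally show ?thesis .
    qed
    have alg: "(8 * x) * (8 / x ^ 3) = 64 / x\<^sup>2" if "x \<ge> 1" for x :: real
      using that by (simp add: power2_eq_square power3_eq_cube)
    have alg2: "64 / x\<^sup>2 \<le> 128 * (1 / x - 1 / (x + 1))" if "x \<ge> 1" for x :: real
    proof -
      have "1 / x - 1 / (x + 1) = 1 / (x * (x + 1))" using that by (simp add: field_simps)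
      moreover have "1 / (x * (2 * x)) \<le> 1 / (x * (x + 1))"
        using that by (intro divide_left_mono mult_left_mono mult_pos_pos) auto
      ultimately show ?thesis by (simp add: power2_eq_square)
    qed
    let ?S = "lbox (n0 + Suc j) - lbox (n0 + j) - {k. lnorm k < R}"
    have "(\<Sum>k\<in>?S. 1 / lnorm k ^ 3) \<le> real (card ?S) * (8 / ?n ^ 3)"
      by (intro sum_bounded_above b) (auto intro: not_lbox_imp_lnorm[of _ "n0 + j", simplified])
    also have "\<dots> \<le> real (card (lbox (n0 + Suc j) - lbox (n0 + j))) * (8 / ?n ^ 3)"
      using n1 by (intro mult_right_mono) (auto intro!: card_mono)
    also have "\<dots> = (8 * ?n) * (8 / ?n ^ 3)" using card_shell[of "n0 + j"] by simp
    also have "\<dots> = 64 / ?n\<^sup>2" by (rule alg[OF n1])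
    also have "\<dots> \<le> 128 * (1 / ?n - 1 / (?n + 1))" by (rule alg2[OF n1])
    finally have 1: "(\<Sum>k\<in>?S. 1 / lnorm k ^ 3) \<le> 128 * (1 / ?n - 1 / (?n + 1))" .
    have "lbox (n0 + Suc j) - {k. lnorm k < R} = (lbox (n0 + j) - {k. lnorm k < R}) \<union> ?S"
      using lbox_mono[of "n0 + j" "n0 + Suc j"] by auto
    then have "(\<Sum>k\<in>lbox (n0 + Suc j) - {k. lnorm k < R}. 1 / lnorm k ^ 3) =
       (\<Sum>k\<in>lbox (n0 + j) - {k. lnorm k < R}. 1 / lnorm k ^ 3) + (\<Sum>k\<in>?S. 1 / lnorm k ^ 3)"
      by (simp only:) (rule sum.union_disjoint; auto)
    with 1 Suc show ?case by (simp add: algebra_simps)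
  qed
  obtain n where n: "F \<subseteq> lbox n" using finite_subset_lbox assms(2) by blast
  have "F \<subseteq> lbox (n0 + n) - {k. lnorm k < R}" using n lbox_mono[of n "n0 + n"] assms(3) by auto
  then have "(\<Sum>k\<in>F. 1 / lnorm k ^ 3) \<le> (\<Sum>k\<in>lbox (n0 + n) - {k. lnorm k < R}. 1 / lnorm k ^ 3)"
    by (intro sum_mono2) auto
  also have "\<dots> \<le> 128 * (1 / (real n0 + 1)) + 128 / R" 
  proof -
    have "0 \<le> 1 / (real n0 + real n + 1)" by simp
    then show ?thesis using *[of n] unfolding right_diff_distrib by linarith
  qed
  also have "1 / (real n0 + 1) \<le> 1 / (R / 2)" using n0 assms(1) by (intro divide_left_mono) auto
  finally show ?thesis using assms(1) by (simp add: field_simps)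
qed

lemma cube_summable: "(\<lambda>k. 1 / lnorm k ^ 3) summable_on UNIV"
proof (rule nonneg_bdd_above_summable_on)
  show "bdd_above (sum (\<lambda>k. 1 / lnorm k ^ 3) ` {F. F \<subseteq> UNIV \<and> finite F})"
  proof (rule bdd_aboveI2)
    fix F :: "(int \<times> int) set" assume "F \<in> {F. F \<subseteq> UNIV \<and> finite F}"
    then have F: "finite F" by simp
    have "(\<Sum>k\<in>F. 1 / lnorm k ^ 3) = (\<Sum>k\<in>F - {0}. 1 / lnorm k ^ 3)"
      by (rule sum.mono_neutral_right) (use F in auto)
    also have "\<dots> \<le> 512 / 1" using F lnorm_ge_1 by (intro sum_inverse_lnorm_cube_tail) auto
    finally show "(\<Sum>k\<in>F. 1 / lnorm k ^ 3) \<le> 512" by simp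
  qed
qed auto

section \<open>Truncated weights and weighted convolutions\<close>

text \<open>
  The truncation at \<open>N\<close> makes the weighted supremum in the absorption argument finite a priori; all
  bounds are uniform in \<open>N\<close>.
\<close>

definition wgt :: "real \<Rightarrow> nat \<Rightarrow> int \<times> int \<Rightarrow> real" where
  "wgt N n l = lnorm l ^ 2 * min (lnorm l) N ^ n"

lemma wgt_pos: "k \<noteq> 0 \<Longrightarrow> N \<ge> 1 \<Longrightarrow> 0 < wgt N n k"
  unfolding wgt_def using lnorm_ge_1[of k] by (auto intro!: mult_pos_pos)

lemma wgt_nonneg: "N \<ge> 1 \<Longrightarrow> 0 \<le> wgt N n k"
  unfolding wgt_def by simp

lemma wgt_half:
  assumes "N \<ge> 1" "lnorm k \<le> 2 * lnorm l"
  shows "wgt N n k \<le> 2 ^ (n + 2) * wgt N n l"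
proof -
  have "lnorm k ^ 2 \<le> (2 * lnorm l) ^ 2" using assms by (intro power_mono) auto
  moreover have "min (lnorm k) N ^ n \<le> (2 * min (lnorm l) N) ^ n" using assms by (intro power_mono) auto
  ultimately have "wgt N n k \<le> (2 * lnorm l) ^ 2 * (2 * min (lnorm l) N) ^ n"
    unfolding wgt_def using assms(1) by (intro mult_mono) auto
  also have "\<dots> = 2 ^ (n + 2) * wgt N n l" unfolding wgt_def power_mult_distrib by (simp add: power_add)
  finally show ?thesis .
qed

lemma wgt_le: "N \<ge> 1 \<Longrightarrow> wgt N n k \<le> lnorm k ^ (n + 2)"
proof -
  assume "N \<ge> 1"
  then have "min (lnorm k) N ^ n \<le> lnorm k ^ n" by (intro power_mono) auto
  then have "wgt N n k \<le> lnorm k ^ 2 * lnorm k ^ n" unfolding wgt_def by (intro mult_left_mono) auto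
  then show ?thesis by (simp add: power_add mult_ac power2_eq_square)
qed

lemma wgt_eq: "lnorm k \<le> N \<Longrightarrow> wgt N n k = lnorm k ^ (n + 2)"
  unfolding wgt_def by (simp add: power_add mult.commute min_def power2_eq_square)

text \<open>The first summand comes from the points with
  \<open>lnorm (k - l) \<le> 3 * lnorm k\<close> in \<open>weighted_convolution_le\<close>, the 384
  from those farther out.\<close>

definition conv_const :: "nat \<Rightarrow> real" where
  "conv_const n = 2 ^ (n + 2) * 64 + 384"

lemma conv_const_pos: "conv_const n > 0" by (simp add: conv_const_def add_pos_pos)

text \<open>For \<open>lnorm (k - l) \<le> 3 * lnorm k\<close> the weight at \<open>l\<close>
  dominates a fixed fraction of the weight at \<open>k\<close>, and the sum of
  \<open>1 / lnorm (k - l)\<close> is of order \<open>lnorm k\<close>. Farther out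
  \<open>lnorm l\<close> is at least two thirds of \<open>lnorm (k - l)\<close>, and the factor
  \<open>lnorm l ^ 2\<close> of \<open>wgt\<close> combines with \<open>e / lnorm (k - l)\<close> to
  the tail of an inverse cube. That factor stands outside the \<open>min\<close> so that this tail
  converges uniformly in \<open>N\<close>.\<close>

lemma weighted_convolution_le:
  fixes u :: "int \<times> int \<Rightarrow> real"
  assumes u0: "u 0 = 0" and unn: "\<And>m. u m \<ge> 0" and ue: "\<And>m. lnorm m * u m \<le> e"
    and k: "k \<noteq> 0" and N: "N \<ge> 1" and F: "finite F" "\<And>l. l \<in> F \<Longrightarrow> lnorm k \<le> 2 * lnorm l"
  shows "(\<Sum>l\<in>F. u (k - l) / wgt N n l) \<le> conv_const n * e * lnorm k / wgt N n k"
proof -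
  have k1: "lnorm k \<ge> 1" and wk: "wgt N n k > 0" using lnorm_ge_1[OF k] wgt_pos[OF k N] by auto
  have e0: "e \<ge> 0" using ue[of 0] by simp
  define F1 where "F1 = {l\<in>F. k - l \<noteq> 0 \<and> lnorm (k - l) \<le> 3 * lnorm k}"
  define F2 where "F2 = {l\<in>F. 3 * lnorm k < lnorm (k - l)}"
  have um: "u m \<le> e / lnorm m" if "m \<noteq> 0" for m
    using ue[of m] lnorm_pos[OF that] by (simp add: field_simps)
  have sum_shift: "(\<Sum>l\<in>G. f (k - l)) = (\<Sum>m\<in>(\<lambda>l. k - l) ` G. f m)" for f :: "int \<times> int \<Rightarrow> real" and G
    by (subst sum.reindex) (auto simp: inj_on_def)
  have "(\<Sum>l\<in>F1. u (k - l) / wgt N n l) \<le> (\<Sum>l\<in>F1. (2 ^ (n + 2) * e / wgt N n k) * (1 / lnorm (k - l)))"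
  proof (rule sum_mono)
    fix l assume l: "l \<in> F1"
    then have l2: "lnorm k \<le> 2 * lnorm l" "k - l \<noteq> 0" using F(2) by (auto simp: F1_def)
    then have "l \<noteq> 0" using k1 by auto
    then have wl: "wgt N n l > 0" using wgt_pos N by blast
    have "u (k - l) / wgt N n l \<le> (e / lnorm (k - l)) / wgt N n l"
      using um[OF l2(2)] wl by (intro divide_right_mono) auto
    also have "\<dots> \<le> (e / lnorm (k - l)) * (2 ^ (n + 2) / wgt N n k)"
    proof -
      have "1 / wgt N n l \<le> 2 ^ (n + 2) / wgt N n k"
        using wgt_half[OF N l2(1), of n] wl wk by (simp add: field_simps)
      moreover have "0 \<le> e / lnorm (k - l)" using e0 by simp
      ultimately show ?thesis using mult_left_mono by fastforce
    qed
    finally show "u (k - l) / wgt N n l \<le> (2 ^ (n + 2) * e / wgt N n k) * (1 / lnorm (k - l))"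
      by (simp add: mult_ac)
  qed
  also have "\<dots> = (2 ^ (n + 2) * e / wgt N n k) * (\<Sum>m\<in>(\<lambda>l. k - l) ` F1. 1 / lnorm m)"
    by (simp only: sum_distrib_left[symmetric] sum_shift[of "\<lambda>m. 1 / lnorm m"])
  also have "\<dots> \<le> (2 ^ (n + 2) * e / wgt N n k) * (16 * (3 * lnorm k + 1))"
    using wk e0 by (intro mult_left_mono sum_inverse_lnorm_ball) (auto simp: F1_def)
  also have "\<dots> \<le> (2 ^ (n + 2) * e / wgt N n k) * (64 * lnorm k)"
    using wk e0 k1 by (intro mult_left_mono) auto
  finally have 1: "(\<Sum>l\<in>F1. u (k - l) / wgt N n l) \<le> (2 ^ (n + 2) * e / wgt N n k) * (64 * lnorm k)" .
  have "(\<Sum>l\<in>F2. u (k - l) / wgt N n l) \<le> (\<Sum>l\<in>F2. (9/4 * e * lnorm k ^ 2 / wgt N n k) * (1 / lnorm (k - l) ^ 3))"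
  proof (rule sum_mono)
    fix l assume l: "l \<in> F2"
    define m where "m = k - l"
    have m3: "3 * lnorm k < lnorm m" using l by (auto simp: F2_def m_def)
    then have m0: "m \<noteq> 0" "lnorm m > 0" using k1 by auto
    have lm: "2 / 3 * lnorm m \<le> lnorm l" 
      using lnorm_triangle_diff[of m k] m3 by (simp add: m_def lnorm_diff_commute[of "k-l" k])
    then have lk: "lnorm k \<le> lnorm l" using m3 k1 by linarith
    have l0: "lnorm l > 0" using lk k1 by linarith
    have "(2 / 3 * lnorm m)\<^sup>2 \<le> (lnorm l)\<^sup>2" using lm by (intro power_mono) auto
    moreover have "min (lnorm k) N ^ n \<le> min (lnorm l) N ^ n" using lk N by (intro power_mono) auto
    ultimately have "(2 / 3 * lnorm m)\<^sup>2 * min (lnorm k) N ^ n \<le> wgt N n l"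
      unfolding wgt_def using N by (intro mult_mono) auto
    moreover have "min (lnorm k) N ^ n = wgt N n k / lnorm k ^ 2" using k1 by (simp add: wgt_def)
    ultimately have A: "4 / 9 * (lnorm m)\<^sup>2 * (wgt N n k / lnorm k ^ 2) \<le> wgt N n l"
      by (simp add: power_mult_distrib power_divide)
    have B: "4 / 9 * (lnorm m)\<^sup>2 * (wgt N n k / lnorm k ^ 2) > 0" using wk m0 k1 by simp
    have "u m / wgt N n l \<le> (e / lnorm m) / wgt N n l"
      using um[OF m0(1)] A B by (intro divide_right_mono) auto
    also have "\<dots> \<le> (e / lnorm m) / (4 / 9 * (lnorm m)\<^sup>2 * (wgt N n k / lnorm k ^ 2))"
      using e0 by (intro divide_left_mono[OF A _ mult_pos_pos[OF less_le_trans[OF B A] B]]) auto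
    also have "\<dots> = (9/4 * e * lnorm k ^ 2 / wgt N n k) * (1 / lnorm m ^ 3)"
      using wk m0 k1 by (simp add: field_simps power2_eq_square power3_eq_cube)
    finally show "u (k - l) / wgt N n l \<le> (9/4 * e * lnorm k ^ 2 / wgt N n k) * (1 / lnorm (k - l) ^ 3)"
      by (simp add: m_def)
  qed
  also have "\<dots> = (9/4 * e * lnorm k ^ 2 / wgt N n k) * (\<Sum>m\<in>(\<lambda>l. k - l) ` F2. 1 / lnorm m ^ 3)"
    by (simp only: sum_distrib_left[symmetric] sum_shift[of "\<lambda>m. 1 / lnorm m ^ 3"])
  also have "\<dots> \<le> (9/4 * e * lnorm k ^ 2 / wgt N n k) * (512 / (3 * lnorm k))"
    using wk e0 k1 F by (intro mult_left_mono sum_inverse_lnorm_cube_tail) (auto simp: F2_def)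
  also have "\<dots> = 384 * e * lnorm k / wgt N n k" using k1 by (simp add: field_simps power2_eq_square)
  finally have 2: "(\<Sum>l\<in>F2. u (k - l) / wgt N n l) \<le> 384 * e * lnorm k / wgt N n k" .
  have "(\<Sum>l\<in>F. u (k - l) / wgt N n l) = (\<Sum>l\<in>F1 \<union> F2. u (k - l) / wgt N n l)"
    using F u0 by (intro sum.mono_neutral_right) (auto simp: F1_def F2_def)
  also have "\<dots> = (\<Sum>l\<in>F1. u (k - l) / wgt N n l) + (\<Sum>l\<in>F2. u (k - l) / wgt N n l)"
    using F by (intro sum.union_disjoint) (auto simp: F1_def F2_def)
  also have "\<dots> \<le> (2 ^ (n + 2) * e / wgt N n k) * (64 * lnorm k) + 384 * e * lnorm k / wgt N n k"
    using 1 2 by linarith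
  also have "\<dots> = conv_const n * e * lnorm k / wgt N n k"
    by (simp add: conv_const_def add_divide_distrib[symmetric] algebra_simps)
  finally show ?thesis .
qed

text \<open>Decay faster than \<open>1 / lnorm m\<close> makes the critical constant as small as
  desired at high modes. The part of \<open>u\<close> beyond \<open>R\<close> falls under
  \<open>weighted_convolution_le\<close> with the small constant \<open>\<eta>'\<close>; the
  finitely many other modes contribute at most \<open>2 ^ (n + 2) * S / wgt N n k\<close>, and the
  factor \<open>lnorm k\<close> on the right beats this once \<open>lnorm k \<ge> K\<close>.\<close>

lemma weighted_convolution_small:
  fixes u :: "int \<times> int \<Rightarrow> real"
  assumes u0: "u 0 = 0" and unn: "\<And>m. u m \<ge> 0"
    and us: "\<And>\<eta>. \<eta> > 0 \<Longrightarrow> \<exists>R. \<forall>m. lnorm m \<ge> R \<longrightarrow> lnorm m * u m \<le> \<eta>"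
    and \<eta>: "\<eta> > 0"
  shows "\<exists>K. \<forall>k N F. lnorm k \<ge> K \<longrightarrow> k \<noteq> 0 \<longrightarrow> N \<ge> 1 \<longrightarrow> finite F \<longrightarrow> (\<forall>l\<in>F. lnorm k \<le> 2 * lnorm l) \<longrightarrow>
     (\<Sum>l\<in>F. u (k - l) / wgt N n l) \<le> \<eta> * lnorm k / wgt N n k"
proof -
  define \<eta>' where "\<eta>' = \<eta> / (2 * conv_const n)"
  have "\<eta>' > 0" using \<eta> conv_const_pos by (simp add: \<eta>'_def)
  then obtain R where R: "\<And>m. lnorm m \<ge> R \<Longrightarrow> lnorm m * u m \<le> \<eta>'" using us by blast
  define S where "S = (\<Sum>m\<in>{m. lnorm m \<le> R}. u m)"
  have S0: "S \<ge> 0" unfolding S_def using unn by (simp add: sum_nonneg)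
  define K where "K = 2 ^ (n + 3) * S / \<eta>"
  show ?thesis
  proof (intro exI[of _ K] allI impI)
    fix k N F assume kK: "K \<le> lnorm k" and k: "k \<noteq> 0" and N: "(1::real) \<le> N" and fin: "finite F" and F: "\<forall>l\<in>F. lnorm k \<le> 2 * lnorm l"
    have k1: "lnorm k \<ge> 1" and wk: "wgt N n k > 0" using lnorm_ge_1[OF k] wgt_pos[OF k N] by auto
    define u1 where "u1 m = (if lnorm m \<ge> R then u m else 0)" for m
    have 1: "(\<Sum>l\<in>F. u1 (k - l) / wgt N n l) \<le> conv_const n * \<eta>' * lnorm k / wgt N n k"
      using F fin k N R u0 unn \<open>\<eta>' > 0\<close> by (intro weighted_convolution_le) (auto simp: u1_def)
    define F2 where "F2 = {l\<in>F. lnorm (k - l) \<le> R}"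
    have f2: "finite F2" using fin by (simp add: F2_def)
    have "(\<Sum>l\<in>F. (u (k - l) - u1 (k - l)) / wgt N n l) = (\<Sum>l\<in>F2. (u (k - l) - u1 (k - l)) / wgt N n l)"
      using fin by (intro sum.mono_neutral_right) (auto simp: F2_def u1_def)
    also have "\<dots> \<le> (\<Sum>l\<in>F2. (2 ^ (n + 2) / wgt N n k) * u (k - l))"
    proof (rule sum_mono)
      fix l assume "l \<in> F2"
      then have l2: "lnorm k \<le> 2 * lnorm l" using F by (auto simp: F2_def)
      then have "l \<noteq> 0" using k1 by auto
      then have wl: "wgt N n l > 0" using wgt_pos N by blast
      have "(u (k - l) - u1 (k - l)) / wgt N n l \<le> u (k - l) * (1 / wgt N n l)"
        using wl unn by (simp add: u1_def divide_right_mono)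
      also have "\<dots> \<le> u (k - l) * (2 ^ (n + 2) / wgt N n k)"
        using wgt_half[OF N l2(1), of n] wl wk unn by (intro mult_left_mono) (auto simp: field_simps)
      finally show "(u (k - l) - u1 (k - l)) / wgt N n l \<le> (2 ^ (n + 2) / wgt N n k) * u (k - l)" by (simp add: mult_ac)
    qed
    also have "\<dots> = (2 ^ (n + 2) / wgt N n k) * (\<Sum>m\<in>(\<lambda>l. k - l) ` F2. u m)"
      by (subst sum.reindex) (auto simp: inj_on_def sum_distrib_left)
    also have "\<dots> \<le> (2 ^ (n + 2) / wgt N n k) * S"
      unfolding S_def using wk unn finite_lnorm_le by (intro mult_left_mono sum_mono2) (auto simp: F2_def)
    also have "\<dots> \<le> (\<eta> / 2) * lnorm k / wgt N n k"
    proof -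
      have "2 ^ (n + 2) * S \<le> (\<eta> / 2) * lnorm k" using kK \<eta> unfolding K_def by (simp add: field_simps power_add)
      then have "2 ^ (n + 2) * S / wgt N n k \<le> (\<eta> / 2) * lnorm k / wgt N n k" using wk by (intro divide_right_mono) auto
      then show ?thesis by simp
    qed
    finally have 2: "(\<Sum>l\<in>F. (u (k - l) - u1 (k - l)) / wgt N n l) \<le> (\<eta> / 2) * lnorm k / wgt N n k" .
    have "(\<Sum>l\<in>F. u (k - l) / wgt N n l) = (\<Sum>l\<in>F. u1 (k - l) / wgt N n l) + (\<Sum>l\<in>F. (u (k - l) - u1 (k - l)) / wgt N n l)"
      by (simp add: sum.distrib[symmetric] diff_divide_distrib)
    also have "\<dots> \<le> conv_const n * \<eta>' * lnorm k / wgt N n k + (\<eta> / 2) * lnorm k / wgt N n k"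
      using 1 2 by linarith
    also have "conv_const n * \<eta>' = \<eta> / 2" using conv_const_pos[of n] by (simp add: \<eta>'_def)
    finally show "(\<Sum>l\<in>F. u (k - l) / wgt N n l) \<le> \<eta> * lnorm k / wgt N n k" by simp
  qed
qed

section \<open>The system of Fourier modes\<close>

definition cross2 :: "int \<times> int \<Rightarrow> int \<times> int \<Rightarrow> real" where
  "cross2 l m = real_of_int (fst l) * real_of_int (snd m) - real_of_int (snd l) * real_of_int (fst m)"

definition dot2 :: "int \<times> int \<Rightarrow> int \<times> int \<Rightarrow> real" where
  "dot2 l m = real_of_int (fst l) * real_of_int (fst m) + real_of_int (snd l) * real_of_int (snd m)"

text \<open>The symbol of the projected advection term in stream-function coefficients:
  \<open>cross2 l m\<close> is the velocity direction of mode \<open>l\<close> applied to the wave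
  vector \<open>m\<close>, and the quotient projects the result onto the divergence-free direction
  of mode \<open>l + m\<close>. For \<open>l + m = 0\<close> the value is 0.\<close>

definition triad :: "int \<times> int \<Rightarrow> int \<times> int \<Rightarrow> real" where
  "triad l m = cross2 l m * dot2 m (l + m) / (lnorm (l + m))\<^sup>2"

lemma cross2_le: "\<bar>cross2 l m\<bar> \<le> lnorm l * lnorm m"
proof -
  have "(cross2 l m)\<^sup>2 + (dot2 l m)\<^sup>2 = (lnorm l * lnorm m)\<^sup>2"
    unfolding power_mult_distrib lnorm_power2 cross2_def dot2_def by (simp add: power2_eq_square algebra_simps)
  then have "(cross2 l m)\<^sup>2 \<le> (lnorm l * lnorm m)\<^sup>2" by (metis le_add_same_cancel1 zero_le_power2)
  then show ?thesis using abs_le_square_iff[of "cross2 l m" "lnorm l * lnorm m"] by (simp add: abs_mult)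
qed

lemma dot2_le: "\<bar>dot2 l m\<bar> \<le> lnorm l * lnorm m"
proof -
  have "(cross2 l m)\<^sup>2 + (dot2 l m)\<^sup>2 = (lnorm l * lnorm m)\<^sup>2"
    unfolding power_mult_distrib lnorm_power2 cross2_def dot2_def by (simp add: power2_eq_square algebra_simps)
  then have "(dot2 l m)\<^sup>2 \<le> (lnorm l * lnorm m)\<^sup>2" by (metis le_add_same_cancel2 zero_le_power2)
  then show ?thesis using abs_le_square_iff[of "dot2 l m" "lnorm l * lnorm m"] by (simp add: abs_mult)
qed

text \<open>Since \<open>cross2 l m = cross2 l (l + m)\<close>, each factor of the numerator carries
  one \<open>lnorm (l + m)\<close>, and together they cancel the denominator.\<close>

lemma triad_le: "\<bar>triad l m\<bar> \<le> lnorm l * lnorm m"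
proof (cases "l + m = 0")
  case True then show ?thesis by (simp add: triad_def)
next
  case False
  have "cross2 l m = cross2 l (l + m)" by (simp add: cross2_def algebra_simps)
  then have "\<bar>cross2 l m\<bar> \<le> lnorm l * lnorm (l + m)" using cross2_le by metis
  then have "\<bar>cross2 l m\<bar> * \<bar>dot2 m (l + m)\<bar> \<le> (lnorm l * lnorm (l + m)) * (lnorm m * lnorm (l + m))"
    by (intro mult_mono dot2_le) auto
  then show ?thesis unfolding triad_def using lnorm_pos[OF False]
    by (simp add: abs_mult power2_eq_square field_simps)
qed

lemma convolution_summable:
  fixes a :: "int \<times> int \<Rightarrow> real"
  assumes nn: "\<And>k. a k \<ge> 0" "\<And>k. b k \<ge> 0"
    and A: "\<And>F. finite F \<Longrightarrow> (\<Sum>k\<in>F. (a k)\<^sup>2) \<le> A" and B: "\<And>F. finite F \<Longrightarrow> (\<Sum>k\<in>F. (b k)\<^sup>2) \<le> B"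
  shows "finite F \<Longrightarrow> (\<Sum>l\<in>F. a l * b (k - l)) \<le> sqrt A * sqrt B"
    and "(\<lambda>l. a l * b (k - l)) summable_on UNIV"
    and "(\<Sum>\<^sub>\<infinity>l. a l * b (k - l)) \<le> sqrt A * sqrt B"
proof -
  show fin: "(\<Sum>l\<in>F. a l * b (k - l)) \<le> sqrt A * sqrt B" if "finite F" for F
  proof -
    have "(\<Sum>l\<in>F. a l * b (k - l)) \<le> L2_set a F * L2_set (\<lambda>l. b (k - l)) F"
      using L2_set_mult_ineq[of a "\<lambda>l. b (k - l)" F] nn by simp
    also have "\<dots> \<le> sqrt A * sqrt B"
    proof (intro mult_mono)
      show "L2_set a F \<le> sqrt A" unfolding L2_set_def using A[OF that] by simp
      have "(\<Sum>l\<in>F. (b (k - l))\<^sup>2) = (\<Sum>m\<in>(\<lambda>l. k - l) ` F. (b m)\<^sup>2)"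
        by (subst sum.reindex) (auto simp: inj_on_def)
      also have "\<dots> \<le> B" using B that by blast
      finally show "L2_set (\<lambda>l. b (k - l)) F \<le> sqrt B" unfolding L2_set_def by simp
      show "0 \<le> sqrt A" using A[of "{}"] by simp
    qed simp
    finally show ?thesis .
  qed
  show s: "(\<lambda>l. a l * b (k - l)) summable_on UNIV"
    by (rule nonneg_bdd_above_summable_on) (auto intro!: bdd_aboveI2 fin mult_nonneg_nonneg nn)
  show "(\<Sum>\<^sub>\<infinity>l. a l * b (k - l)) \<le> sqrt A * sqrt B"
    by (rule infsum_le_finite_sums[OF s]) (use fin in auto)
qed

lemma sum3_power2_le: "((x::real) + y + w)\<^sup>2 \<le> 3 * (x\<^sup>2 + y\<^sup>2 + w\<^sup>2)"
  using sum_squares_bound[of x y] sum_squares_bound[of x w] sum_squares_bound[of y w]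
  by (simp add: power2_eq_square algebra_simps)

text \<open>The equation as a system for complex sequences, free of function spaces. In the
  application \<open>\<alpha>\<close> is \<open>\<nu> * \<kappa>\<^sup>2\<close>, \<open>c\<close>
  is \<open>\<kappa>\<close> and \<open>\<Lambda>\<close> is \<open>\<nu> * lam\<close>. The bound
  in \<open>energy\<close> is global in time because the trajectory is bounded, the one in
  \<open>enstrophy\<close> is local but independent of \<open>F\<close>, and \<open>forcing\<close>
  expresses that the force is an eigenvector.\<close>

locale lattice_ode =
  fixes z :: "int \<times> int \<Rightarrow> real \<Rightarrow> complex" and \<gamma> :: "int \<times> int \<Rightarrow> complex"
    and \<alpha> c E \<Lambda> :: real
  assumes \<alpha>: "\<alpha> > 0" and \<Lambda>: "\<Lambda> > 0"
    and z0: "\<And>t. z 0 t = 0"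
    and zcnj: "\<And>k t. z (- k) t = cnj (z k t)"
    and energy: "\<And>F t. finite F \<Longrightarrow> (\<Sum>k\<in>F. (lnorm k * cmod (z k t))\<^sup>2) \<le> E"
    and enstrophy: "\<And>s T. s \<le> T \<Longrightarrow> \<exists>D. \<forall>F. finite F \<longrightarrow>
          integral {s..T} (\<lambda>t. \<Sum>k\<in>F. ((lnorm k)\<^sup>2 * cmod (z k t))\<^sup>2) \<le> D"
    and ode: "\<And>k s t. k \<noteq> 0 \<Longrightarrow> s \<le> t \<Longrightarrow>
          ((\<lambda>\<tau>. \<gamma> k - (\<alpha> * (lnorm k)\<^sup>2) *\<^sub>R z k \<tau>
               + c *\<^sub>R (\<Sum>\<^sub>\<infinity>l. triad l (k - l) *\<^sub>R (z l \<tau> * z (k - l) \<tau>)))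
            has_integral (z k t - z k s)) {s..t}"
    and forcing: "\<And>k. \<gamma> k \<noteq> 0 \<Longrightarrow> \<alpha> * (lnorm k)\<^sup>2 = \<Lambda>"
    and initial: "\<And>k. z k 0 = 0"
begin

definition U :: "int \<times> int \<Rightarrow> real \<Rightarrow> real" where "U k t = lnorm k * cmod (z k t)"

definition NL :: "int \<times> int \<Rightarrow> real \<Rightarrow> complex" where
  "NL k t = (\<Sum>\<^sub>\<infinity>l. triad l (k - l) *\<^sub>R (z l t * z (k - l) t))"

text \<open>A majorant of \<open>NL\<close> (see \<open>NL_le\<close>) whose terms are nonnegative,
  so that monotone convergence applies to it.\<close>

definition M :: "int \<times> int \<Rightarrow> real \<Rightarrow> real" where "M k t = (\<Sum>\<^sub>\<infinity>l. U l t * U (k - l) t)"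

lemma U_nonneg [simp]: "0 \<le> U k t" by (simp add: U_def)

lemma U_zero [simp]: "U 0 t = 0" by (simp add: U_def)

lemma E_nonneg: "0 \<le> E" using energy[of "{}"] by simp

lemma U_energy: "finite F \<Longrightarrow> (\<Sum>k\<in>F. (U k t)\<^sup>2) \<le> E"
  using energy by (simp add: U_def)

lemma U_le: "U k t \<le> sqrt E"
  using U_energy[of "{k}" t] by (simp add: real_le_rsqrt)

lemma M_summable: "(\<lambda>l. U l t * U (k - l) t) summable_on UNIV"
  by (rule convolution_summable(2)[of "\<lambda>l. U l t" "\<lambda>l. U l t", OF _ _ U_energy U_energy]) auto

lemma M_le: "M k t \<le> E"
  unfolding M_def using convolution_summable(3)[of "\<lambda>l. U l t" "\<lambda>l. U l t", OF _ _ U_energy U_energy] E_nonneg by simp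

lemma NL_term_le: "norm (triad l (k - l) *\<^sub>R (z l t * z (k - l) t)) \<le> U l t * U (k - l) t"
proof -
  have "\<bar>triad l (k - l)\<bar> * (cmod (z l t) * cmod (z (k - l) t)) \<le> (lnorm l * lnorm (k - l)) * (cmod (z l t) * cmod (z (k - l) t))"
    by (intro mult_right_mono triad_le) auto
  then show ?thesis by (simp add: U_def norm_mult mult_ac)
qed

lemma NL_abs_summable: "(\<lambda>l. norm (triad l (k - l) *\<^sub>R (z l t * z (k - l) t))) summable_on UNIV"
  by (rule summable_on_comparison_test[OF M_summable[of t k]]) (use NL_term_le in auto)

lemma NL_le: "norm (NL k t) \<le> M k t"
proof -
  have "norm (NL k t) \<le> (\<Sum>\<^sub>\<infinity>l. norm (triad l (k - l) *\<^sub>R (z l t * z (k - l) t)))"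
    unfolding NL_def by (rule norm_infsum_bound[OF NL_abs_summable])
  also have "\<dots> \<le> M k t" unfolding M_def
    by (rule infsum_mono[OF NL_abs_summable M_summable]) (use NL_term_le in auto)
  finally show ?thesis .
qed

lemma continuous_z: "continuous_on S (z k)"
proof (cases "k = 0")
  case True then show ?thesis using z0 by (simp add: continuous_on_cong[of S S "z k" "\<lambda>_. 0"])
next
  case False
  have c: "continuous_on {-a..a} (z k)" if "a > 0" for a
  proof -
    let ?f = "\<lambda>\<tau>. \<gamma> k - (\<alpha> * (lnorm k)\<^sup>2) *\<^sub>R z k \<tau> + c *\<^sub>R (\<Sum>\<^sub>\<infinity>l. triad l (k - l) *\<^sub>R (z l \<tau> * z (k - l) \<tau>))"
    have "z k t = z k (-a) + integral {-a..t} ?f" if "t \<in> {-a..a}" for t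
      using ode[OF False, of "-a" t, THEN integral_unique] that by simp
    moreover have "?f integrable_on {-a..a}" using ode[OF False, of "-a" a] \<open>a > 0\<close> has_integral_integrable by fastforce
    then have "continuous_on {-a..a} (\<lambda>t. z k (-a) + integral {-a..t} ?f)"
      by (intro continuous_intros indefinite_integral_continuous_1)
    ultimately show ?thesis by (metis (no_types, lifting) continuous_on_cong)
  qed
  have "isCont (z k) t" for t
  proof -
    have "t \<in> interior {-(\<bar>t\<bar>+1)..\<bar>t\<bar>+1}" by auto
    then show ?thesis using c[of "\<bar>t\<bar>+1"] continuous_on_interior by fastforce
  qed
  then show ?thesis by (simp add: continuous_at_imp_continuous_on)
qed

lemma continuous_U: "continuous_on S (U k)"
  unfolding U_def by (intro continuous_intros continuous_z)

text \<open>Partial sums over boxes increase to \<open>M\<close>. Monotone convergence yields the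
  integrability of the limit together with any bound that is uniform over finite sets.\<close>

lemma M_square_integral_le:
  assumes B: "\<And>F. finite F \<Longrightarrow> integral {s..T} (\<lambda>\<tau>. ((\<tau> - s) * (\<Sum>l\<in>F. U l \<tau> * U (k - l) \<tau>))\<^sup>2) \<le> B"
  shows "(\<lambda>\<tau>. ((\<tau> - s) * M k \<tau>)\<^sup>2) integrable_on {s..T}" (is ?A)
    and "integral {s..T} (\<lambda>\<tau>. ((\<tau> - s) * M k \<tau>)\<^sup>2) \<le> B" (is ?B)
proof -
  define f where "f n \<tau> = ((\<tau> - s) * (\<Sum>l\<in>lbox n. U l \<tau> * U (k - l) \<tau>))\<^sup>2" for n \<tau>
  have fi: "f n integrable_on {s..T}" for n
    unfolding f_def by (intro integrable_continuous_real continuous_intros continuous_U)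
  have i0: "0 \<le> integral {s..T} (f n)" for n
    by (rule integral_nonneg[OF fi]) (simp add: f_def)
  have iB: "integral {s..T} (f n) \<le> B" for n using B[of "lbox n"] by (simp add: f_def[abs_def])
  have "?A \<and> (\<lambda>n. integral {s..T} (f n)) \<longlonglongrightarrow> integral {s..T} (\<lambda>\<tau>. ((\<tau> - s) * M k \<tau>)\<^sup>2)"
  proof (rule monotone_convergence_increasing[OF fi])
    show "f n \<tau> \<le> f (Suc n) \<tau>" if "\<tau> \<in> {s..T}" for n \<tau>
      unfolding f_def using that lbox_mono[of n "Suc n"]
      by (intro power_mono mult_left_mono sum_mono2 mult_nonneg_nonneg sum_nonneg) auto
    show "(\<lambda>n. f n \<tau>) \<longlonglongrightarrow> ((\<tau> - s) * M k \<tau>)\<^sup>2" for \<tau>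
    proof -
      have "((\<lambda>l. U l \<tau> * U (k - l) \<tau>) has_sum M k \<tau>) UNIV"
        unfolding M_def using M_summable by (rule has_sum_infsum)
      then have "(\<lambda>n. \<Sum>l\<in>lbox n. U l \<tau> * U (k - l) \<tau>) \<longlonglongrightarrow> M k \<tau>"
        unfolding has_sum_def by (rule filterlim_compose[OF _ filterlim_lbox])
      then show ?thesis unfolding f_def by (intro tendsto_intros)
    qed
    show "bounded (range (\<lambda>n. integral {s..T} (f n)))"
      using i0 iB by (auto intro!: boundedI[of _ B])
  qed
  then show ?A ?B using iB by (auto intro: LIMSEQ_le_const2)
qed

text \<open>This is \<open>weighted_energy\<close> for \<open>lnorm k *\<^sub>R z k\<close> with
  rate \<open>\<alpha> * (lnorm k)\<^sup>2\<close>. The rate occurs as a divisor on the right and as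
  a factor on the left, so relative to the bracket on the right the squared pointwise value gains
  \<open>(lnorm k)\<^sup>2\<close> and the integrated square gains
  \<open>lnorm k ^ 4\<close>.\<close>

lemma gain:
  assumes k: "k \<noteq> 0" and t: "s \<le> t" "t \<le> T"
    and B: "\<And>F. finite F \<Longrightarrow> integral {s..T} (\<lambda>\<tau>. ((\<tau> - s) * (\<Sum>l\<in>F. U l \<tau> * U (k - l) \<tau>))\<^sup>2) \<le> B"
  shows "((t - s) * U k t)\<^sup>2 + (\<alpha> * (lnorm k)\<^sup>2) * integral {s..t} (\<lambda>\<tau>. ((\<tau> - s) * U k \<tau>)\<^sup>2)
    \<le> 3 / (\<alpha> * (lnorm k)\<^sup>2) * (integral {s..T} (\<lambda>\<tau>. (U k \<tau>)\<^sup>2) + (T - s) ^ 3 * (lnorm k * cmod (\<gamma> k))\<^sup>2 + c\<^sup>2 * (lnorm k)\<^sup>2 * B)"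
proof -
  define a where "a = \<alpha> * (lnorm k)\<^sup>2"
  have a: "a > 0" unfolding a_def using \<alpha> lnorm_pos[OF k] by simp
  define y where "y \<tau> = lnorm k *\<^sub>R z k \<tau>" for \<tau>
  define h where "h \<tau> = lnorm k *\<^sub>R (\<gamma> k + c *\<^sub>R NL k \<tau>)" for \<tau>
  have ny: "norm (y \<tau>) = U k \<tau>" for \<tau> by (simp add: y_def U_def)
  have cy: "continuous_on S y" for S unfolding y_def by (intro continuous_intros continuous_z)
  have eq: "((\<lambda>\<tau>. h \<tau> - a *\<^sub>R y \<tau>) has_integral (y t' - y s)) {s..t'}" if "s \<le> t'" for t'
  proof -
    have "((\<lambda>\<tau>. lnorm k *\<^sub>R (\<gamma> k - a *\<^sub>R z k \<tau> + c *\<^sub>R NL k \<tau>)) has_integral lnorm k *\<^sub>R (z k t' - z k s)) {s..t'}"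
      using ode[OF k that] unfolding NL_def a_def by (rule has_integral_cmul)
    moreover have "(\<lambda>\<tau>. lnorm k *\<^sub>R (\<gamma> k - a *\<^sub>R z k \<tau> + c *\<^sub>R NL k \<tau>)) = (\<lambda>\<tau>. h \<tau> - a *\<^sub>R y \<tau>)"
      by (auto simp: h_def y_def algebra_simps)
    ultimately show ?thesis by (simp add: y_def scaleR_diff_right)
  qed
  have hn: "norm (h \<tau>) \<le> lnorm k * cmod (\<gamma> k) + \<bar>c\<bar> * lnorm k * M k \<tau>" for \<tau>
  proof -
    have "norm (h \<tau>) \<le> lnorm k * (cmod (\<gamma> k) + \<bar>c\<bar> * norm (NL k \<tau>))"
      unfolding h_def using norm_triangle_ineq[of "\<gamma> k" "c *\<^sub>R NL k \<tau>"] by (simp add: mult_left_mono)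
    also have "\<dots> \<le> lnorm k * (cmod (\<gamma> k) + \<bar>c\<bar> * M k \<tau>)"
      by (intro mult_left_mono add_left_mono NL_le) auto
    finally show ?thesis by (simp add: algebra_simps)
  qed
  have "(\<lambda>\<tau>. a *\<^sub>R y \<tau>) integrable_on {s..t}"
    by (intro integrable_continuous_real continuous_intros cy)
  note Henstock_Kurzweil_Integration.integrable_add[OF has_integral_integrable[OF eq[OF t(1)]] this]
  then have hi: "h integrable_on {s..t}" by simp
  have habs: "h absolutely_integrable_on {s..t}"
  proof (rule absolutely_integrable_integrable_bound[OF _ hi])
    show "norm (h \<tau>) \<le> lnorm k * cmod (\<gamma> k) + \<bar>c\<bar> * lnorm k * E" for \<tau>
      using hn[of \<tau>] mult_left_mono[OF M_le[of k \<tau>], of "\<bar>c\<bar> * lnorm k"] by simp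
  qed auto
  define G where "G = lnorm k * cmod (\<gamma> k)"
  \<comment> \<open>Taking a square root means that only \<open>(H \<tau>)\<^sup>2\<close> has to be
    integrated; the 3 is the price of squaring a sum of three terms.\<close>
  define H where "H \<tau> = sqrt (3 * ((U k \<tau>)\<^sup>2 + ((\<tau> - s) * G)\<^sup>2 + (c * lnorm k)\<^sup>2 * ((\<tau> - s) * M k \<tau>)\<^sup>2))" for \<tau>
  have H2: "(H \<tau>)\<^sup>2 = 3 * ((U k \<tau>)\<^sup>2 + ((\<tau> - s) * G)\<^sup>2 + (c * lnorm k)\<^sup>2 * ((\<tau> - s) * M k \<tau>)\<^sup>2)" for \<tau>
    unfolding H_def by (intro real_sqrt_pow2) auto
  note Mi = M_square_integral_le[OF B]
  have sub: "{s..t} \<subseteq> {s..T}" using t by auto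
  have Mi': "(\<lambda>\<tau>. ((\<tau> - s) * M k \<tau>)\<^sup>2) integrable_on {s..t}"
    by (rule integrable_on_subinterval[OF Mi(1) sub])
  have i1: "(\<lambda>\<tau>. (U k \<tau>)\<^sup>2) integrable_on {s'..t'}" for s' t' by (intro integrable_continuous_real continuous_intros continuous_U)
  have i2: "(\<lambda>\<tau>. ((\<tau> - s) * G)\<^sup>2) integrable_on {s'..t'}" for s' t' by (intro integrable_continuous_real continuous_intros)
  have i3: "(\<lambda>\<tau>. (c * lnorm k)\<^sup>2 * ((\<tau> - s) * M k \<tau>)\<^sup>2) integrable_on {s..t}"
    using integrable_on_cmult_left[OF Mi', of "(c * lnorm k)\<^sup>2"] by simp
  have Hi: "(\<lambda>\<tau>. (H \<tau>)\<^sup>2) integrable_on {s..t}"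
    unfolding H2 using integrable_on_cmult_left[OF Henstock_Kurzweil_Integration.integrable_add[OF Henstock_Kurzweil_Integration.integrable_add[OF i1 i2] i3], of 3]
    by simp
  have bd: "norm (y \<tau>) + (\<tau> - s) * norm (h \<tau>) \<le> H \<tau>" if "\<tau> \<in> {s..t}" for \<tau>
  proof -
    have "norm (y \<tau>) + (\<tau> - s) * norm (h \<tau>) \<le> U k \<tau> + (\<tau> - s) * (G + \<bar>c\<bar> * lnorm k * M k \<tau>)"
      unfolding ny G_def using hn that by (intro add_left_mono mult_left_mono) auto
    also have "\<dots> = U k \<tau> + (\<tau> - s) * G + \<bar>c\<bar> * lnorm k * ((\<tau> - s) * M k \<tau>)" by (simp add: algebra_simps)
    also have "\<dots> \<le> H \<tau>" unfolding H_def
      by (rule real_le_rsqrt, rule order_trans[OF sum3_power2_le]) (simp add: power_mult_distrib)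
    finally show ?thesis .
  qed
  have "((t - s) * norm (y t))\<^sup>2 + a * integral {s..t} (\<lambda>\<tau>. ((\<tau> - s) * norm (y \<tau>))\<^sup>2) \<le> (1 / a) * integral {s..t} (\<lambda>\<tau>. (H \<tau>)\<^sup>2)"
    using eq by (intro weighted_energy[OF t(1) a _ habs cy Hi bd]) auto
  also have "integral {s..t} (\<lambda>\<tau>. (H \<tau>)\<^sup>2) = 3 * (integral {s..t} (\<lambda>\<tau>. (U k \<tau>)\<^sup>2) + integral {s..t} (\<lambda>\<tau>. ((\<tau> - s) * G)\<^sup>2) + (c * lnorm k)\<^sup>2 * integral {s..t} (\<lambda>\<tau>. ((\<tau> - s) * M k \<tau>)\<^sup>2))"
    unfolding H2 
    by (simp only: integral_mult_right Henstock_Kurzweil_Integration.integral_add[OF Henstock_Kurzweil_Integration.integrable_add[OF i1 i2] i3] Henstock_Kurzweil_Integration.integral_add[OF i1 i2])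
  also have "(1 / a) * \<dots> \<le> (1 / a) * (3 * (integral {s..T} (\<lambda>\<tau>. (U k \<tau>)\<^sup>2) + (T - s) ^ 3 * G\<^sup>2 + (c * lnorm k)\<^sup>2 * B))"
  proof (intro mult_left_mono add_mono)
    show "integral {s..t} (\<lambda>\<tau>. (U k \<tau>)\<^sup>2) \<le> integral {s..T} (\<lambda>\<tau>. (U k \<tau>)\<^sup>2)"
      by (intro integral_subset_le[OF sub i1 i1]) auto
    show "integral {s..t} (\<lambda>\<tau>. ((\<tau> - s) * M k \<tau>)\<^sup>2) \<le> B"
      by (rule order_trans[OF integral_subset_le[OF sub Mi' Mi(1)] Mi(2)]) auto
    have "integral {s..t} (\<lambda>\<tau>. ((\<tau> - s) * G)\<^sup>2) \<le> integral {s..t} (\<lambda>\<tau>. ((T - s) * G)\<^sup>2)"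
      using t by (intro integral_le i2) (auto simp: power_mult_distrib intro!: mult_right_mono power_mono)
    also have "\<dots> = (t - s) * ((T - s) * G)\<^sup>2" using t by simp
    also have "\<dots> \<le> (T - s) * ((T - s) * G)\<^sup>2" using t by (intro mult_right_mono) auto
    finally show "integral {s..t} (\<lambda>\<tau>. ((\<tau> - s) * G)\<^sup>2) \<le> (T - s) ^ 3 * G\<^sup>2"
      by (simp add: power_mult_distrib power2_eq_square power3_eq_cube mult_ac)
  qed (use a in auto)
  finally show ?thesis unfolding ny a_def G_def by (simp add: power_mult_distrib)
qed

end

lemma le_mult_self: "1 \<le> a \<Longrightarrow> 0 \<le> x \<Longrightarrow> x \<le> a * (x::real)"
  using mult_right_mono[of 1 a x] by simp

context lattice_ode
begin

section \<open>Regularity\<close>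

text \<open>By \<open>forcing\<close> only modes on one circle are forced. They are finitely many,
  so any power of \<open>lnorm k\<close> can be put on the force.\<close>

lemma forcing_bound: "\<exists>\<Gamma>\<ge>0. \<forall>k. lnorm k ^ n * (lnorm k * cmod (\<gamma> k))\<^sup>2 \<le> \<Gamma>"
proof -
  define S where "S = {k. lnorm k \<le> sqrt (\<Lambda> / \<alpha>)}"
  define \<Gamma> where "\<Gamma> = (\<Sum>k\<in>S. lnorm k ^ n * (lnorm k * cmod (\<gamma> k))\<^sup>2)"
  have "finite S" unfolding S_def by (rule finite_lnorm_le)
  have \<Gamma>0: "\<Gamma> \<ge> 0" unfolding \<Gamma>_def by (intro sum_nonneg) auto
  have "lnorm k ^ n * (lnorm k * cmod (\<gamma> k))\<^sup>2 \<le> \<Gamma>" for k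
  proof (cases "\<gamma> k = 0")
    case True then show ?thesis using \<Gamma>0 by simp
  next
    case False
    then have "(lnorm k)\<^sup>2 = \<Lambda> / \<alpha>" using forcing[OF False] \<alpha> by (simp add: field_simps)
    then have "k \<in> S" unfolding S_def by (simp add: real_le_rsqrt)
    then show ?thesis unfolding \<Gamma>_def using \<open>finite S\<close> by (intro member_le_sum) auto
  qed
  then show ?thesis using \<Gamma>0 by blast
qed

lemma forcing_large: assumes "lnorm k > sqrt (\<Lambda> / \<alpha>)" shows "\<gamma> k = 0"
proof (rule ccontr)
  assume "\<gamma> k \<noteq> 0"
  then have "(lnorm k)\<^sup>2 = \<Lambda> / \<alpha>" using forcing \<alpha> by (simp add: field_simps)
  then have "lnorm k = sqrt (\<Lambda> / \<alpha>)" by (metis lnorm_nonneg real_sqrt_abs abs_of_nonneg)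
  then show False using assms by simp
qed

text \<open>In \<open>k = l + (k - l)\<close> one of the two summands has norm at least
  \<open>lnorm k / 2\<close>. The set collects these large summands, with \<open>l\<close> reflected
  to \<open>k - l\<close> where necessary, at the cost of the factor 2 in
  \<open>convolution_halve\<close>.\<close>

definition halfset :: "int \<times> int \<Rightarrow> (int \<times> int) set \<Rightarrow> (int \<times> int) set" where
  "halfset k F = {l \<in> F \<union> (\<lambda>l. k - l) ` F. lnorm k \<le> 2 * lnorm l}"

lemma finite_halfset: "finite F \<Longrightarrow> finite (halfset k F)" by (simp add: halfset_def)

lemma halfset_nonzero: "k \<noteq> 0 \<Longrightarrow> l \<in> halfset k F \<Longrightarrow> l \<noteq> 0"
  using lnorm_pos[of k] by (auto simp: halfset_def)

lemma convolution_halve: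
  assumes "finite F"
  shows "(\<Sum>l\<in>F. U l \<tau> * U (k - l) \<tau>) \<le> 2 * (\<Sum>l\<in>halfset k F. U l \<tau> * U (k - l) \<tau>)"
proof -
  define F1 where "F1 = {l\<in>F. lnorm k \<le> 2 * lnorm l}"
  define F2 where "F2 = F - F1"
  have "(\<Sum>l\<in>F. U l \<tau> * U (k - l) \<tau>) = (\<Sum>l\<in>F1. U l \<tau> * U (k - l) \<tau>) + (\<Sum>l\<in>F2. U l \<tau> * U (k - l) \<tau>)"
    unfolding F2_def using assms by (subst sum.subset_diff[of F1 F]) (auto simp: F1_def)
  moreover have "(\<Sum>l\<in>F1. U l \<tau> * U (k - l) \<tau>) \<le> (\<Sum>l\<in>halfset k F. U l \<tau> * U (k - l) \<tau>)"
    using assms by (intro sum_mono2) (auto simp: F1_def halfset_def)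
  moreover have "(\<Sum>l\<in>F2. U l \<tau> * U (k - l) \<tau>) \<le> (\<Sum>l\<in>halfset k F. U l \<tau> * U (k - l) \<tau>)"
  proof -
    have "(\<Sum>l\<in>F2. U l \<tau> * U (k - l) \<tau>) = (\<Sum>m\<in>(\<lambda>l. k - l) ` F2. U m \<tau> * U (k - m) \<tau>)"
      by (subst sum.reindex) (auto simp: inj_on_def mult.commute)
    also have "\<dots> \<le> (\<Sum>l\<in>halfset k F. U l \<tau> * U (k - l) \<tau>)"
    proof (intro sum_mono2)
      show "(\<lambda>l. k - l) ` F2 \<subseteq> halfset k F"
      proof (rule image_subsetI)
        fix l assume l: "l \<in> F2"
        show "k - l \<in> halfset k F"
          using l lnorm_triangle_diff[of k l] by (auto simp: F2_def F1_def halfset_def)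
      qed
    qed (use assms in \<open>auto simp: halfset_def\<close>)
    finally show ?thesis .
  qed
  ultimately show ?thesis by linarith
qed

lemma integrable_U_sum: "(\<lambda>\<tau>. (lnorm l * U l \<tau>)\<^sup>2) integrable_on {s..T}"
  by (intro integrable_continuous_real continuous_intros continuous_U)

text \<open>The time-integrated enstrophies of single modes are nonnegative with bounded finite
  sums, hence summable, and a summable family has small tails. All smallness in the regularity
  argument originates here.\<close>

lemma enstrophy_tail:
  assumes "s \<le> T"
  obtains D where "D \<ge> 0" "\<And>F. finite F \<Longrightarrow> (\<Sum>l\<in>F. integral {s..T} (\<lambda>\<tau>. (lnorm l * U l \<tau>)\<^sup>2)) \<le> D"
    and "\<And>\<eta>. \<eta> > 0 \<Longrightarrow> \<exists>R. \<forall>F. finite F \<longrightarrow> (\<forall>l\<in>F. R \<le> lnorm l) \<longrightarrow>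
           (\<Sum>l\<in>F. integral {s..T} (\<lambda>\<tau>. (lnorm l * U l \<tau>)\<^sup>2)) \<le> \<eta>"
proof -
  define b where "b l = integral {s..T} (\<lambda>\<tau>. (lnorm l * U l \<tau>)\<^sup>2)" for l
  have b0: "b l \<ge> 0" for l unfolding b_def by (rule integral_nonneg[OF integrable_U_sum]) auto
  obtain D where D: "\<And>F. finite F \<Longrightarrow> integral {s..T} (\<lambda>t. \<Sum>k\<in>F. ((lnorm k)\<^sup>2 * cmod (z k t))\<^sup>2) \<le> D"
    using enstrophy[OF assms] by blast
  have bD: "sum b F \<le> D" if "finite F" for F
    using D[OF that] Henstock_Kurzweil_Integration.integral_sum[OF that integrable_U_sum, of s T] unfolding b_def
    by (simp add: U_def power2_eq_square mult.assoc)
  have "b summable_on UNIV"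
    by (rule nonneg_bdd_above_summable_on) (auto intro!: bdd_aboveI2 bD b0)
  then have hs: "(b has_sum infsum b UNIV) UNIV" by (rule has_sum_infsum)
  have "\<exists>R. \<forall>F. finite F \<longrightarrow> (\<forall>l\<in>F. R \<le> lnorm l) \<longrightarrow> sum b F \<le> \<eta>" if "\<eta> > 0" for \<eta>
  proof -
    have "eventually (\<lambda>F. dist (sum b F) (infsum b UNIV) < \<eta>) (finite_subsets_at_top UNIV)"
      using hs that unfolding has_sum_def by (rule tendstoD)
    then obtain F0 where F0: "finite F0" "dist (sum b F0) (infsum b UNIV) < \<eta>"
      unfolding eventually_finite_subsets_at_top by auto
    obtain n where n: "F0 \<subseteq> lbox n" using F0 finite_subset_lbox by blast
    \<comment> \<open>Points of \<open>lbox n\<close> satisfy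
      \<open>lnorm l \<le> 2 * real n\<close>, so such an \<open>F\<close> is disjoint from
      \<open>F0\<close>.\<close>
    have "sum b F \<le> \<eta>" if F: "finite F" "\<forall>l\<in>F. 2 * real n + 1 \<le> lnorm l" for F
    proof -
      have "F0 \<inter> F = {}" using n F lbox_imp_lnorm by fastforce
      then have "sum b F0 + sum b F = sum b (F0 \<union> F)" using F0 F by (simp add: sum.union_disjoint)
      also have "\<dots> \<le> infsum b UNIV" using F0 F b0 by (intro finite_sum_le_infsum[OF \<open>b summable_on UNIV\<close>]) auto
      finally show ?thesis using F0(2) by (simp add: dist_real_def)
    qed
    then show ?thesis by blast
  qed
  moreover have "D \<ge> 0" using bD[of "{}"] by simp
  ultimately show ?thesis using that bD unfolding b_def by blast
qed

text \<open>On the large factor one may insert \<open>2 * lnorm l / lnorm k \<ge> 1\<close>.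
  Cauchy-Schwarz then pays with the enstrophy of the large factor and the energy \<open>E\<close> of
  the other one. The 16 is the square of this 2 times the 2 from
  \<open>convolution_halve\<close>.\<close>

lemma convolution_integral_le:
  assumes "s \<le> T" and k: "k \<noteq> 0"
    and \<delta>: "\<And>F. finite F \<Longrightarrow> (\<forall>l\<in>F. lnorm k \<le> 2 * lnorm l) \<Longrightarrow> (\<Sum>l\<in>F. integral {s..T} (\<lambda>\<tau>. (lnorm l * U l \<tau>)\<^sup>2)) \<le> \<delta>"
    and "finite F"
  shows "integral {s..T} (\<lambda>\<tau>. ((\<tau> - s) * (\<Sum>l\<in>F. U l \<tau> * U (k - l) \<tau>))\<^sup>2) \<le> (T - s)\<^sup>2 * (16 * E / (lnorm k)\<^sup>2) * \<delta>"
proof -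
  define G where "G = halfset k F"
  have fG: "finite G" and Gk: "\<And>l. l \<in> G \<Longrightarrow> lnorm k \<le> 2 * lnorm l"
    unfolding G_def using finite_halfset[OF assms(4)] by (auto simp: halfset_def)
  have k0: "lnorm k > 0" using lnorm_pos k by blast
  have pt: "(\<Sum>l\<in>F. U l \<tau> * U (k - l) \<tau>)\<^sup>2 \<le> (16 * E / (lnorm k)\<^sup>2) * (\<Sum>l\<in>G. (lnorm l * U l \<tau>)\<^sup>2)" for \<tau>
  proof -
    have "(\<Sum>l\<in>F. U l \<tau> * U (k - l) \<tau>) \<le> 2 * (\<Sum>l\<in>G. U l \<tau> * U (k - l) \<tau>)"
      unfolding G_def by (rule convolution_halve[OF assms(4)])
    also have "\<dots> \<le> 2 * (\<Sum>l\<in>G. (2 / lnorm k) * ((lnorm l * U l \<tau>) * U (k - l) \<tau>))"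
    proof (intro mult_left_mono sum_mono)
      fix l assume l: "l \<in> G"
      have "1 * (U l \<tau> * U (k - l) \<tau>) \<le> (2 * lnorm l / lnorm k) * (U l \<tau> * U (k - l) \<tau>)"
        using Gk[OF l] k0 by (intro mult_right_mono) auto
      then show "U l \<tau> * U (k - l) \<tau> \<le> (2 / lnorm k) * ((lnorm l * U l \<tau>) * U (k - l) \<tau>)" by (simp add: mult_ac)
    qed simp
    also have "\<dots> = (4 / lnorm k) * (\<Sum>l\<in>G. (lnorm l * U l \<tau>) * U (k - l) \<tau>)"
      by (simp only: sum_distrib_left[symmetric])
    finally have 1: "(\<Sum>l\<in>F. U l \<tau> * U (k - l) \<tau>) \<le> (4 / lnorm k) * (\<Sum>l\<in>G. (lnorm l * U l \<tau>) * U (k - l) \<tau>)" .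
    have "(\<Sum>l\<in>F. U l \<tau> * U (k - l) \<tau>)\<^sup>2 \<le> ((4 / lnorm k) * (\<Sum>l\<in>G. (lnorm l * U l \<tau>) * U (k - l) \<tau>))\<^sup>2"
      by (intro power_mono 1 sum_nonneg) auto
    also have "\<dots> = (16 / (lnorm k)\<^sup>2) * (\<Sum>l\<in>G. (lnorm l * U l \<tau>) * U (k - l) \<tau>)\<^sup>2"
      by (simp add: power_mult_distrib power_divide)
    also have "\<dots> \<le> (16 / (lnorm k)\<^sup>2) * ((\<Sum>l\<in>G. (lnorm l * U l \<tau>)\<^sup>2) * (\<Sum>l\<in>G. (U (k - l) \<tau>)\<^sup>2))"
      by (intro mult_left_mono Cauchy_Schwarz_ineq_sum) auto
    also have "(\<Sum>l\<in>G. (U (k - l) \<tau>)\<^sup>2) = (\<Sum>m\<in>(\<lambda>l. k - l) ` G. (U m \<tau>)\<^sup>2)"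
      by (subst sum.reindex) (auto simp: inj_on_def)
    also have "(16 / (lnorm k)\<^sup>2) * ((\<Sum>l\<in>G. (lnorm l * U l \<tau>)\<^sup>2) * \<dots>) \<le> (16 / (lnorm k)\<^sup>2) * ((\<Sum>l\<in>G. (lnorm l * U l \<tau>)\<^sup>2) * E)"
      using fG by (intro mult_left_mono U_energy sum_nonneg) auto
    finally show ?thesis by (simp add: mult_ac)
  qed
  have "integral {s..T} (\<lambda>\<tau>. ((\<tau> - s) * (\<Sum>l\<in>F. U l \<tau> * U (k - l) \<tau>))\<^sup>2)
     \<le> integral {s..T} (\<lambda>\<tau>. ((T - s)\<^sup>2 * (16 * E / (lnorm k)\<^sup>2)) * (\<Sum>l\<in>G. (lnorm l * U l \<tau>)\<^sup>2))"
  proof (rule integral_le)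
    fix \<tau> assume "\<tau> \<in> {s..T}"
    then have "(\<tau> - s)\<^sup>2 \<le> (T - s)\<^sup>2" by (intro power_mono) auto
    then show "((\<tau> - s) * (\<Sum>l\<in>F. U l \<tau> * U (k - l) \<tau>))\<^sup>2 \<le> ((T - s)\<^sup>2 * (16 * E / (lnorm k)\<^sup>2)) * (\<Sum>l\<in>G. (lnorm l * U l \<tau>)\<^sup>2)"
      unfolding power_mult_distrib mult.assoc using pt[of \<tau>] by (intro mult_mono) (auto simp: power_mult_distrib mult.assoc)
  qed (intro integrable_continuous_real continuous_intros continuous_U)+
  also have "\<dots> = ((T - s)\<^sup>2 * (16 * E / (lnorm k)\<^sup>2)) * (\<Sum>l\<in>G. integral {s..T} (\<lambda>\<tau>. (lnorm l * U l \<tau>)\<^sup>2))"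
    by (simp only: integral_mult_right Henstock_Kurzweil_Integration.integral_sum[OF fG integrable_U_sum])
  also have "\<dots> \<le> ((T - s)\<^sup>2 * (16 * E / (lnorm k)\<^sup>2)) * \<delta>"
    using E_nonneg Gk by (intro mult_left_mono \<delta>[OF fG]) auto
  finally show ?thesis .
qed

lemma first_gain:
  assumes sT: "s + 1 \<le> T"
  shows "\<eta> > 0 \<Longrightarrow> \<exists>R. \<forall>k. R \<le> lnorm k \<longrightarrow> (\<forall>t\<in>{s+1..T}. lnorm k * U k t \<le> \<eta>)"
    and "\<exists>C. \<forall>k. k \<noteq> 0 \<longrightarrow> integral {s+1..T} (\<lambda>\<tau>. (U k \<tau>)\<^sup>2) \<le> C / lnorm k ^ 4"
proof -
  have "s \<le> T" using sT by simp
  obtain D where D: "D \<ge> 0" "\<And>F. finite F \<Longrightarrow> (\<Sum>l\<in>F. integral {s..T} (\<lambda>\<tau>. (lnorm l * U l \<tau>)\<^sup>2)) \<le> D"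
    and tail: "\<And>\<eta>. \<eta> > 0 \<Longrightarrow> \<exists>R. \<forall>F. finite F \<longrightarrow> (\<forall>l\<in>F. R \<le> lnorm l) \<longrightarrow>
           (\<Sum>l\<in>F. integral {s..T} (\<lambda>\<tau>. (lnorm l * U l \<tau>)\<^sup>2)) \<le> \<eta>"
    using enstrophy_tail[OF \<open>s \<le> T\<close>] by blast
  define K1 where "K1 = 1 + 16 * c\<^sup>2 * (T - s)\<^sup>2 * E"
  have K1: "K1 > 0" unfolding K1_def using E_nonneg by (simp add: add_pos_nonneg)
  have main: "((t - s) * U k t)\<^sup>2 + (\<alpha> * (lnorm k)\<^sup>2) * integral {s..t} (\<lambda>\<tau>. ((\<tau> - s) * U k \<tau>)\<^sup>2)
      \<le> 3 / (\<alpha> * (lnorm k)\<^sup>2) * (K1 * \<delta> + (T - s) ^ 3 * (lnorm k * cmod (\<gamma> k))\<^sup>2)"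
    if k: "k \<noteq> 0" and t: "s \<le> t" "t \<le> T" and \<delta>: "\<And>F. finite F \<Longrightarrow> (\<forall>l\<in>F. lnorm k \<le> 2 * lnorm l) \<Longrightarrow> (\<Sum>l\<in>F. integral {s..T} (\<lambda>\<tau>. (lnorm l * U l \<tau>)\<^sup>2)) \<le> \<delta>"
    for k t \<delta>
  proof -
    have k1: "lnorm k \<ge> 1" using lnorm_ge_1 k by blast
    have "integral {s..T} (\<lambda>\<tau>. (U k \<tau>)\<^sup>2) \<le> integral {s..T} (\<lambda>\<tau>. (lnorm k * U k \<tau>)\<^sup>2)"
      using k1 by (intro integral_le integrable_continuous_real continuous_intros continuous_U power_mono le_mult_self) auto
    also have "\<dots> \<le> \<delta>" using \<delta>[of "{k}"] by simp
    finally have 1: "integral {s..T} (\<lambda>\<tau>. (U k \<tau>)\<^sup>2) \<le> \<delta>" .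
    have "((t - s) * U k t)\<^sup>2 + (\<alpha> * (lnorm k)\<^sup>2) * integral {s..t} (\<lambda>\<tau>. ((\<tau> - s) * U k \<tau>)\<^sup>2)
      \<le> 3 / (\<alpha> * (lnorm k)\<^sup>2) * (integral {s..T} (\<lambda>\<tau>. (U k \<tau>)\<^sup>2) + (T - s) ^ 3 * (lnorm k * cmod (\<gamma> k))\<^sup>2 + c\<^sup>2 * (lnorm k)\<^sup>2 * ((T - s)\<^sup>2 * (16 * E / (lnorm k)\<^sup>2) * \<delta>))"
      by (rule gain[OF k t convolution_integral_le[OF \<open>s \<le> T\<close> k \<delta>]]) auto
    also have "c\<^sup>2 * (lnorm k)\<^sup>2 * ((T - s)\<^sup>2 * (16 * E / (lnorm k)\<^sup>2) * \<delta>) = 16 * c\<^sup>2 * (T - s)\<^sup>2 * E * \<delta>"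
      using k1 by simp
    also have "3 / (\<alpha> * (lnorm k)\<^sup>2) * (integral {s..T} (\<lambda>\<tau>. (U k \<tau>)\<^sup>2) + (T - s) ^ 3 * (lnorm k * cmod (\<gamma> k))\<^sup>2 + 16 * c\<^sup>2 * (T - s)\<^sup>2 * E * \<delta>)
       \<le> 3 / (\<alpha> * (lnorm k)\<^sup>2) * (K1 * \<delta> + (T - s) ^ 3 * (lnorm k * cmod (\<gamma> k))\<^sup>2)"
      using 1 \<alpha> by (intro mult_left_mono) (auto simp: K1_def algebra_simps)
    finally show ?thesis .
  qed
  have int0: "0 \<le> integral {s..t} (\<lambda>\<tau>. ((\<tau> - s) * U k \<tau>)\<^sup>2)" for t k
    by (rule integral_nonneg) (auto intro!: integrable_continuous_real continuous_intros continuous_U)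
  show "\<exists>R. \<forall>k. R \<le> lnorm k \<longrightarrow> (\<forall>t\<in>{s+1..T}. lnorm k * U k t \<le> \<eta>)" if "\<eta> > 0"
  proof -
    define \<eta>' where "\<eta>' = \<eta>\<^sup>2 * \<alpha> / (3 * K1)"
    have "\<eta>' > 0" using that \<alpha> K1 by (simp add: \<eta>'_def)
    then obtain R where R: "\<And>F. finite F \<Longrightarrow> (\<forall>l\<in>F. R \<le> lnorm l) \<Longrightarrow>
           (\<Sum>l\<in>F. integral {s..T} (\<lambda>\<tau>. (lnorm l * U l \<tau>)\<^sup>2)) \<le> \<eta>'" using tail by blast
    \<comment> \<open>The entry \<open>2 * R\<close> passes from \<open>lnorm k\<close> to factors
      of half that size, and the last entry lies beyond all forced modes.\<close>
    define R' where "R' = max 1 (max (2 * R) (sqrt (\<Lambda> / \<alpha>) + 1))"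
    have "lnorm k * U k t \<le> \<eta>" if kR: "R' \<le> lnorm k" and t: "t \<in> {s+1..T}" for k t
    proof -
      have k: "k \<noteq> 0" and k1: "lnorm k \<ge> 1" using kR by (auto simp: R'_def)
      have g: "\<gamma> k = 0" using kR by (intro forcing_large) (auto simp: R'_def)
      have "((t - s) * U k t)\<^sup>2 + (\<alpha> * (lnorm k)\<^sup>2) * integral {s..t} (\<lambda>\<tau>. ((\<tau> - s) * U k \<tau>)\<^sup>2)
        \<le> 3 / (\<alpha> * (lnorm k)\<^sup>2) * (K1 * \<eta>' + (T - s) ^ 3 * (lnorm k * cmod (\<gamma> k))\<^sup>2)"
      proof (rule main[OF k])
        fix F assume "finite F" and F: "\<forall>l\<in>F. lnorm k \<le> 2 * lnorm l"
        have "\<forall>l\<in>F. R \<le> lnorm l" using F kR by (auto simp: R'_def)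
        then show "(\<Sum>l\<in>F. integral {s..T} (\<lambda>\<tau>. (lnorm l * U l \<tau>)\<^sup>2)) \<le> \<eta>'" using R \<open>finite F\<close> by blast
      qed (use t in auto)
      also have "\<dots> = \<eta>\<^sup>2 / (lnorm k)\<^sup>2" using g \<alpha> K1 by (simp add: \<eta>'_def)
      finally have "((t - s) * U k t)\<^sup>2 \<le> \<eta>\<^sup>2 / (lnorm k)\<^sup>2"
        using int0[of t k] \<alpha> by (smt (verit) mult_nonneg_nonneg zero_le_power2)
      moreover have "(U k t)\<^sup>2 \<le> ((t - s) * U k t)\<^sup>2"
        using t by (intro power_mono le_mult_self) auto
      ultimately have "(U k t)\<^sup>2 \<le> \<eta>\<^sup>2 / (lnorm k)\<^sup>2" by linarith
      then have "(lnorm k * U k t)\<^sup>2 \<le> \<eta>\<^sup>2" using k1 by (simp add: power_mult_distrib field_simps)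
      then show ?thesis using that(1) \<open>\<eta> > 0\<close> by (meson less_imp_le power2_le_imp_le)
    qed
    then show ?thesis by blast
  qed
  show "\<exists>C. \<forall>k. k \<noteq> 0 \<longrightarrow> integral {s+1..T} (\<lambda>\<tau>. (U k \<tau>)\<^sup>2) \<le> C / lnorm k ^ 4"
  proof -
    obtain \<Gamma> where \<Gamma>: "\<And>k. (lnorm k * cmod (\<gamma> k))\<^sup>2 \<le> \<Gamma>" using forcing_bound[of 0] by auto
    define C where "C = 3 / \<alpha>\<^sup>2 * (K1 * D + (T - s) ^ 3 * \<Gamma>)"
    have "integral {s+1..T} (\<lambda>\<tau>. (U k \<tau>)\<^sup>2) \<le> C / lnorm k ^ 4" if k: "k \<noteq> 0" for k
    proof -
      have k1: "lnorm k \<ge> 1" using lnorm_ge_1 k by blast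
      have "integral {s+1..T} (\<lambda>\<tau>. (U k \<tau>)\<^sup>2) \<le> integral {s+1..T} (\<lambda>\<tau>. ((\<tau> - s) * U k \<tau>)\<^sup>2)"
        by (intro integral_le integrable_continuous_real continuous_intros continuous_U power_mono le_mult_self) auto
      also have "\<dots> \<le> integral {s..T} (\<lambda>\<tau>. ((\<tau> - s) * U k \<tau>)\<^sup>2)"
        by (intro integral_subset_le integrable_continuous_real continuous_intros continuous_U) auto
      finally have 1: "integral {s+1..T} (\<lambda>\<tau>. (U k \<tau>)\<^sup>2) \<le> integral {s..T} (\<lambda>\<tau>. ((\<tau> - s) * U k \<tau>)\<^sup>2)" .
      have "((T - s) * U k T)\<^sup>2 + (\<alpha> * (lnorm k)\<^sup>2) * integral {s..T} (\<lambda>\<tau>. ((\<tau> - s) * U k \<tau>)\<^sup>2)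
        \<le> 3 / (\<alpha> * (lnorm k)\<^sup>2) * (K1 * D + (T - s) ^ 3 * (lnorm k * cmod (\<gamma> k))\<^sup>2)"
        using \<open>s \<le> T\<close> D(2) by (intro main[OF k]) auto
      also have "\<dots> \<le> 3 / (\<alpha> * (lnorm k)\<^sup>2) * (K1 * D + (T - s) ^ 3 * \<Gamma>)"
        using \<Gamma>[of k] \<alpha> \<open>s \<le> T\<close> by (intro mult_left_mono add_left_mono) auto
      finally have "(\<alpha> * (lnorm k)\<^sup>2) * integral {s..T} (\<lambda>\<tau>. ((\<tau> - s) * U k \<tau>)\<^sup>2) \<le> 3 / (\<alpha> * (lnorm k)\<^sup>2) * (K1 * D + (T - s) ^ 3 * \<Gamma>)"
        by (smt (verit) zero_le_power2)
      then have "integral {s..T} (\<lambda>\<tau>. ((\<tau> - s) * U k \<tau>)\<^sup>2) \<le> 3 / (\<alpha> * (lnorm k)\<^sup>2) * (K1 * D + (T - s) ^ 3 * \<Gamma>) / (\<alpha> * (lnorm k)\<^sup>2)"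
        using \<alpha> k1 by (simp add: pos_le_divide_eq mult.commute)
      also have "\<dots> = C / lnorm k ^ 4" using \<alpha> k1 by (simp add: C_def power2_eq_square power4_eq_xxxx)
      finally show ?thesis using 1 by linarith
    qed
    then show ?thesis by blast
  qed
qed

end

section \<open>Absorption of the convolution into the dissipation\<close>

lemma weighted_Cauchy_Schwarz:
  fixes u v w :: "'a \<Rightarrow> real"
  assumes "\<And>l. l \<in> G \<Longrightarrow> u l \<ge> 0" "\<And>l. l \<in> G \<Longrightarrow> w l > 0"
  shows "(\<Sum>l\<in>G. v l * u l)\<^sup>2 \<le> (\<Sum>l\<in>G. u l / w l) * (\<Sum>l\<in>G. w l * u l * (v l)\<^sup>2)"
proof -
  \<comment> \<open>As in a Schur test, the kernel \<open>u\<close> is shared between both factors: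
    one becomes the sum of \<open>u l / w l\<close>, which the weighted convolution estimates
    control, the other carries the weighted unknown.\<close>
  have "(\<Sum>l\<in>G. v l * u l) = (\<Sum>l\<in>G. sqrt (u l / w l) * (sqrt (u l * w l) * v l))"
  proof (rule sum.cong[OF refl])
    fix l assume "l \<in> G"
    then have p: "u l \<ge> 0" "w l > 0" using assms by auto
    have "sqrt (u l / w l) * sqrt (u l * w l) = sqrt ((u l)\<^sup>2)"
      using p by (simp add: real_sqrt_mult[symmetric] power2_eq_square)
    then show "v l * u l = sqrt (u l / w l) * (sqrt (u l * w l) * v l)" using p by (simp add: mult.assoc[symmetric])
  qed
  also have "(\<dots>)\<^sup>2 \<le> (\<Sum>l\<in>G. (sqrt (u l / w l))\<^sup>2) * (\<Sum>l\<in>G. (sqrt (u l * w l) * v l)\<^sup>2)"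
    by (rule Cauchy_Schwarz_ineq_sum)
  also have "(\<Sum>l\<in>G. (sqrt (u l / w l))\<^sup>2) = (\<Sum>l\<in>G. u l / w l)"
    using assms by (intro sum.cong) (auto simp: less_imp_le)
  also have "(\<Sum>l\<in>G. (sqrt (u l * w l) * v l)\<^sup>2) = (\<Sum>l\<in>G. w l * u l * (v l)\<^sup>2)"
    using assms by (intro sum.cong) (auto simp: power_mult_distrib less_imp_le mult.commute)
  finally show ?thesis .
qed

lemma absorb_identity:
  fixes a P W Q :: real
  assumes "a > 0" "P > 0" "W > 0" "Q > 0"
  shows "3 / (a * P\<^sup>2) * (A0 / Q + c\<^sup>2 * P\<^sup>2 * (4 * Y * (\<eta> * P / W)\<^sup>2)) / (a * P\<^sup>2) =
    3 / a\<^sup>2 * (A0 / (Q * P ^ 4)) + 12 * c\<^sup>2 * \<eta>\<^sup>2 / a\<^sup>2 * Y / W\<^sup>2"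
  using assms by (simp add: field_simps power2_eq_square power4_eq_xxxx)

lemma collect_identity:
  fixes a P :: real
  assumes "a > 0" "P > 0"
  shows "3 / (a * P\<^sup>2) * (A0 / P ^ (2 * n) + R / P ^ (2 * n)) = 3 / a * (A0 + R) / (P ^ (n + 1))\<^sup>2"
proof -
  have "(P ^ (n + 1))\<^sup>2 = P\<^sup>2 * P ^ (2 * n)"
    by (simp add: power2_eq_square mult_2 power_add)
  moreover have "3 / (a * x) * (A0 / y + R / y) = 3 / a * (A0 + R) / (x * y)" for x y
    by (simp add: add_divide_distrib[symmetric])
  ultimately show ?thesis by simp
qed

lemma power_shift_square: "((x::real) ^ (n + 2))\<^sup>2 = x ^ (2 * n + 4)"
proof -
  have "(n + 2) * 2 = 2 * n + 4" by simp
  then show ?thesis by (metis power_mult)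
qed

context lattice_ode
begin

text \<open>The supremum \<open>Y\<close> of \<open>(wgt N n k)\<^sup>2 * b k\<close> satisfies
  \<open>Y \<le> A + Y / 2\<close> unless it is attained at the level of the low modes: at high
  modes the convolution costs only a small multiple of \<open>Y\<close>, at low modes the hypothesis
  on the integrals suffices. With \<open>n \<ge> 2\<close> the supremum is finite, because for fixed
  \<open>N\<close> the squared weight grows at most like \<open>lnorm k ^ 4\<close>. The resulting
  bound does not depend on \<open>N\<close>, so \<open>N\<close> may be adapted to \<open>k\<close>
  afterwards, and a further use of \<open>gain\<close> turns the integrated decay into pointwise
  decay.\<close>

lemma second_gain:
  assumes sT: "s + 1 \<le> T" and n: "n \<ge> 2"
    and small: "\<And>\<eta>. \<eta> > 0 \<Longrightarrow> \<exists>R. \<forall>k. R \<le> lnorm k \<longrightarrow> (\<forall>t\<in>{s..T}. lnorm k * U k t \<le> \<eta>)"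
    and C: "\<And>k. k \<noteq> 0 \<Longrightarrow> integral {s..T} (\<lambda>\<tau>. (U k \<tau>)\<^sup>2) \<le> C / lnorm k ^ (2 * n)"
  shows "\<exists>C'. \<forall>k. k \<noteq> 0 \<longrightarrow> (\<forall>t\<in>{s+1..T}. U k t \<le> C' / lnorm k ^ (n + 1))
            \<and> integral {s+1..T} (\<lambda>\<tau>. (U k \<tau>)\<^sup>2) \<le> C' / lnorm k ^ (2 * n + 4)"
proof -
  have "s \<le> T" using sT by simp
  \<comment> \<open>A majorant constant in time for one factor of the convolution, so that only the
    other factor stays under the time integral.\<close>
  define u where "u m = (SUP t\<in>{s..T}. U m t)" for m
  have bdd: "bdd_above (U m ` {s..T})" for m by (intro bdd_aboveI2[of _ _ "sqrt E"] U_le)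
  have Uu: "U m t \<le> u m" if "t \<in> {s..T}" for m t
    unfolding u_def by (rule cSUP_upper[OF that bdd])
  have u_le: "u m \<le> r" if "\<And>t. t \<in> {s..T} \<Longrightarrow> U m t \<le> r" for m r
    unfolding u_def using \<open>s \<le> T\<close> that by (intro cSUP_least) auto
  have unn: "u m \<ge> 0" for m using order_trans[OF U_nonneg Uu[of s m]] \<open>s \<le> T\<close> by simp
  have u0: "u 0 = 0" using u_le[of 0 0] unn[of 0] by simp
  have us: "\<exists>R. \<forall>m. R \<le> lnorm m \<longrightarrow> lnorm m * u m \<le> \<eta>" if \<eta>: "\<eta> > 0" for \<eta>
  proof -
    obtain R where R: "\<And>k t. R \<le> lnorm k \<Longrightarrow> t \<in> {s..T} \<Longrightarrow> lnorm k * U k t \<le> \<eta>" using small[OF \<eta>] by blast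
    have "lnorm m * u m \<le> \<eta>" if "max R 1 \<le> lnorm m" for m
    proof -
      have "u m \<le> \<eta> / lnorm m" using R[of m] that by (intro u_le) (auto simp: field_simps)
      then show ?thesis using that by (simp add: field_simps)
    qed
    then show ?thesis by blast
  qed
  \<comment> \<open>A bound for all modes, by 1 at high modes and through the energy at low ones. It
    enters the concluding pointwise estimate, where any constant will do.\<close>
  obtain e where e: "\<And>m. lnorm m * u m \<le> e"
  proof -
    obtain R where R: "\<And>m. R \<le> lnorm m \<Longrightarrow> lnorm m * u m \<le> 1" using us[of 1] by auto
    have "lnorm m * u m \<le> max 1 (\<bar>R\<bar> * sqrt E)" for m
    proof (cases "R \<le> lnorm m")
      case False
      then have "lnorm m * u m \<le> \<bar>R\<bar> * sqrt E" using unn U_le by (intro mult_mono u_le) auto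
      then show ?thesis by simp
    qed (simp add: R le_max_iff_disj)
    then show ?thesis using that by blast
  qed
  define b where "b k = integral {s..T} (\<lambda>\<tau>. ((\<tau> - s) * U k \<tau>)\<^sup>2)" for k
  have b0: "b k \<ge> 0" for k unfolding b_def
    by (rule integral_nonneg) (auto intro!: integrable_continuous_real continuous_intros continuous_U)
  have bC: "b k \<le> (T - s)\<^sup>2 * C / lnorm k ^ (2 * n)" if "k \<noteq> 0" for k
  proof -
    have "b k \<le> integral {s..T} (\<lambda>\<tau>. (T - s)\<^sup>2 * (U k \<tau>)\<^sup>2)" unfolding b_def power_mult_distrib
      by (intro integral_le integrable_continuous_real continuous_intros continuous_U mult_right_mono power_mono) auto
    also have "\<dots> \<le> (T - s)\<^sup>2 * (C / lnorm k ^ (2 * n))" using mult_left_mono[OF C[OF that], of "(T - s)\<^sup>2"] by simp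
    finally show ?thesis by simp
  qed
  have C0: "C \<ge> 0"
  proof -
    have k: "((1,0)::int\<times>int) \<noteq> 0" by (simp add: zero_prod_def)
    have "0 \<le> integral {s..T} (\<lambda>\<tau>. (U (1,0) \<tau>)\<^sup>2)"
      by (rule integral_nonneg) (auto intro!: integrable_continuous_real continuous_intros continuous_U)
    then have "0 \<le> C / lnorm (1,0) ^ (2 * n)" using C[OF k] by linarith
    then show ?thesis using zero_less_power[OF lnorm_pos[OF k], of "2 * n"] by (simp add: zero_le_divide_iff)
  qed
  obtain \<Gamma> where \<Gamma>: "\<Gamma> \<ge> 0" "\<And>k. lnorm k ^ (2 * n) * (lnorm k * cmod (\<gamma> k))\<^sup>2 \<le> \<Gamma>" using forcing_bound by blast
  define A0 where "A0 = C + (T - s) ^ 3 * \<Gamma>"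
  have src: "integral {s..T} (\<lambda>\<tau>. (U k \<tau>)\<^sup>2) + (T - s) ^ 3 * (lnorm k * cmod (\<gamma> k))\<^sup>2 \<le> A0 / lnorm k ^ (2 * n)" if "k \<noteq> 0" for k
  proof -
    have p: "lnorm k ^ (2 * n) > 0" using lnorm_pos[OF that] by simp
    have "(lnorm k * cmod (\<gamma> k))\<^sup>2 \<le> \<Gamma> / lnorm k ^ (2 * n)" using \<Gamma>(2)[of k] p by (simp add: field_simps)
    then have "(T - s) ^ 3 * (lnorm k * cmod (\<gamma> k))\<^sup>2 \<le> (T - s) ^ 3 * (\<Gamma> / lnorm k ^ (2 * n))" using \<open>s \<le> T\<close> by (intro mult_left_mono) auto
    then show ?thesis using C[OF that] by (simp add: A0_def add_divide_distrib)
  qed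
  \<comment> \<open>Stated for arbitrary \<open>X\<close> and \<open>S\<close> because it is applied
    twice: with the unknown supremum \<open>Y\<close> and the small kernel bound for the absorption,
    and later with the final \<open>X\<close>, \<open>N = lnorm k\<close> and the kernel bound from
    \<open>e\<close>.\<close>
  have B: "integral {s..T} (\<lambda>\<tau>. ((\<tau> - s) * (\<Sum>l\<in>F. U l \<tau> * U (k - l) \<tau>))\<^sup>2) \<le> 4 * X * S\<^sup>2"
    if k: "k \<noteq> 0" and N: "N \<ge> 1" and F: "finite F" and X: "X \<ge> 0" "\<And>l. (wgt N n l)\<^sup>2 * b l \<le> X"
      and S: "(\<Sum>l\<in>halfset k F. u (k - l) / wgt N n l) \<le> S" for k N F X S
  proof -
    define G where "G = halfset k F"
    have fG: "finite G" unfolding G_def by (rule finite_halfset[OF F])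
    have w: "wgt N n l > 0" if "l \<in> G" for l using that halfset_nonzero[OF k] wgt_pos[OF _ N] unfolding G_def by blast
    define \<Sigma> where "\<Sigma> = (\<Sum>l\<in>G. u (k - l) / wgt N n l)"
    have \<Sigma>0: "\<Sigma> \<ge> 0" unfolding \<Sigma>_def using w unn by (intro sum_nonneg divide_nonneg_pos) auto
    have pt: "((\<tau> - s) * (\<Sum>l\<in>F. U l \<tau> * U (k - l) \<tau>))\<^sup>2 \<le> 4 * \<Sigma> * (\<Sum>l\<in>G. wgt N n l * u (k - l) * ((\<tau> - s) * U l \<tau>)\<^sup>2)"
      if \<tau>: "\<tau> \<in> {s..T}" for \<tau>
    proof -
      have "(\<tau> - s) * (\<Sum>l\<in>F. U l \<tau> * U (k - l) \<tau>) \<le> (\<tau> - s) * (2 * (\<Sum>l\<in>G. U l \<tau> * U (k - l) \<tau>))"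
        unfolding G_def using \<tau> by (intro mult_left_mono convolution_halve F) auto
      also have "\<dots> \<le> (\<tau> - s) * (2 * (\<Sum>l\<in>G. U l \<tau> * u (k - l)))"
        using \<tau> by (intro mult_left_mono sum_mono Uu) auto
      also have "\<dots> = 2 * (\<Sum>l\<in>G. ((\<tau> - s) * U l \<tau>) * u (k - l))"
        by (simp add: sum_distrib_left mult_ac)
      finally have "((\<tau> - s) * (\<Sum>l\<in>F. U l \<tau> * U (k - l) \<tau>))\<^sup>2 \<le> (2 * (\<Sum>l\<in>G. ((\<tau> - s) * U l \<tau>) * u (k - l)))\<^sup>2"
        using \<tau> by (intro power_mono mult_nonneg_nonneg sum_nonneg) auto
      also have "\<dots> = 4 * (\<Sum>l\<in>G. ((\<tau> - s) * U l \<tau>) * u (k - l))\<^sup>2" by (simp add: power_mult_distrib)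
      also have "\<dots> \<le> 4 * (\<Sigma> * (\<Sum>l\<in>G. wgt N n l * u (k - l) * ((\<tau> - s) * U l \<tau>)\<^sup>2))"
        unfolding \<Sigma>_def using unn w by (intro mult_left_mono weighted_Cauchy_Schwarz) auto
      finally show ?thesis by simp
    qed
    have "integral {s..T} (\<lambda>\<tau>. ((\<tau> - s) * (\<Sum>l\<in>F. U l \<tau> * U (k - l) \<tau>))\<^sup>2)
       \<le> integral {s..T} (\<lambda>\<tau>. 4 * \<Sigma> * (\<Sum>l\<in>G. wgt N n l * u (k - l) * ((\<tau> - s) * U l \<tau>)\<^sup>2))"
      by (intro integral_le pt integrable_continuous_real continuous_intros continuous_U)
    also have "\<dots> = 4 * \<Sigma> * (\<Sum>l\<in>G. wgt N n l * u (k - l) * b l)"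
    proof -
      have "integral {s..T} (\<lambda>\<tau>. \<Sum>l\<in>G. wgt N n l * u (k - l) * ((\<tau> - s) * U l \<tau>)\<^sup>2) = (\<Sum>l\<in>G. integral {s..T} (\<lambda>\<tau>. wgt N n l * u (k - l) * ((\<tau> - s) * U l \<tau>)\<^sup>2))"
        by (intro Henstock_Kurzweil_Integration.integral_sum fG integrable_continuous_real continuous_intros continuous_U)
      then show ?thesis by (simp add: b_def)
    qed
    also have "\<dots> \<le> 4 * \<Sigma> * (\<Sum>l\<in>G. X * (u (k - l) / wgt N n l))"
    proof (intro mult_left_mono sum_mono)
      fix l assume l: "l \<in> G"
      have "wgt N n l * b l \<le> X / wgt N n l" using X(2)[of l] w[OF l] by (simp add: field_simps power2_eq_square)
      then have "u (k - l) * (wgt N n l * b l) \<le> u (k - l) * (X / wgt N n l)" using unn by (intro mult_left_mono) auto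
      then show "wgt N n l * u (k - l) * b l \<le> X * (u (k - l) / wgt N n l)" by (simp add: mult_ac)
    qed (use \<Sigma>0 in auto)
    also have "\<dots> = 4 * X * \<Sigma>\<^sup>2" unfolding \<Sigma>_def sum_distrib_left[symmetric] by (simp add: power2_eq_square)
    also have "\<dots> \<le> 4 * X * S\<^sup>2" using S X \<Sigma>0 unfolding \<Sigma>_def G_def by (intro mult_left_mono power_mono) auto
    finally show ?thesis .
  qed
  \<comment> \<open>The absorbed coefficient
    \<open>12 * c\<^sup>2 * \<eta>\<^sup>2 / \<alpha>\<^sup>2\<close>, with 12 from the 3 of
    \<open>gain\<close> and the 4 of \<open>B\<close>, becomes \<open>12 / 25\<close> times the
    square of \<open>\<bar>c\<bar> / (\<bar>c\<bar> + 1)\<close>; the \<open>+ 1\<close> admits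
    \<open>c = 0\<close>.\<close>
  define \<eta> where "\<eta> = \<alpha> / (5 * (\<bar>c\<bar> + 1))"
  have \<eta>: "\<eta> > 0" using \<alpha> by (simp add: \<eta>_def)
  have \<eta>c: "12 * c\<^sup>2 * \<eta>\<^sup>2 / \<alpha>\<^sup>2 \<le> 1 / 2"
  proof -
    have "12 * c\<^sup>2 * (\<alpha> / (5 * d))\<^sup>2 / \<alpha>\<^sup>2 = 12/25 * (\<bar>c\<bar> / d)\<^sup>2" if "d > 0" for d
      using \<alpha> that by (simp add: power_divide power_mult_distrib field_simps)
    from this[of "\<bar>c\<bar> + 1"]
    have "12 * c\<^sup>2 * \<eta>\<^sup>2 / \<alpha>\<^sup>2 = 12/25 * (\<bar>c\<bar> / (\<bar>c\<bar> + 1))\<^sup>2" unfolding \<eta>_def by simp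
    also have "(\<bar>c\<bar> / (\<bar>c\<bar> + 1))\<^sup>2 \<le> 1" by (intro power_le_one) auto
    finally show ?thesis by simp
  qed
  obtain K where K: "\<And>k N F. K \<le> lnorm k \<Longrightarrow> k \<noteq> 0 \<Longrightarrow> N \<ge> 1 \<Longrightarrow> finite F \<Longrightarrow> (\<forall>l\<in>F. lnorm k \<le> 2 * lnorm l) \<Longrightarrow>
     (\<Sum>l\<in>F. u (k - l) / wgt N n l) \<le> \<eta> * lnorm k / wgt N n k"
    using weighted_convolution_small[OF u0 unn us \<eta>, of n] by blast
  \<comment> \<open>The first summand solves \<open>Y \<le> A + Y / 2\<close>, the second covers the
    modes with \<open>lnorm k < K\<close>, where the a priori decay of \<open>b k\<close> leaves
    four powers of \<open>lnorm k\<close>.\<close>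
  define X where "X = 2 * (3 / \<alpha>\<^sup>2 * A0) + (T - s)\<^sup>2 * C * \<bar>K\<bar> ^ 4"
  have A0: "A0 \<ge> 0" unfolding A0_def using C0 \<Gamma> \<open>s \<le> T\<close> by simp
  have X0: "X \<ge> 0" unfolding X_def using A0 C0 by simp
  have X: "(wgt N n k)\<^sup>2 * b k \<le> X" if N: "N \<ge> 1" for N k
  proof -
    define Y where "Y = (SUP k. (wgt N n k)\<^sup>2 * b k)"
    have "bdd_above (range (\<lambda>k. (wgt N n k)\<^sup>2 * b k))"
    proof (rule bdd_aboveI2)
      fix k show "(wgt N n k)\<^sup>2 * b k \<le> (N ^ n)\<^sup>2 * ((T - s)\<^sup>2 * C)"
      proof (cases "k = 0")
        case True then show ?thesis using C0 by (simp add: wgt_def)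
      next
        case False
        then have k1: "lnorm k \<ge> 1" by (rule lnorm_ge_1)
        have "min (lnorm k) N ^ n \<le> N ^ n" using N by (intro power_mono) auto
        then have "wgt N n k \<le> (lnorm k)\<^sup>2 * N ^ n" unfolding wgt_def by (intro mult_left_mono) auto
        then have w: "(wgt N n k)\<^sup>2 \<le> ((lnorm k)\<^sup>2 * N ^ n)\<^sup>2" using wgt_nonneg[OF N] by (intro power_mono) auto
        have "lnorm k ^ 4 \<le> lnorm k ^ (2 * n)" using k1 n by (intro power_increasing) auto
        then have "b k \<le> (T - s)\<^sup>2 * C / lnorm k ^ 4"
          using k1 C0 by (intro order_trans[OF bC[OF False]] divide_left_mono) auto
        then have "(wgt N n k)\<^sup>2 * b k \<le> ((lnorm k)\<^sup>2 * N ^ n)\<^sup>2 * ((T - s)\<^sup>2 * C / lnorm k ^ 4)"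
          using w b0 by (intro mult_mono) auto
        also have "\<dots> = (N ^ n)\<^sup>2 * ((T - s)\<^sup>2 * C)" using k1 by (simp add: power_mult_distrib flip: power_mult)
        finally show ?thesis .
      qed
    qed
    then have Y: "(wgt N n k)\<^sup>2 * b k \<le> Y" for k unfolding Y_def by (rule cSUP_upper[OF UNIV_I])
    have Y0: "Y \<ge> 0" using Y[of 0] b0[of 0] by (simp add: wgt_def)
    have step: "(wgt N n k)\<^sup>2 * b k \<le> max (3 / \<alpha>\<^sup>2 * A0 + Y / 2) ((T - s)\<^sup>2 * C * \<bar>K\<bar> ^ 4)" for k
    proof (cases "k = 0")
      case True then show ?thesis using C0 by (simp add: wgt_def le_max_iff_disj)
    next
      case False
      then have k1: "lnorm k \<ge> 1" by (rule lnorm_ge_1)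
      have w0: "wgt N n k > 0" by (rule wgt_pos[OF False N])
      have wle: "wgt N n k \<le> lnorm k ^ (n + 2)" by (rule wgt_le[OF N])
      have wle2: "(wgt N n k)\<^sup>2 \<le> lnorm k ^ (2 * n) * lnorm k ^ 4"
      proof -
        have "(wgt N n k)\<^sup>2 \<le> (lnorm k ^ (n + 2))\<^sup>2" using wle w0 by (intro power_mono) auto
        also have "\<dots> = lnorm k ^ (2 * n) * lnorm k ^ 4" unfolding power_shift_square by (rule power_add)
        finally show ?thesis .
      qed
      show ?thesis
      proof (cases "K \<le> lnorm k")
        case True
        define S where "S = \<eta> * lnorm k / wgt N n k"
        have "((T - s) * U k T)\<^sup>2 + (\<alpha> * (lnorm k)\<^sup>2) * b k
            \<le> 3 / (\<alpha> * (lnorm k)\<^sup>2) * (integral {s..T} (\<lambda>\<tau>. (U k \<tau>)\<^sup>2) + (T - s) ^ 3 * (lnorm k * cmod (\<gamma> k))\<^sup>2 + c\<^sup>2 * (lnorm k)\<^sup>2 * (4 * Y * S\<^sup>2))"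
          unfolding b_def
        proof (rule gain[OF False \<open>s \<le> T\<close> order_refl])
          fix F :: "(int \<times> int) set" assume F: "finite F"
          show "integral {s..T} (\<lambda>\<tau>. ((\<tau> - s) * (\<Sum>l\<in>F. U l \<tau> * U (k - l) \<tau>))\<^sup>2) \<le> 4 * Y * S\<^sup>2"
            unfolding S_def by (intro B[OF False N F Y0 Y] K[OF True False N] finite_halfset F) (auto simp: halfset_def)
        qed
        also have "\<dots> \<le> 3 / (\<alpha> * (lnorm k)\<^sup>2) * (A0 / lnorm k ^ (2 * n) + c\<^sup>2 * (lnorm k)\<^sup>2 * (4 * Y * S\<^sup>2))"
          using src[OF False] \<alpha> by (intro mult_left_mono add_right_mono) auto
        finally have "(\<alpha> * (lnorm k)\<^sup>2) * b k \<le> 3 / (\<alpha> * (lnorm k)\<^sup>2) * (A0 / lnorm k ^ (2 * n) + c\<^sup>2 * (lnorm k)\<^sup>2 * (4 * Y * S\<^sup>2))"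
          by (smt (verit) zero_le_power2)
        moreover have "\<alpha> * (lnorm k)\<^sup>2 > 0" using \<alpha> k1 by simp
        ultimately have "b k \<le> 3 / (\<alpha> * (lnorm k)\<^sup>2) * (A0 / lnorm k ^ (2 * n) + c\<^sup>2 * (lnorm k)\<^sup>2 * (4 * Y * S\<^sup>2)) / (\<alpha> * (lnorm k)\<^sup>2)"
          by (intro mult_imp_le_div_pos) (simp_all only: mult.commute[of "b k"])
        also have "\<dots> = 3 / \<alpha>\<^sup>2 * (A0 / (lnorm k ^ (2 * n) * lnorm k ^ 4)) + 12 * c\<^sup>2 * \<eta>\<^sup>2 / \<alpha>\<^sup>2 * Y / (wgt N n k)\<^sup>2"
          unfolding S_def using \<alpha> k1 w0 by (intro absorb_identity) auto
        finally have "(wgt N n k)\<^sup>2 * b k \<le> (wgt N n k)\<^sup>2 * (3 / \<alpha>\<^sup>2 * (A0 / (lnorm k ^ (2 * n) * lnorm k ^ 4)) + 12 * c\<^sup>2 * \<eta>\<^sup>2 / \<alpha>\<^sup>2 * Y / (wgt N n k)\<^sup>2)"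
          by (intro mult_left_mono) auto
        also have "\<dots> = 3 / \<alpha>\<^sup>2 * (A0 * ((wgt N n k)\<^sup>2 / (lnorm k ^ (2 * n) * lnorm k ^ 4))) + 12 * c\<^sup>2 * \<eta>\<^sup>2 / \<alpha>\<^sup>2 * Y"
          using w0 by (simp add: field_simps)
        also have "\<dots> \<le> 3 / \<alpha>\<^sup>2 * (A0 * 1) + 1 / 2 * Y"
          using wle2 A0 Y0 \<eta>c k1 by (intro add_mono mult_left_mono mult_right_mono) auto
        finally show ?thesis by (simp add: le_max_iff_disj)
      next
        case K': False
        have "(wgt N n k)\<^sup>2 * b k \<le> (lnorm k ^ (2 * n) * lnorm k ^ 4) * ((T - s)\<^sup>2 * C / lnorm k ^ (2 * n))"
          using b0 by (intro mult_mono wle2 bC[OF False]) auto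
        also have "\<dots> = (T - s)\<^sup>2 * C * lnorm k ^ 4" using k1 by simp
        also have "\<dots> \<le> (T - s)\<^sup>2 * C * \<bar>K\<bar> ^ 4" using K' C0 by (intro mult_left_mono power_mono) auto
        finally show ?thesis by (simp add: le_max_iff_disj)
      qed
    qed
    have "Y \<le> max (3 / \<alpha>\<^sup>2 * A0 + Y / 2) ((T - s)\<^sup>2 * C * \<bar>K\<bar> ^ 4)"
      unfolding Y_def[of] by (rule cSUP_least) (use step in \<open>auto simp: Y_def\<close>)
    moreover have "0 \<le> 3 / \<alpha>\<^sup>2 * A0" "0 \<le> (T - s)\<^sup>2 * C * \<bar>K\<bar> ^ 4" using A0 C0 by auto
    ultimately have "Y \<le> X" unfolding X_def by linarith
    then show ?thesis using Y[of k] by linarith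
  qed
  define \<kappa> where "\<kappa> = conv_const n * e"
  define C1 where "C1 = 3 / \<alpha> * (A0 + 4 * c\<^sup>2 * X * \<kappa>\<^sup>2)"
  have "(\<forall>t\<in>{s+1..T}. U k t \<le> (sqrt C1 + X) / lnorm k ^ (n + 1)) \<and> integral {s+1..T} (\<lambda>\<tau>. (U k \<tau>)\<^sup>2) \<le> (sqrt C1 + X) / lnorm k ^ (2 * n + 4)"
    if k: "k \<noteq> 0" for k
  proof -
    have k1: "lnorm k \<ge> 1" using k by (rule lnorm_ge_1)
    have C1: "C1 \<ge> 0" unfolding C1_def using A0 X0 \<alpha> by simp
    \<comment> \<open>With \<open>N = lnorm k\<close> the truncation is inactive at \<open>k\<close>
      itself.\<close>
    have wk: "wgt (lnorm k) n k = lnorm k ^ (n + 2)" by (rule wgt_eq) simp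
    have "integral {s+1..T} (\<lambda>\<tau>. (U k \<tau>)\<^sup>2) \<le> integral {s+1..T} (\<lambda>\<tau>. ((\<tau> - s) * U k \<tau>)\<^sup>2)"
      by (intro integral_le integrable_continuous_real continuous_intros continuous_U power_mono le_mult_self) auto
    also have "\<dots> \<le> b k" unfolding b_def
      by (intro integral_subset_le integrable_continuous_real continuous_intros continuous_U) auto
    also have "b k \<le> X / lnorm k ^ (2 * n + 4)"
    proof -
      have "(lnorm k ^ (n + 2))\<^sup>2 * b k \<le> X" using X[OF k1, of k] wk by simp
      moreover have "(lnorm k ^ (n + 2))\<^sup>2 = lnorm k ^ (2 * n + 4)" by (rule power_shift_square)
      ultimately show ?thesis using k1 by (simp add: field_simps)
    qed
    also have "\<dots> \<le> (sqrt C1 + X) / lnorm k ^ (2 * n + 4)" using k1 C1 by (intro divide_right_mono) auto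
    finally have 1: "integral {s+1..T} (\<lambda>\<tau>. (U k \<tau>)\<^sup>2) \<le> (sqrt C1 + X) / lnorm k ^ (2 * n + 4)" .
    have 2: "U k t \<le> (sqrt C1 + X) / lnorm k ^ (n + 1)" if t: "t \<in> {s+1..T}" for t
    proof -
      define S where "S = \<kappa> * lnorm k / lnorm k ^ (n + 2)"
      have "((t - s) * U k t)\<^sup>2 + (\<alpha> * (lnorm k)\<^sup>2) * integral {s..t} (\<lambda>\<tau>. ((\<tau> - s) * U k \<tau>)\<^sup>2)
          \<le> 3 / (\<alpha> * (lnorm k)\<^sup>2) * (integral {s..T} (\<lambda>\<tau>. (U k \<tau>)\<^sup>2) + (T - s) ^ 3 * (lnorm k * cmod (\<gamma> k))\<^sup>2 + c\<^sup>2 * (lnorm k)\<^sup>2 * (4 * X * S\<^sup>2))"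
      proof (rule gain[OF k])
        fix F :: "(int \<times> int) set" assume F: "finite F"
        have "(\<Sum>l\<in>halfset k F. u (k - l) / wgt (lnorm k) n l) \<le> S" unfolding S_def wk[symmetric] \<kappa>_def
          by (intro weighted_convolution_le[OF u0 unn e k k1] finite_halfset F) (auto simp: halfset_def)
        then show "integral {s..T} (\<lambda>\<tau>. ((\<tau> - s) * (\<Sum>l\<in>F. U l \<tau> * U (k - l) \<tau>))\<^sup>2) \<le> 4 * X * S\<^sup>2"
          by (intro B[OF k k1 F X0 X[OF k1]])
      qed (use t in auto)
      also have "\<dots> \<le> 3 / (\<alpha> * (lnorm k)\<^sup>2) * (A0 / lnorm k ^ (2 * n) + c\<^sup>2 * (lnorm k)\<^sup>2 * (4 * X * S\<^sup>2))"
        using src[OF k] \<alpha> by (intro mult_left_mono add_right_mono) auto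
      also have "c\<^sup>2 * (lnorm k)\<^sup>2 * (4 * X * S\<^sup>2) = 4 * c\<^sup>2 * X * \<kappa>\<^sup>2 / lnorm k ^ (2 * n)"
      proof -
        have "S = \<kappa> / (lnorm k * lnorm k ^ n)" unfolding S_def using k1 by (simp add: power_add power2_eq_square)
        then have "(lnorm k)\<^sup>2 * S\<^sup>2 = \<kappa>\<^sup>2 / lnorm k ^ (2 * n)" using k1
          by (simp add: power_divide power_mult_distrib power_mult[symmetric] mult.commute)
        then show ?thesis by (simp add: mult_ac)
      qed
      also have "3 / (\<alpha> * (lnorm k)\<^sup>2) * (A0 / lnorm k ^ (2 * n) + 4 * c\<^sup>2 * X * \<kappa>\<^sup>2 / lnorm k ^ (2 * n)) = C1 / (lnorm k ^ (n + 1))\<^sup>2"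
        unfolding C1_def using \<alpha> k1 by (intro collect_identity) auto
      finally have "((t - s) * U k t)\<^sup>2 + (\<alpha> * (lnorm k)\<^sup>2) * integral {s..t} (\<lambda>\<tau>. ((\<tau> - s) * U k \<tau>)\<^sup>2) \<le> C1 / (lnorm k ^ (n + 1))\<^sup>2" .
      moreover have "0 \<le> (\<alpha> * (lnorm k)\<^sup>2) * integral {s..t} (\<lambda>\<tau>. ((\<tau> - s) * U k \<tau>)\<^sup>2)"
        using \<alpha> by (intro mult_nonneg_nonneg integral_nonneg) (auto intro!: integrable_continuous_real continuous_intros continuous_U)
      ultimately have "((t - s) * U k t)\<^sup>2 \<le> C1 / (lnorm k ^ (n + 1))\<^sup>2" by linarith
      moreover have "(U k t)\<^sup>2 \<le> ((t - s) * U k t)\<^sup>2"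
        using t by (intro power_mono le_mult_self) auto
      ultimately have "(U k t)\<^sup>2 \<le> (sqrt C1 / lnorm k ^ (n + 1))\<^sup>2" using C1 by (simp add: power_divide)
      then have "U k t \<le> sqrt C1 / lnorm k ^ (n + 1)" by (rule power2_le_imp_le) (use C1 in auto)
      also have "\<dots> \<le> (sqrt C1 + X) / lnorm k ^ (n + 1)" using X0 by (intro divide_right_mono) auto
      finally show ?thesis .
    qed
    show ?thesis using 1 2 by blast
  qed
  then show ?thesis by blast
qed

text \<open>One application of \<open>first_gain\<close> and two of \<open>second_gain\<close>, with
  \<open>n = 2\<close> and \<open>n = 3\<close>, each costing one unit of time at the left end. The
  exponent 5 fits the balance laws: with \<open>zd k\<close> of order
  \<open>1 / (lnorm k)\<^sup>2\<close> and a spectral weight of order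
  \<open>(lnorm k)\<^sup>2\<close>, the differentiated terms decay like
  \<open>1 / lnorm k ^ 3\<close>, which is summable over the lattice.\<close>

lemma regularity:
  assumes "s \<le> T"
  shows "\<exists>C\<ge>0. \<forall>k t. k \<noteq> 0 \<longrightarrow> t \<in> {s..T} \<longrightarrow> cmod (z k t) \<le> C / lnorm k ^ 5"
proof -
  have small: "\<exists>R. \<forall>k. R \<le> lnorm k \<longrightarrow> (\<forall>t\<in>{s-2..T}. lnorm k * U k t \<le> \<eta>)" if "\<eta> > 0" for \<eta>
    using first_gain(1)[of "s - 3" T] assms that by simp
  obtain C1 where C1: "\<And>k. k \<noteq> 0 \<Longrightarrow> integral {s-2..T} (\<lambda>\<tau>. (U k \<tau>)\<^sup>2) \<le> C1 / lnorm k ^ (2 * 2)"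
    using first_gain(2)[of "s - 3" T] assms by auto
  obtain C2 where C2: "\<And>k. k \<noteq> 0 \<Longrightarrow> integral {s-1..T} (\<lambda>\<tau>. (U k \<tau>)\<^sup>2) \<le> C2 / lnorm k ^ 8"
    using second_gain[OF _ _ small C1] assms by auto
  have C2': "integral {s-1..T} (\<lambda>\<tau>. (U k \<tau>)\<^sup>2) \<le> \<bar>C2\<bar> / lnorm k ^ (2 * 3)" if "k \<noteq> 0" for k
  proof -
    have k1: "lnorm k \<ge> 1" using that by (rule lnorm_ge_1)
    have "C2 / lnorm k ^ 8 \<le> \<bar>C2\<bar> / lnorm k ^ 8" by (intro divide_right_mono) auto
    also have "\<dots> \<le> \<bar>C2\<bar> / lnorm k ^ 6" using k1 by (intro divide_left_mono power_increasing) auto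
    finally show ?thesis using C2[OF that] by simp
  qed
  have small': "\<exists>R. \<forall>k. R \<le> lnorm k \<longrightarrow> (\<forall>t\<in>{s-1..T}. lnorm k * U k t \<le> \<eta>)" if "\<eta> > 0" for \<eta>
    using small[OF that] by fastforce
  have "\<exists>C. \<forall>k. k \<noteq> 0 \<longrightarrow> (\<forall>t\<in>{s-1+1..T}. U k t \<le> C / lnorm k ^ (3 + 1))
      \<and> integral {s-1+1..T} (\<lambda>\<tau>. (U k \<tau>)\<^sup>2) \<le> C / lnorm k ^ (2 * 3 + 4)"
    using assms by (intro second_gain[OF _ _ small' C2']) auto
  then obtain C3 where C3': "\<forall>k. k \<noteq> 0 \<longrightarrow> (\<forall>t\<in>{s-1+1..T}. U k t \<le> C3 / lnorm k ^ (3 + 1))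
      \<and> integral {s-1+1..T} (\<lambda>\<tau>. (U k \<tau>)\<^sup>2) \<le> C3 / lnorm k ^ (2 * 3 + 4)" by (rule exE)
  have C3: "U k t \<le> C3 / lnorm k ^ 4" if "k \<noteq> 0" "t \<in> {s..T}" for k t
    using C3'[rule_format, OF that(1)] that(2) by simp
  have "cmod (z k t) \<le> \<bar>C3\<bar> / lnorm k ^ 5" if k: "k \<noteq> 0" and "t \<in> {s..T}" for k t
  proof -
    have p: "lnorm k > 0" using k by (rule lnorm_pos)
    have "lnorm k * cmod (z k t) \<le> C3 / lnorm k ^ 4" using C3[OF that] by (simp add: U_def)
    also have "\<dots> \<le> \<bar>C3\<bar> / lnorm k ^ 4" by (intro divide_right_mono) auto
    finally have "cmod (z k t) \<le> \<bar>C3\<bar> / lnorm k ^ 4 / lnorm k" using p by (simp add: pos_le_divide_eq mult_ac)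
    also have "\<dots> = \<bar>C3\<bar> / lnorm k ^ 5" by (simp add: eval_nat_numeral mult_ac)
    finally show ?thesis .
  qed
  then show ?thesis by (intro exI[of _ "\<bar>C3\<bar>"]) auto
qed

end

section \<open>Termwise limits and derivatives of lattice series\<close>

lemma lattice_enumeration: obtains e :: "nat \<Rightarrow> int \<times> int" where "bij e"
proof -
  have "infinite (UNIV :: (int \<times> int) set)" using infinite_UNIV_char_0[where 'a=int] by (simp add: finite_prod)
  then show ?thesis using that bij_betw_from_nat_into[of "UNIV :: (int \<times> int) set"] by auto
qed

text \<open>An enumeration of the lattice turns unordered sums into ordinary series, to which the
  Weierstrass test and termwise differentiation apply.\<close>

lemma infsum_eq_suminf:
  fixes f :: "int \<times> int \<Rightarrow> 'a::banach"
  assumes "bij e" "f summable_on UNIV"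
  shows "(\<lambda>n. f (e n)) sums (\<Sum>\<^sub>\<infinity>k. f k)"
proof (rule has_sum_imp_sums)
  show "((\<lambda>n. f (e n)) has_sum (\<Sum>\<^sub>\<infinity>k. f k)) UNIV"
    using has_sum_reindex_bij_betw[OF assms(1), of f] has_sum_infsum[OF assms(2)] by simp
qed

lemma summable_on_dominated:
  fixes f :: "'b \<Rightarrow> 'a::banach"
  assumes "B summable_on A" "\<And>k. k \<in> A \<Longrightarrow> norm (f k) \<le> (B k :: real)"
  shows "f summable_on A"
  by (rule abs_summable_summable, rule summable_on_comparison_test[OF assms(1)]) (use assms(2) in auto)

lemma continuous_on_infsum_lattice:
  fixes f :: "int \<times> int \<Rightarrow> real \<Rightarrow> complex"
  assumes c: "\<And>k. continuous_on S (f k)" and b: "\<And>k t. t \<in> S \<Longrightarrow> norm (f k t) \<le> B k" and B: "B summable_on UNIV"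
  shows "continuous_on S (\<lambda>t. \<Sum>\<^sub>\<infinity>k. f k t)"
proof -
  obtain e :: "nat \<Rightarrow> int \<times> int" where e: "bij e" by (rule lattice_enumeration)
  have "summable (\<lambda>n. B (e n))" using infsum_eq_suminf[OF e B] by (simp add: sums_iff)
  then have "uniform_limit S (\<lambda>n t. \<Sum>i<n. f (e i) t) (\<lambda>t. \<Sum>i. f (e i) t) sequentially"
    using b by (intro Weierstrass_m_test) auto
  then have "continuous_on S (\<lambda>t. \<Sum>i. f (e i) t)"
    by (rule uniform_limit_theorem[rotated]) (auto intro!: always_eventually continuous_intros c)
  moreover have "(\<Sum>i. f (e i) t) = (\<Sum>\<^sub>\<infinity>k. f k t)" if "t \<in> S" for t
    using infsum_eq_suminf[OF e summable_on_dominated[OF B b[OF that]]] by (simp add: sums_iff)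
  ultimately show ?thesis by (simp cong: continuous_on_cong)
qed

lemma has_derivative_infsum_lattice:
  fixes f f' :: "int \<times> int \<Rightarrow> real \<Rightarrow> real"
  assumes d: "\<And>k t. t \<in> {a<..<b} \<Longrightarrow> (f k has_real_derivative f' k t) (at t)"
    and B: "B summable_on UNIV" and f: "\<And>k t. t \<in> {a<..<b} \<Longrightarrow> \<bar>f k t\<bar> \<le> B k"
    and f': "\<And>k t. t \<in> {a<..<b} \<Longrightarrow> \<bar>f' k t\<bar> \<le> B k"
    and t: "t \<in> {a<..<b}"
  shows "((\<lambda>t. \<Sum>\<^sub>\<infinity>k. f k t) has_real_derivative (\<Sum>\<^sub>\<infinity>k. f' k t)) (at t)"
proof -
  obtain e :: "nat \<Rightarrow> int \<times> int" where e: "bij e" by (rule lattice_enumeration)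
  have sB: "summable (\<lambda>n. B (e n))" using infsum_eq_suminf[OF e B] by (simp add: sums_iff)
  have eq: "(\<Sum>n. f (e n) t) = (\<Sum>\<^sub>\<infinity>k. f k t)" if "t \<in> {a<..<b}" for t
    using infsum_eq_suminf[OF e summable_on_dominated[OF B, of "\<lambda>k. f k t"]] f[OF that] by (simp add: sums_iff)
  have eq': "(\<Sum>n. f' (e n) t) = (\<Sum>\<^sub>\<infinity>k. f' k t)"
    using infsum_eq_suminf[OF e summable_on_dominated[OF B, of "\<lambda>k. f' k t"]] f'[OF t] by (simp add: sums_iff)
  have "((\<lambda>t. \<Sum>n. f (e n) t) has_field_derivative (\<Sum>n. f' (e n) t)) (at t)"
  proof (rule has_field_derivative_series'(2)[where S="{a<..<b}" and x0=t])
    show "uniformly_convergent_on {a<..<b} (\<lambda>n x. \<Sum>i<n. f' (e i) x)"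
      using f' by (intro Weierstrass_m_test'[OF _ sB]) auto
    show "summable (\<lambda>n. f (e n) t)"
      using f[OF t] by (intro summable_comparison_test'[OF sB]) auto
    show "(f (e n) has_field_derivative f' (e n) x) (at x within {a<..<b})" if "x \<in> {a<..<b}" for n x
      using d[OF that] by (rule DERIV_subset) auto
  qed (use t in \<open>auto simp: interior_open\<close>)
  then show ?thesis unfolding eq'
    by (rule has_field_derivative_transform_within_open[where S="{a<..<b}"]) (use t eq in auto)
qed

lemma inverse_power_summable: "n \<ge> 3 \<Longrightarrow> (\<lambda>k. r / lnorm k ^ n) summable_on UNIV"
proof -
  assume n: "n \<ge> 3"
  have "(\<lambda>k. \<bar>r\<bar> * (1 / lnorm k ^ 3)) summable_on UNIV" by (intro summable_on_cmult_right cube_summable)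
  then show ?thesis
  proof (rule summable_on_dominated)
    fix k :: "int \<times> int"
    show "norm (r / lnorm k ^ n) \<le> \<bar>r\<bar> * (1 / lnorm k ^ 3)"
    proof (cases "k = 0")
      case False
      then have "lnorm k ^ 3 \<le> lnorm k ^ n" using n lnorm_ge_1[of k] by (intro power_increasing) auto
      then have "\<bar>r\<bar> / lnorm k ^ n \<le> \<bar>r\<bar> / lnorm k ^ 3" using lnorm_pos[OF False] by (intro divide_left_mono) auto
      then show ?thesis by simp
    qed (use n in \<open>auto simp: power_0_left\<close>)
  qed
qed

lemma summable_on_product_nonneg:
  fixes a :: "'a \<Rightarrow> real" and b :: "'b \<Rightarrow> real"
  assumes a: "a summable_on UNIV" "\<And>x. a x \<ge> 0" and b: "b summable_on UNIV" "\<And>x. b x \<ge> 0"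
  shows "(\<lambda>(x, y). a x * b y) summable_on UNIV"
proof (rule nonneg_bdd_above_summable_on)
  show "bdd_above (sum (\<lambda>(x, y). a x * b y) ` {F. F \<subseteq> UNIV \<and> finite F})"
  proof (rule bdd_aboveI2)
    fix F :: "('a \<times> 'b) set" assume "F \<in> {F. F \<subseteq> UNIV \<and> finite F}"
    then have F: "finite F" by simp
    have "(\<Sum>(x, y)\<in>F. a x * b y) \<le> (\<Sum>(x, y)\<in>fst ` F \<times> snd ` F. a x * b y)"
    proof (rule sum_mono2)
      show "F \<subseteq> fst ` F \<times> snd ` F" by force
    qed (use F a b in auto)
    also have "\<dots> = sum a (fst ` F) * sum b (snd ` F)"
      by (simp add: sum_product sum.cartesian_product)
    also have "\<dots> \<le> infsum a UNIV * infsum b UNIV"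
      using F a b by (intro mult_mono finite_sum_le_infsum infsum_nonneg sum_nonneg) auto
    finally show "(\<Sum>(x, y)\<in>F. a x * b y) \<le> infsum a UNIV * infsum b UNIV" .
  qed
qed (use a b in auto)

text \<open>The detailed conservation law of a triad \<open>l + m + n = 0\<close>: \<open>\<theta> = 1\<close> is energy, \<open>\<theta> = |k|\<^sup>2\<close> is enstrophy.\<close>

lemma triad_identity:
  assumes "\<And>k. \<theta> k = p + q * (lnorm k)\<^sup>2"
  shows "\<theta> (l + m) * (cross2 l m * ((lnorm m)\<^sup>2 - (lnorm l)\<^sup>2))
     + \<theta> l * (cross2 m (-l-m) * ((lnorm (-l-m))\<^sup>2 - (lnorm m)\<^sup>2))
     + \<theta> m * (cross2 (-l-m) l * ((lnorm l)\<^sup>2 - (lnorm (-l-m))\<^sup>2)) = 0"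
proof -
  have n: "lnorm (-l-m) = lnorm (l + m)" using lnorm_minus[of "l + m"] by simp
  have "cross2 m (-l-m) = cross2 l m" "cross2 (-l-m) l = cross2 l m"
    by (simp_all add: cross2_def algebra_simps)
  then show ?thesis unfolding assms n by (simp add: algebra_simps)
qed

section \<open>Conservation laws and the balance of weighted energies\<close>

context lattice_ode
begin

text \<open>The sum is rewritten as the double sum of \<open>h\<close> over pairs
  \<open>(l, m)\<close> with \<open>k = l + m\<close> and symmetrised twice. Adding the terms with
  \<open>l\<close> and \<open>m\<close> exchanged turns \<open>dot2 m (l + m)\<close> into
  \<open>(lnorm m)\<^sup>2 - (lnorm l)\<^sup>2\<close>; rotating the triad
  \<open>l, m, -(l + m)\<close> then makes \<open>triad_identity\<close> applicable term by term.
  The rearrangements rest on absolute summability, which is where the decay of \<open>z\<close>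
  enters.\<close>

lemma triad_sum_zero:
  assumes C: "\<And>k. k \<noteq> 0 \<Longrightarrow> cmod (z k t) \<le> C / lnorm k ^ 5" and C0: "C \<ge> 0"
    and \<theta>: "\<And>k. \<theta> k = p + q * (lnorm k)\<^sup>2"
  shows "(\<Sum>\<^sub>\<infinity>k. \<theta> k * (lnorm k)\<^sup>2 * (z k t \<bullet> NL k t)) = 0"
proof -
  define Z where "Z k = z k t" for k
  define h where "h = (\<lambda>(l,m). complex_of_real (\<theta> (l + m) * (cross2 l m * dot2 m (l + m))) * (Z l * Z m * Z (- (l + m))))"
  define \<Theta> where "\<Theta> = \<bar>p\<bar> + \<bar>q\<bar>"
  have \<Theta>: "\<bar>\<theta> k\<bar> \<le> \<Theta> * (lnorm k)\<^sup>2" if "k \<noteq> 0" for k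
  proof -
    have "\<bar>\<theta> k\<bar> \<le> \<bar>p\<bar> * 1 + \<bar>q\<bar> * (lnorm k)\<^sup>2" unfolding \<theta> using abs_triangle_ineq[of p "q * (lnorm k)\<^sup>2"] by (simp add: abs_mult)
    also have "\<dots> \<le> \<bar>p\<bar> * (lnorm k)\<^sup>2 + \<bar>q\<bar> * (lnorm k)\<^sup>2"
      using lnorm_ge_1[OF that] by (intro add_right_mono mult_left_mono) auto
    finally show ?thesis by (simp add: \<Theta>_def algebra_simps)
  qed
  have \<Theta>0: "\<Theta> \<ge> 0" by (simp add: \<Theta>_def)
  \<comment> \<open>The coefficient of \<open>h\<close> grows like one power of
    \<open>lnorm l\<close>, two of \<open>lnorm m\<close> and three of \<open>lnorm (l + m)\<close>.
    Five powers of decay each leave 4, 3 and 2; the last are estimated away, and two inverse cubes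
    give a summable product.\<close>
  define B where "B = (\<lambda>(l,m). (\<Theta> * C ^ 3 / lnorm l ^ 3) * (1 / lnorm m ^ 3))"
  have hB: "norm (h x) \<le> B x" for x
  proof -
    obtain l m where x: "x = (l, m)" by (cases x)
    show ?thesis
    proof (cases "l = 0 \<or> m = 0 \<or> l + m = 0")
      case True
      then have "l = 0 \<or> m = 0 \<or> - (l + m) = 0" by (metis neg_0_equal_iff_equal)
      then have "Z l * Z m * Z (- (l + m)) = 0"
        by (elim disjE) (simp_all only: Z_def z0 mult_zero_left mult_zero_right)
      then have "h x = 0" unfolding x h_def prod.case by (simp only: mult_zero_right)
      moreover have "B x \<ge> 0" unfolding B_def x using \<Theta>0 C0 by simp
      ultimately show ?thesis by simp
    next
      case False
      let ?l = "lnorm l" and ?m = "lnorm m" and ?n = "lnorm (l + m)"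
      have 1: "?l \<ge> 1" "?m \<ge> 1" "?n \<ge> 1" using False lnorm_ge_1 by auto
      have n5: "cmod (Z (- (l + m))) \<le> C / ?n ^ 5"
        unfolding Z_def zcnj complex_mod_cnj by (rule C) (use False in auto)
      have ZC: "cmod (Z k) \<le> C / lnorm k ^ 5" if "k \<noteq> 0" for k unfolding Z_def by (rule C[OF that])
      have "norm (h x) = \<bar>\<theta> (l + m)\<bar> * (\<bar>cross2 l m\<bar> * \<bar>dot2 m (l + m)\<bar>) * (cmod (Z l) * cmod (Z m) * cmod (Z (- (l + m))))"
        by (simp add: h_def x norm_mult abs_mult)
      also have "\<dots> \<le> (\<Theta> * ?n\<^sup>2) * ((?l * ?m) * (?m * ?n)) * (C / ?l ^ 5 * (C / ?m ^ 5) * (C / ?n ^ 5))"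
        using False \<Theta>0 C0 1
        by (intro mult_mono \<Theta> cross2_le dot2_le n5 ZC mult_nonneg_nonneg divide_nonneg_nonneg zero_le_power) auto
      also have "\<dots> = (\<Theta> * C ^ 3) * (1 / ?l ^ 4) * (1 / ?m ^ 3) * (1 / ?n ^ 2)"
        using 1 by (simp add: divide_simps) (simp add: eval_nat_numeral)
      also have "\<dots> \<le> (\<Theta> * C ^ 3) * (1 / ?l ^ 3) * (1 / ?m ^ 3) * 1"
      proof -
        have "1 / ?l ^ 4 \<le> 1 / ?l ^ 3" using 1 by (intro divide_left_mono power_increasing) auto
        moreover have "1 / ?n\<^sup>2 \<le> 1" using 1 by simp
        ultimately show ?thesis using \<Theta>0 C0 by (intro mult_mono order_refl) auto
      qed
      finally show ?thesis by (simp add: B_def x)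
    qed
  qed
  have Bs: "B summable_on UNIV"
  proof -
    have "(\<lambda>k. \<Theta> * C ^ 3 / lnorm k ^ 3) summable_on UNIV" "(\<lambda>k. 1 / lnorm k ^ 3) summable_on UNIV"
      by (intro inverse_power_summable; simp)+
    then show ?thesis unfolding B_def using \<Theta>0 C0 by (intro summable_on_product_nonneg) auto
  qed
  have hs: "h summable_on UNIV" using hB by (rule summable_on_dominated[OF Bs])
  have bij1: "bij (\<lambda>(l::int\<times>int, m::int\<times>int). (m, l))"
    by (rule o_bij[of "\<lambda>(l, m). (m, l)"]) auto
  have bij2: "bij (\<lambda>(l::int\<times>int, m::int\<times>int). (m, - l - m))"
    by (rule o_bij[of "\<lambda>(m, n). (- m - n, m)"]) (auto simp: fun_eq_iff)
  have bij3: "bij (\<lambda>(k::int\<times>int, l::int\<times>int). (l, k - l))"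
    by (rule o_bij[of "\<lambda>(l, m). (l + m, l)"]) (auto simp: fun_eq_iff)
  define H where "H = (\<lambda>(l,m). complex_of_real (\<theta> (l + m) * (cross2 l m * ((lnorm m)\<^sup>2 - (lnorm l)\<^sup>2))) * (Z l * Z m * Z (- (l + m))))"
  have Hh: "H x = h x + h (case x of (l, m) \<Rightarrow> (m, l))" for x
  proof -
    obtain l m where x: "x = (l, m)" by (cases x)
    have c: "cross2 m l = - cross2 l m" by (simp add: cross2_def)
    have d: "dot2 m (l + m) - dot2 l (l + m) = (lnorm m)\<^sup>2 - (lnorm l)\<^sup>2"
      unfolding lnorm_power2 dot2_def by (simp add: power2_eq_square algebra_simps)
    have key: "\<theta> (l + m) * (cross2 l m * ((lnorm m)\<^sup>2 - (lnorm l)\<^sup>2)) =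
        \<theta> (l + m) * (cross2 l m * dot2 m (l + m)) + \<theta> (l + m) * (cross2 m l * dot2 l (l + m))"
      unfolding d[symmetric] c by (simp add: algebra_simps)
    show ?thesis unfolding H_def h_def x prod.case add.commute[of m l] key
      by (simp only: of_real_add distrib_right mult.commute[of "Z m" "Z l"])
  qed
  have hs1: "(\<lambda>x. h (case x of (l, m) \<Rightarrow> (m, l))) summable_on UNIV"
    using summable_on_reindex_bij_betw[OF bij1, of h] hs by simp
  have Hs: "H summable_on UNIV" unfolding Hh[abs_def] by (intro summable_on_add hs hs1)
  have S1: "infsum H UNIV = 2 * infsum h UNIV"
    unfolding Hh[abs_def] infsum_add[OF hs hs1] using infsum_reindex_bij_betw[OF bij1, of h] by simp
  \<comment> \<open>The cyclic rotation of the triad \<open>l, m, -(l + m)\<close>, written in its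
    first two entries.\<close>
  let ?r = "\<lambda>(l::int\<times>int, m::int\<times>int). (m, - l - m)"
  have Hs1: "(\<lambda>x. H (?r x)) summable_on UNIV" "infsum (\<lambda>x. H (?r x)) UNIV = infsum H UNIV"
    using summable_on_reindex_bij_betw[OF bij2, of H] infsum_reindex_bij_betw[OF bij2, of H] Hs by auto
  have Hs2: "(\<lambda>x. H (?r (?r x))) summable_on UNIV" "infsum (\<lambda>x. H (?r (?r x))) UNIV = infsum H UNIV"
    using summable_on_reindex_bij_betw[OF bij2, of "\<lambda>x. H (?r x)"] infsum_reindex_bij_betw[OF bij2, of "\<lambda>x. H (?r x)"] Hs1 by auto
  have "H x + H (?r x) + H (?r (?r x)) = 0" for x
  proof -
    obtain l m where x: "x = (l, m)" by (cases x)
    have even: "\<theta> (-l) = \<theta> l" "\<theta> (-m) = \<theta> m" by (simp_all add: \<theta>)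
    have s: "m + (- l - m) = - l" "- l - m + l = - m" "- m - (- l - m) = l" "- (- l - m) = l + m" by auto
    have "H x + H (?r x) + H (?r (?r x)) = complex_of_real (\<theta> (l + m) * (cross2 l m * ((lnorm m)\<^sup>2 - (lnorm l)\<^sup>2))
     + \<theta> l * (cross2 m (-l-m) * ((lnorm (-l-m))\<^sup>2 - (lnorm m)\<^sup>2))
     + \<theta> m * (cross2 (-l-m) l * ((lnorm l)\<^sup>2 - (lnorm (-l-m))\<^sup>2))) * (Z l * Z m * Z (- l - m))"
      unfolding H_def x by (simp add: s even algebra_simps)
    then show ?thesis unfolding triad_identity[OF \<theta>] by simp
  qed
  then have "infsum (\<lambda>x. H x + H (?r x) + H (?r (?r x))) UNIV = 0" by simp
  then have "3 * infsum H UNIV = 0"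
    using infsum_add[OF summable_on_add[OF Hs Hs1(1)] Hs2(1)] infsum_add[OF Hs Hs1(1)] Hs1(2) Hs2(2) by simp
  then have h0: "infsum h UNIV = 0" using S1 by simp
  have hs3: "(\<lambda>(k, l). h (l, k - l)) summable_on UNIV \<times> UNIV"
    using summable_on_reindex_bij_betw[OF bij3, of h] hs by (simp add: case_prod_unfold)
  have "infsum (\<lambda>k. infsum (\<lambda>l. h (l, k - l)) UNIV) UNIV = infsum (\<lambda>(k, l). h (l, k - l)) (UNIV \<times> UNIV)"
    by (rule infsum_Sigma'_banach[OF hs3])
  also have "\<dots> = infsum h UNIV" using infsum_reindex_bij_betw[OF bij3, of h] by (simp add: case_prod_unfold)
  finally have i0: "infsum (\<lambda>k. infsum (\<lambda>l. h (l, k - l)) UNIV) UNIV = 0" using h0 by simp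
  have s0: "(\<lambda>k. infsum (\<lambda>l. h (l, k - l)) UNIV) summable_on UNIV"
    by (rule summable_on_Sigma_banach[OF hs3])
  have inner: "infsum (\<lambda>l. h (l, k - l)) UNIV = complex_of_real (\<theta> k * (lnorm k)\<^sup>2) * (cnj (z k t) * NL k t)" for k
  proof (cases "k = 0")
    case True then show ?thesis using z0 by (simp add: h_def Z_def)
  next
    case False
    have "infsum (\<lambda>l. h (l, k - l)) UNIV = infsum (\<lambda>l. (complex_of_real (\<theta> k * (lnorm k)\<^sup>2) * cnj (z k t)) * (triad l (k - l) *\<^sub>R (z l t * z (k - l) t))) UNIV"
    proof (rule infsum_cong)
      fix l
      have eqn: "cross2 l (k - l) * dot2 (k - l) k = (lnorm k)\<^sup>2 * triad l (k - l)"
        unfolding triad_def using lnorm_pos[OF False] by simp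
      have lk: "l + (k - l) = k" by simp
      show "h (l, k - l) = (complex_of_real (\<theta> k * (lnorm k)\<^sup>2) * cnj (z k t)) * (triad l (k - l) *\<^sub>R (z l t * z (k - l) t))"
        unfolding h_def prod.case lk eqn Z_def zcnj scaleR_conv_of_real by (simp only: of_real_mult mult_ac)
    qed
    also have "\<dots> = (complex_of_real (\<theta> k * (lnorm k)\<^sup>2) * cnj (z k t)) * NL k t"
      unfolding NL_def by (rule infsum_cmult_right) (use abs_summable_summable[OF NL_abs_summable] in auto)
    finally show ?thesis by (simp add: mult_ac)
  qed
  have "infsum (\<lambda>k. Re (infsum (\<lambda>l. h (l, k - l)) UNIV)) UNIV = Re 0"
    using has_sum_bounded_linear[OF bounded_linear_Re has_sum_infsum[OF s0], THEN infsumI] i0 by simp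
  moreover have "Re (infsum (\<lambda>l. h (l, k - l)) UNIV) = \<theta> k * (lnorm k)\<^sup>2 * (z k t \<bullet> NL k t)" for k
    unfolding inner by (simp add: inner_complex_def algebra_simps)
  ultimately show ?thesis by simp
qed

text \<open>The integrand of \<open>ode\<close>. It becomes the classical derivative of
  \<open>z k\<close> in \<open>z_derivative\<close>, once \<open>NL k\<close> is known to be
  continuous.\<close>

definition zd :: "int \<times> int \<Rightarrow> real \<Rightarrow> complex" where
  "zd k t = \<gamma> k - (\<alpha> * (lnorm k)\<^sup>2) *\<^sub>R z k t + c *\<^sub>R NL k t"

text \<open>The factor \<open>(lnorm k)\<^sup>2\<close> is distributed as
  \<open>2 * (lnorm l)\<^sup>2 + 2 * (lnorm (k - l))\<^sup>2\<close>. The mode that receives it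
  stays bounded by \<open>C\<close>, the other one is summed as an inverse cube with bound 512; the
  two cases together give \<open>2048 = 4 * 512\<close>.\<close>

lemma M_decay:
  assumes C: "\<And>k. k \<noteq> 0 \<Longrightarrow> cmod (z k t) \<le> C / lnorm k ^ 5" and C0: "C \<ge> 0" and k: "k \<noteq> 0"
  shows "M k t \<le> 2048 * C\<^sup>2 / (lnorm k)\<^sup>2"
proof -
  have U1: "(lnorm l)\<^sup>2 * U l t \<le> C" for l
  proof (cases "l = 0")
    case False
    then have p: "lnorm l \<ge> 1" by (rule lnorm_ge_1)
    have "(lnorm l)\<^sup>2 * U l t \<le> (lnorm l)\<^sup>2 * (lnorm l * (C / lnorm l ^ 5))"
      unfolding U_def using C[OF False] by (intro mult_left_mono) auto
    also have "\<dots> = C / (lnorm l)\<^sup>2" using p by (simp add: eval_nat_numeral)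
    also have "\<dots> \<le> C / 1" using p C0 by (intro divide_left_mono) auto
    finally show ?thesis by simp
  qed (use C0 in auto)
  have U2: "U l t \<le> C * (1 / lnorm l ^ 3)" for l
  proof (cases "l = 0")
    case False
    then have p: "lnorm l \<ge> 1" by (rule lnorm_ge_1)
    have "U l t \<le> lnorm l * (C / lnorm l ^ 5)"
      unfolding U_def using C[OF False] by (intro mult_left_mono) auto
    also have "\<dots> = C / lnorm l ^ 4" using p by (simp add: eval_nat_numeral)
    also have "\<dots> \<le> C / lnorm l ^ 3" using p C0 by (intro divide_left_mono power_increasing) auto
    finally show ?thesis by simp
  qed (use C0 in auto)
  have cub: "(\<Sum>l\<in>F. 1 / lnorm l ^ 3) \<le> 512" if "finite F" for F
  proof -
    have "(\<Sum>l\<in>F. 1 / lnorm l ^ 3) = (\<Sum>l\<in>F - {0}. 1 / lnorm l ^ 3)"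
      by (rule sum.mono_neutral_right) (use that in auto)
    also have "\<dots> \<le> 512 / 1" using that lnorm_ge_1 by (intro sum_inverse_lnorm_cube_tail) auto
    finally show ?thesis by simp
  qed
  have "M k t \<le> 2048 * C\<^sup>2 / (lnorm k)\<^sup>2"
    unfolding M_def
  proof (rule infsum_le_finite_sums[OF M_summable])
    fix F :: "(int \<times> int) set" assume F: "finite F"
    have "(lnorm k)\<^sup>2 * (\<Sum>l\<in>F. U l t * U (k - l) t) = (\<Sum>l\<in>F. (lnorm k)\<^sup>2 * (U l t * U (k - l) t))"
      by (rule sum_distrib_left)
    also have "\<dots> \<le> (\<Sum>l\<in>F. 2 * C\<^sup>2 * (1 / lnorm (k - l) ^ 3) + 2 * C\<^sup>2 * (1 / lnorm l ^ 3))"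
    proof (rule sum_mono)
      fix l
      have "(lnorm k)\<^sup>2 \<le> (lnorm l + lnorm (k - l))\<^sup>2" by (intro power_mono lnorm_triangle_diff) auto
      also have "\<dots> \<le> 2 * (lnorm l)\<^sup>2 + 2 * (lnorm (k - l))\<^sup>2"
        using sum_squares_bound[of "lnorm l" "lnorm (k - l)"] by (simp add: power2_sum)
      finally have "(lnorm k)\<^sup>2 * (U l t * U (k - l) t) \<le> (2 * (lnorm l)\<^sup>2 + 2 * (lnorm (k - l))\<^sup>2) * (U l t * U (k - l) t)"
        by (intro mult_right_mono) auto
      also have "\<dots> = 2 * (((lnorm l)\<^sup>2 * U l t) * U (k - l) t) + 2 * (((lnorm (k - l))\<^sup>2 * U (k - l) t) * U l t)"
        by (simp add: algebra_simps)
      also have "\<dots> \<le> 2 * (C * (C * (1 / lnorm (k - l) ^ 3))) + 2 * (C * (C * (1 / lnorm l ^ 3)))"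
        using C0 by (intro add_mono mult_left_mono mult_mono U1 U2) auto
      finally show "(lnorm k)\<^sup>2 * (U l t * U (k - l) t) \<le> 2 * C\<^sup>2 * (1 / lnorm (k - l) ^ 3) + 2 * C\<^sup>2 * (1 / lnorm l ^ 3)"
        by (simp add: power2_eq_square)
    qed
    also have "\<dots> = 2 * C\<^sup>2 * (\<Sum>m\<in>(\<lambda>l. k - l) ` F. 1 / lnorm m ^ 3) + 2 * C\<^sup>2 * (\<Sum>l\<in>F. 1 / lnorm l ^ 3)"
      by (subst sum.reindex) (auto simp: inj_on_def sum.distrib sum_distrib_left)
    also have "\<dots> \<le> 2 * C\<^sup>2 * 512 + 2 * C\<^sup>2 * 512" using F by (intro add_mono mult_left_mono cub) auto
    finally have "(lnorm k)\<^sup>2 * (\<Sum>l\<in>F. U l t * U (k - l) t) \<le> 2048 * C\<^sup>2" by simp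
    then show "(\<Sum>l\<in>F. U l t * U (k - l) t) \<le> 2048 * C\<^sup>2 / (lnorm k)\<^sup>2"
      using lnorm_pos[OF k] by (simp add: field_simps)
  qed
  then show ?thesis .
qed

lemma zd_decay:
  assumes "s \<le> T"
  obtains C D where "C \<ge> 0" "D \<ge> 0" "\<And>k t. k \<noteq> 0 \<Longrightarrow> t \<in> {s..T} \<Longrightarrow> cmod (z k t) \<le> C / lnorm k ^ 5"
    "\<And>k t. k \<noteq> 0 \<Longrightarrow> t \<in> {s..T} \<Longrightarrow> cmod (zd k t) \<le> D / (lnorm k)\<^sup>2"
proof -
  obtain C where C0: "C \<ge> 0" and C: "\<And>k t. k \<noteq> 0 \<Longrightarrow> t \<in> {s..T} \<Longrightarrow> cmod (z k t) \<le> C / lnorm k ^ 5"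
    using regularity[OF assms] by blast
  obtain \<Gamma> where \<Gamma>: "\<Gamma> \<ge> 0" "\<And>k. (lnorm k)\<^sup>2 * (lnorm k * cmod (\<gamma> k))\<^sup>2 \<le> \<Gamma>" using forcing_bound[of 2] by blast
  define D where "D = sqrt \<Gamma> + \<alpha> * C + \<bar>c\<bar> * (2048 * C\<^sup>2)"
  have "cmod (zd k t) \<le> D / (lnorm k)\<^sup>2" if k: "k \<noteq> 0" and t: "t \<in> {s..T}" for k t
  proof -
    have p: "lnorm k \<ge> 1" using k by (rule lnorm_ge_1)
    have "((lnorm k)\<^sup>2 * cmod (\<gamma> k))\<^sup>2 \<le> \<Gamma>" using \<Gamma>(2)[of k] by (simp add: power2_eq_square mult_ac)
    then have "(lnorm k)\<^sup>2 * cmod (\<gamma> k) \<le> sqrt \<Gamma>" by (rule real_le_rsqrt)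
    then have 1: "cmod (\<gamma> k) \<le> sqrt \<Gamma> / (lnorm k)\<^sup>2" using p by (simp add: field_simps)
    have "(\<alpha> * (lnorm k)\<^sup>2) * cmod (z k t) \<le> (\<alpha> * (lnorm k)\<^sup>2) * (C / lnorm k ^ 5)"
      using C[OF k t] \<alpha> by (intro mult_left_mono) auto
    also have "\<dots> = \<alpha> * C / lnorm k ^ 3" using p by (simp add: eval_nat_numeral)
    also have "\<dots> \<le> \<alpha> * C / (lnorm k)\<^sup>2" using p C0 \<alpha> by (intro divide_left_mono power_increasing) auto
    finally have 2: "cmod ((\<alpha> * (lnorm k)\<^sup>2) *\<^sub>R z k t) \<le> \<alpha> * C / (lnorm k)\<^sup>2" using \<alpha> by simp
    have "cmod (NL k t) \<le> 2048 * C\<^sup>2 / (lnorm k)\<^sup>2"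
      using NL_le[of k t] M_decay[OF C[OF _ t] C0 k] by linarith
    then have "\<bar>c\<bar> * cmod (NL k t) \<le> \<bar>c\<bar> * (2048 * C\<^sup>2 / (lnorm k)\<^sup>2)" by (rule mult_left_mono) simp
    then have 3: "cmod (c *\<^sub>R NL k t) \<le> \<bar>c\<bar> * (2048 * C\<^sup>2 / (lnorm k)\<^sup>2)" by simp
    have "cmod (zd k t) \<le> cmod (\<gamma> k) + cmod ((\<alpha> * (lnorm k)\<^sup>2) *\<^sub>R z k t) + cmod (c *\<^sub>R NL k t)"
      unfolding zd_def using norm_triangle_ineq[of "\<gamma> k - (\<alpha> * (lnorm k)\<^sup>2) *\<^sub>R z k t" "c *\<^sub>R NL k t"]
        norm_triangle_ineq4[of "\<gamma> k" "(\<alpha> * (lnorm k)\<^sup>2) *\<^sub>R z k t"] by linarith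
    also have "\<dots> \<le> sqrt \<Gamma> / (lnorm k)\<^sup>2 + \<alpha> * C / (lnorm k)\<^sup>2 + \<bar>c\<bar> * (2048 * C\<^sup>2 / (lnorm k)\<^sup>2)" using 1 2 3 by linarith
    finally show ?thesis by (simp add: D_def add_divide_distrib)
  qed
  moreover have "D \<ge> 0" unfolding D_def using \<Gamma> \<alpha> C0 by simp
  ultimately show ?thesis using that C C0 by blast
qed

lemma continuous_NL: "continuous_on {s..T} (NL k)"
proof (cases "s \<le> T")
  case True
  obtain C where C: "C \<ge> 0" "\<And>k t. k \<noteq> 0 \<Longrightarrow> t \<in> {s..T} \<Longrightarrow> cmod (z k t) \<le> C / lnorm k ^ 5"
    using regularity[OF True] by blast
  show ?thesis unfolding NL_def
  proof (rule continuous_on_infsum_lattice)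
    show "(\<lambda>l. sqrt E * C / lnorm l ^ 4) summable_on UNIV" by (rule inverse_power_summable) simp
    fix l t assume t: "t \<in> {s..T}"
    have "norm (triad l (k - l) *\<^sub>R (z l t * z (k - l) t)) \<le> U l t * U (k - l) t" by (rule NL_term_le)
    also have "\<dots> \<le> (C / lnorm l ^ 4) * sqrt E"
    proof (intro mult_mono U_le)
      show "U l t \<le> C / lnorm l ^ 4"
      proof (cases "l = 0")
        case False
        have "U l t \<le> lnorm l * (C / lnorm l ^ 5)"
          unfolding U_def using C(2)[OF False t] by (intro mult_left_mono) auto
        also have "\<dots> = C / lnorm l ^ 4" using lnorm_pos[OF False] by (simp add: eval_nat_numeral)
        finally show ?thesis .
      qed simp
    qed (use C in auto)
    finally show "norm (triad l (k - l) *\<^sub>R (z l t * z (k - l) t)) \<le> sqrt E * C / lnorm l ^ 4" by (simp add: mult_ac)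
  qed (intro continuous_intros continuous_z)
qed simp

lemma z_derivative:
  assumes k: "k \<noteq> 0"
  shows "(z k has_vector_derivative zd k t) (at t)"
proof -
  have czd: "continuous_on {t-1..t+1} (zd k)"
    unfolding zd_def by (intro continuous_intros continuous_z continuous_NL)
  have "((\<lambda>u. integral {t-1..u} (zd k)) has_vector_derivative zd k t) (at t within {t-1..t+1})"
    by (rule integral_has_vector_derivative[OF czd]) auto
  then have A: "((\<lambda>u. z k (t-1) + integral {t-1..u} (zd k)) has_vector_derivative zd k t) (at t within {t-1..t+1})"
    by (auto intro!: derivative_eq_intros)
  have B: "z k u = z k (t-1) + integral {t-1..u} (zd k)" if "u \<in> {t-1..t+1}" for u
    using ode[OF k, of "t-1" u, THEN integral_unique] that unfolding zd_def NL_def by (simp add: algebra_simps)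
  have "(z k has_vector_derivative zd k t) (at t within {t-1..t+1})"
    by (rule has_vector_derivative_transform[OF _ B A]) auto
  then show ?thesis by (subst (asm) at_within_interior) auto
qed

text \<open>For weights affine in \<open>(lnorm k)\<^sup>2\<close> the nonlinear contribution drops
  out by \<open>triad_sum_zero\<close>. It is applied with the constant weight 1 and with
  \<open>gap\<close>.\<close>

lemma weighted_sum_derivative:
  assumes \<theta>: "\<And>k. \<theta> k = p + q * (lnorm k)\<^sup>2"
  shows "((\<lambda>t. \<Sum>\<^sub>\<infinity>k. \<theta> k * (U k t)\<^sup>2) has_real_derivative
      (2 * (\<Sum>\<^sub>\<infinity>k. \<theta> k * (lnorm k)\<^sup>2 * (z k t \<bullet> \<gamma> k))
       - 2 * (\<Sum>\<^sub>\<infinity>k. \<theta> k * (\<alpha> * (lnorm k)\<^sup>2) * (U k t)\<^sup>2))) (at t)"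
    and "(\<lambda>k. \<theta> k * (U k t)\<^sup>2) summable_on UNIV"
    and "(\<lambda>k. \<theta> k * (\<alpha> * (lnorm k)\<^sup>2) * (U k t)\<^sup>2) summable_on UNIV"
proof -
  define \<Theta> where "\<Theta> = \<bar>p\<bar> + \<bar>q\<bar>"
  have \<Theta>: "\<bar>\<theta> k\<bar> \<le> \<Theta> * (lnorm k)\<^sup>2" if "k \<noteq> 0" for k
  proof -
    have "\<bar>\<theta> k\<bar> \<le> \<bar>p\<bar> * 1 + \<bar>q\<bar> * (lnorm k)\<^sup>2" unfolding \<theta> using abs_triangle_ineq[of p "q * (lnorm k)\<^sup>2"] by (simp add: abs_mult)
    also have "\<dots> \<le> \<bar>p\<bar> * (lnorm k)\<^sup>2 + \<bar>q\<bar> * (lnorm k)\<^sup>2"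
      using lnorm_ge_1[OF that] by (intro add_right_mono mult_left_mono) auto
    finally show ?thesis by (simp add: \<Theta>_def algebra_simps)
  qed
  have \<Theta>0: "\<Theta> \<ge> 0" by (simp add: \<Theta>_def)
  have le: "t - 1 \<le> t + 1" by simp
  obtain C D where C1: "C \<ge> 0" and D1: "D \<ge> 0"
    and C2: "\<And>k t'. k \<noteq> 0 \<Longrightarrow> t' \<in> {t-1..t+1} \<Longrightarrow> cmod (z k t') \<le> C / lnorm k ^ 5"
    and D2: "\<And>k t'. k \<noteq> 0 \<Longrightarrow> t' \<in> {t-1..t+1} \<Longrightarrow> cmod (zd k t') \<le> D / (lnorm k)\<^sup>2"
    by (rule zd_decay[OF le], rule that)
  note C = C1 C2 and D = D1 D2
  have tt: "t \<in> {t-1..t+1}" by simp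
  have z5: "cmod (z k t') \<le> C / lnorm k ^ 5" if "t' \<in> {t-1..t+1}" for k t'
    using C(2)[OF _ that] z0 by (cases "k = 0") auto
  have U4: "U k t' \<le> C / lnorm k ^ 4" if "t' \<in> {t-1..t+1}" for k t'
  proof (cases "k = 0")
    case False
    have "U k t' \<le> lnorm k * (C / lnorm k ^ 5)"
      unfolding U_def using z5[OF that] by (intro mult_left_mono) auto
    also have "\<dots> = C / lnorm k ^ 4" using lnorm_pos[OF False] by (simp add: eval_nat_numeral)
    finally show ?thesis .
  qed simp
  have b1: "\<bar>\<theta> k * (U k t')\<^sup>2\<bar> \<le> \<Theta> * C\<^sup>2 / lnorm k ^ 3" if t': "t' \<in> {t-1..t+1}" for k t'
  proof (cases "k = 0")
    case False
    then have p: "lnorm k \<ge> 1" by (rule lnorm_ge_1)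
    have "\<bar>\<theta> k * (U k t')\<^sup>2\<bar> \<le> (\<Theta> * (lnorm k)\<^sup>2) * (C / lnorm k ^ 4)\<^sup>2"
      unfolding abs_mult using \<Theta>[OF False] U4[OF t', of k] by (intro mult_mono) (auto intro!: power_mono)
    also have "\<dots> = \<Theta> * C\<^sup>2 / lnorm k ^ 6" using p by (simp add: eval_nat_numeral)
    also have "\<dots> \<le> \<Theta> * C\<^sup>2 / lnorm k ^ 3" using p \<Theta>0 by (intro divide_left_mono power_increasing) auto
    finally show ?thesis .
  qed (use \<Theta>0 in auto)
  \<comment> \<open>One majorant for three series: \<open>w\<close> is later \<open>zd k\<close>,
    \<open>\<gamma> k\<close> and \<open>NL k\<close>, each of order
    \<open>1 / (lnorm k)\<^sup>2\<close>.\<close>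
  have b2: "\<bar>\<theta> k * (lnorm k)\<^sup>2 * (z k t' \<bullet> w)\<bar> \<le> \<Theta> * C * W / lnorm k ^ 3"
    if t': "t' \<in> {t-1..t+1}" and w: "k \<noteq> 0 \<Longrightarrow> cmod w \<le> W / (lnorm k)\<^sup>2" and W: "W \<ge> 0" for k t' w W
  proof (cases "k = 0")
    case False
    then have p: "lnorm k \<ge> 1" by (rule lnorm_ge_1)
    have "\<bar>z k t' \<bullet> w\<bar> \<le> cmod (z k t') * cmod w" by (rule Cauchy_Schwarz_ineq2)
    also have "\<dots> \<le> (C / lnorm k ^ 5) * (W / (lnorm k)\<^sup>2)" using z5[OF t'] w[OF False] C(1) by (intro mult_mono) auto
    finally have "\<bar>\<theta> k * (lnorm k)\<^sup>2 * (z k t' \<bullet> w)\<bar> \<le> (\<Theta> * (lnorm k)\<^sup>2) * (lnorm k)\<^sup>2 * ((C / lnorm k ^ 5) * (W / (lnorm k)\<^sup>2))"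
      unfolding abs_mult using \<Theta>[OF False] \<Theta>0 by (intro mult_mono) auto
    also have "\<dots> = \<Theta> * C * W / lnorm k ^ 3" using p by (simp add: eval_nat_numeral)
    finally show ?thesis .
  qed (use \<Theta>0 C W in auto)
  show s1: "(\<lambda>k. \<theta> k * (U k t)\<^sup>2) summable_on UNIV"
    by (rule summable_on_dominated[OF inverse_power_summable[of 3 "\<Theta> * C\<^sup>2"]]) (simp_all add: b1[OF tt, simplified])
  show s2: "(\<lambda>k. \<theta> k * (\<alpha> * (lnorm k)\<^sup>2) * (U k t)\<^sup>2) summable_on UNIV"
  proof (rule summable_on_dominated[OF inverse_power_summable[of 4 "\<alpha> * \<Theta> * C\<^sup>2"]])
    fix k show "norm (\<theta> k * (\<alpha> * (lnorm k)\<^sup>2) * (U k t)\<^sup>2) \<le> \<alpha> * \<Theta> * C\<^sup>2 / lnorm k ^ 4"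
    proof (cases "k = 0")
      case False
      then have p: "lnorm k \<ge> 1" by (rule lnorm_ge_1)
      have "norm (\<theta> k * (\<alpha> * (lnorm k)\<^sup>2) * (U k t)\<^sup>2) \<le> (\<Theta> * (lnorm k)\<^sup>2) * (\<alpha> * (lnorm k)\<^sup>2) * (C / lnorm k ^ 4)\<^sup>2"
        unfolding real_norm_def abs_mult using \<Theta>[OF False] U4[OF tt, of k] \<Theta>0 \<alpha> by (intro mult_mono) (auto intro!: power_mono)
      also have "\<dots> = \<alpha> * \<Theta> * C\<^sup>2 / lnorm k ^ 4" using p by (simp add: eval_nat_numeral)
      finally show ?thesis .
    qed (use \<Theta>0 \<alpha> in auto)
  qed simp
  have sz: "(\<lambda>k. \<theta> k * (lnorm k)\<^sup>2 * (z k t \<bullet> zd k t)) summable_on UNIV"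
  proof (rule summable_on_dominated[OF inverse_power_summable[of 3 "\<Theta> * C * D"]])
    show "norm (\<theta> k * (lnorm k)\<^sup>2 * (z k t \<bullet> zd k t)) \<le> \<Theta> * C * D / lnorm k ^ 3" for k
      unfolding real_norm_def by (rule b2[OF tt _ D1]) (rule D2[OF _ tt])
  qed simp
  obtain \<Gamma> where \<Gamma>: "\<Gamma> \<ge> 0" "\<And>k. (lnorm k)\<^sup>2 * (lnorm k * cmod (\<gamma> k))\<^sup>2 \<le> \<Gamma>" using forcing_bound[of 2] by blast
  have \<gamma>b: "cmod (\<gamma> k) \<le> sqrt \<Gamma> / (lnorm k)\<^sup>2" if "k \<noteq> 0" for k
  proof -
    have "((lnorm k)\<^sup>2 * cmod (\<gamma> k))\<^sup>2 \<le> \<Gamma>" using \<Gamma>(2)[of k] by (simp add: power2_eq_square mult_ac)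
    then have "(lnorm k)\<^sup>2 * cmod (\<gamma> k) \<le> sqrt \<Gamma>" by (rule real_le_rsqrt)
    then show ?thesis using lnorm_pos[OF that] by (simp add: field_simps)
  qed
  have sg: "(\<lambda>k. \<theta> k * (lnorm k)\<^sup>2 * (z k t \<bullet> \<gamma> k)) summable_on UNIV"
  proof (rule summable_on_dominated[OF inverse_power_summable[of 3 "\<Theta> * C * sqrt \<Gamma>"]])
    show "norm (\<theta> k * (lnorm k)\<^sup>2 * (z k t \<bullet> \<gamma> k)) \<le> \<Theta> * C * sqrt \<Gamma> / lnorm k ^ 3" for k
      unfolding real_norm_def by (rule b2[OF tt _ real_sqrt_ge_zero[OF \<Gamma>(1)]]) (rule \<gamma>b)
  qed simp
  have sn: "(\<lambda>k. \<theta> k * (lnorm k)\<^sup>2 * (z k t \<bullet> NL k t)) summable_on UNIV"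
  proof (rule summable_on_dominated[OF inverse_power_summable[of 3 "\<Theta> * C * (2048 * C\<^sup>2)"]])
    fix k show "norm (\<theta> k * (lnorm k)\<^sup>2 * (z k t \<bullet> NL k t)) \<le> \<Theta> * C * (2048 * C\<^sup>2) / lnorm k ^ 3"
      unfolding real_norm_def
    proof (rule b2[OF tt])
      assume k: "k \<noteq> 0"
      show "cmod (NL k t) \<le> 2048 * C\<^sup>2 / (lnorm k)\<^sup>2"
        using NL_le[of k t] M_decay[OF C(2)[OF _ tt] C(1) k] by linarith
    qed auto
  qed simp
  have "((\<lambda>t. \<Sum>\<^sub>\<infinity>k. \<theta> k * (U k t)\<^sup>2) has_real_derivative (\<Sum>\<^sub>\<infinity>k. 2 * (\<theta> k * (lnorm k)\<^sup>2 * (z k t \<bullet> zd k t)))) (at t)"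
  proof (rule has_derivative_infsum_lattice[where a="t-1" and b="t+1" and B="\<lambda>k. (\<Theta> * C\<^sup>2 + 2 * (\<Theta> * C * D)) / lnorm k ^ 3"])
    fix k t' assume "t' \<in> {t-1<..<t+1}"
    then have t': "t' \<in> {t-1..t+1}" by auto
    have n: "0 \<le> \<Theta> * C\<^sup>2 / lnorm k ^ 3" "0 \<le> \<Theta> * C * D / lnorm k ^ 3" using \<Theta>0 C D by auto
    show "\<bar>\<theta> k * (U k t')\<^sup>2\<bar> \<le> (\<Theta> * C\<^sup>2 + 2 * (\<Theta> * C * D)) / lnorm k ^ 3"
      using b1[OF t', of k] n unfolding add_divide_distrib by linarith
    have "\<bar>\<theta> k * (lnorm k)\<^sup>2 * (z k t' \<bullet> zd k t')\<bar> \<le> \<Theta> * C * D / lnorm k ^ 3"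
      by (rule b2[OF t' _ D1]) (rule D2[OF _ t'])
    then show "\<bar>2 * (\<theta> k * (lnorm k)\<^sup>2 * (z k t' \<bullet> zd k t'))\<bar> \<le> (\<Theta> * C\<^sup>2 + 2 * (\<Theta> * C * D)) / lnorm k ^ 3"
      using n unfolding add_divide_distrib abs_mult[of 2] by linarith
    show "((\<lambda>t. \<theta> k * (U k t)\<^sup>2) has_real_derivative 2 * (\<theta> k * (lnorm k)\<^sup>2 * (z k t' \<bullet> zd k t'))) (at t')"
    proof (cases "k = 0")
      case False
      have "((\<lambda>t. z k t \<bullet> z k t) has_vector_derivative (z k t' \<bullet> zd k t' + zd k t' \<bullet> z k t')) (at t')"
        by (rule bounded_bilinear.has_vector_derivative[OF bounded_bilinear_inner z_derivative[OF False] z_derivative[OF False]])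
      then have "((\<lambda>t. z k t \<bullet> z k t) has_real_derivative 2 * (z k t' \<bullet> zd k t')) (at t')"
        by (simp add: has_real_derivative_iff_has_vector_derivative inner_commute)
      then have "((\<lambda>t. \<theta> k * (lnorm k)\<^sup>2 * (z k t \<bullet> z k t)) has_real_derivative \<theta> k * (lnorm k)\<^sup>2 * (2 * (z k t' \<bullet> zd k t'))) (at t')"
        by (rule DERIV_cmult)
      then show ?thesis by (simp add: U_def power_mult_distrib power2_norm_eq_inner mult_ac)
    qed simp
  qed (auto intro!: inverse_power_summable)
  moreover have "(\<Sum>\<^sub>\<infinity>k. 2 * (\<theta> k * (lnorm k)\<^sup>2 * (z k t \<bullet> zd k t))) =
      2 * (\<Sum>\<^sub>\<infinity>k. \<theta> k * (lnorm k)\<^sup>2 * (z k t \<bullet> \<gamma> k)) - 2 * (\<Sum>\<^sub>\<infinity>k. \<theta> k * (\<alpha> * (lnorm k)\<^sup>2) * (U k t)\<^sup>2)"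
  proof -
    have "\<theta> k * (lnorm k)\<^sup>2 * (z k t \<bullet> zd k t) = (\<theta> k * (lnorm k)\<^sup>2 * (z k t \<bullet> \<gamma> k) - \<theta> k * (\<alpha> * (lnorm k)\<^sup>2) * (U k t)\<^sup>2)
        + c * (\<theta> k * (lnorm k)\<^sup>2 * (z k t \<bullet> NL k t))" for k
      unfolding zd_def U_def power_mult_distrib power2_norm_eq_inner
      by (simp add: inner_add_right inner_diff_right algebra_simps)
    moreover have sd: "(\<lambda>k. \<theta> k * (lnorm k)\<^sup>2 * (z k t \<bullet> \<gamma> k) - \<theta> k * (\<alpha> * (lnorm k)\<^sup>2) * (U k t)\<^sup>2) summable_on UNIV"
      using summable_on_add[OF sg s2[THEN summable_on_uminus[THEN iffD2]]] by simp
    ultimately have "(\<Sum>\<^sub>\<infinity>k. \<theta> k * (lnorm k)\<^sup>2 * (z k t \<bullet> zd k t)) =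
       (\<Sum>\<^sub>\<infinity>k. \<theta> k * (lnorm k)\<^sup>2 * (z k t \<bullet> \<gamma> k) - \<theta> k * (\<alpha> * (lnorm k)\<^sup>2) * (U k t)\<^sup>2) + (\<Sum>\<^sub>\<infinity>k. c * (\<theta> k * (lnorm k)\<^sup>2 * (z k t \<bullet> NL k t)))"
      by (simp only: infsum_add[OF sd summable_on_cmult_right[OF sn]])
    also have "(\<Sum>\<^sub>\<infinity>k. c * (\<theta> k * (lnorm k)\<^sup>2 * (z k t \<bullet> NL k t))) = 0"
      using triad_sum_zero[OF C(2)[OF _ tt] C(1) \<theta>] by (subst infsum_cmult_right'[of c]) simp
    also have "(\<Sum>\<^sub>\<infinity>k. \<theta> k * (lnorm k)\<^sup>2 * (z k t \<bullet> \<gamma> k) - \<theta> k * (\<alpha> * (lnorm k)\<^sup>2) * (U k t)\<^sup>2) =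
      (\<Sum>\<^sub>\<infinity>k. \<theta> k * (lnorm k)\<^sup>2 * (z k t \<bullet> \<gamma> k)) - (\<Sum>\<^sub>\<infinity>k. \<theta> k * (\<alpha> * (lnorm k)\<^sup>2) * (U k t)\<^sup>2)"
      using infsum_add[OF sg s2[THEN summable_on_uminus[THEN iffD2]]] by (simp add: infsum_uminus)
    finally show ?thesis by (subst infsum_cmult_right') simp
  qed
  ultimately show "((\<lambda>t. \<Sum>\<^sub>\<infinity>k. \<theta> k * (U k t)\<^sup>2) has_real_derivative
      (2 * (\<Sum>\<^sub>\<infinity>k. \<theta> k * (lnorm k)\<^sup>2 * (z k t \<bullet> \<gamma> k)) - 2 * (\<Sum>\<^sub>\<infinity>k. \<theta> k * (\<alpha> * (lnorm k)\<^sup>2) * (U k t)\<^sup>2))) (at t)"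
    by simp
qed

section \<open>The Lyapunov functional on the negative half line\<close>

definition en :: "real \<Rightarrow> real" where "en t = (\<Sum>\<^sub>\<infinity>k. (U k t)\<^sup>2)"
text \<open>In the application this is the symbol of \<open>\<nu> (A - \<lambda>)\<close>. As
  \<open>U k\<close> is the modulus of a velocity coefficient, \<open>phi\<close> and
  \<open>diss\<close> are positive multiples of \<open>\<Phi>\<close> and of
  \<open>|(A - \<lambda>)u|^2\<close> in the overview.\<close>

definition gap :: "int \<times> int \<Rightarrow> real" where "gap k = \<alpha> * (lnorm k)\<^sup>2 - \<Lambda>"
definition phi :: "real \<Rightarrow> real" where "phi t = (\<Sum>\<^sub>\<infinity>k. gap k * (U k t)\<^sup>2)"
definition diss :: "real \<Rightarrow> real" where "diss t = (\<Sum>\<^sub>\<infinity>k. (gap k)\<^sup>2 * (U k t)\<^sup>2)"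

lemma gap_form: "gap k = - \<Lambda> + \<alpha> * (lnorm k)\<^sup>2" by (simp add: gap_def)

lemma en_summable: "(\<lambda>k. (U k t)\<^sup>2) summable_on UNIV"
  using weighted_sum_derivative(2)[of "\<lambda>_. 1" 1 0] by simp

lemma phi_summable: "(\<lambda>k. gap k * (U k t)\<^sup>2) summable_on UNIV"
  using weighted_sum_derivative(2)[OF gap_form] .

lemma diss_summable: "(\<lambda>k. (gap k)\<^sup>2 * (U k t)\<^sup>2) summable_on UNIV"
proof -
  have "(\<lambda>k. gap k * (\<alpha> * (lnorm k)\<^sup>2) * (U k t)\<^sup>2 + (- \<Lambda>) * (gap k * (U k t)\<^sup>2)) summable_on UNIV"
    by (intro summable_on_add summable_on_cmult_right weighted_sum_derivative(3)[OF gap_form] phi_summable)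
  then show ?thesis by (simp add: gap_def power2_eq_square algebra_simps)
qed

lemma en_bounds: "0 \<le> en t" "en t \<le> E"
proof -
  show "0 \<le> en t" unfolding en_def by (rule infsum_nonneg) simp
  show "en t \<le> E" unfolding en_def by (rule infsum_le_finite_sums[OF en_summable]) (use U_energy in auto)
qed

lemma diss_nonneg: "0 \<le> diss t" unfolding diss_def by (rule infsum_nonneg) simp

text \<open>The force drops out because \<open>gap k\<close> vanishes wherever
  \<open>\<gamma> k\<close> does not; this is where the eigenvector hypothesis acts. The rest is the
  identity \<open>gap k * (\<alpha> * (lnorm k)\<^sup>2) = (gap k)\<^sup>2 + \<Lambda> * gap
  k\<close>.\<close>

lemma phi_derivative: "(phi has_real_derivative (- 2 * \<Lambda> * phi t - 2 * diss t)) (at t)"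
proof -
  have "gap k * (lnorm k)\<^sup>2 * (z k t \<bullet> \<gamma> k) = 0" for k
    using forcing[of k] by (cases "\<gamma> k = 0") (auto simp: gap_def)
  then have 1: "(\<Sum>\<^sub>\<infinity>k. gap k * (lnorm k)\<^sup>2 * (z k t \<bullet> \<gamma> k)) = 0" by (intro infsum_0)
  have "gap k * (\<alpha> * (lnorm k)\<^sup>2) * (U k t)\<^sup>2 = (gap k)\<^sup>2 * (U k t)\<^sup>2 + \<Lambda> * (gap k * (U k t)\<^sup>2)" for k
    by (simp add: gap_def power2_eq_square algebra_simps)
  then have "(\<Sum>\<^sub>\<infinity>k. gap k * (\<alpha> * (lnorm k)\<^sup>2) * (U k t)\<^sup>2) = diss t + \<Lambda> * phi t"
    unfolding diss_def phi_def
    by (simp only: infsum_add[OF diss_summable summable_on_cmult_right[OF phi_summable]] infsum_cmult_right')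
  then have "2 * (\<Sum>\<^sub>\<infinity>k. gap k * (lnorm k)\<^sup>2 * (z k t \<bullet> \<gamma> k)) - 2 * (\<Sum>\<^sub>\<infinity>k. gap k * (\<alpha> * (lnorm k)\<^sup>2) * (U k t)\<^sup>2)
      = - 2 * \<Lambda> * phi t - 2 * diss t"
    unfolding 1 by simp
  moreover have "(phi has_real_derivative (2 * (\<Sum>\<^sub>\<infinity>k. gap k * (lnorm k)\<^sup>2 * (z k t \<bullet> \<gamma> k))
      - 2 * (\<Sum>\<^sub>\<infinity>k. gap k * (\<alpha> * (lnorm k)\<^sup>2) * (U k t)\<^sup>2))) (at t)"
    unfolding phi_def[abs_def] by (rule weighted_sum_derivative(1)[OF gap_form])
  ultimately show ?thesis by (simp only:)
qed

text \<open>The dissipation in the energy balance equals \<open>phi t + \<Lambda> * en t\<close>.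
  Discarding the nonnegative second part leaves \<open>phi\<close> with a negative sign, and the
  work of the force is bounded because only finitely many modes are forced.\<close>

lemma en_derivative:
  obtains G where "\<And>t. \<exists>d. (en has_real_derivative d) (at t) \<and> d \<le> 2 * G - 2 * phi t"
proof -
  define S where "S = {k. lnorm k \<le> sqrt (\<Lambda> / \<alpha>)}"
  have fS: "finite S" unfolding S_def by (rule finite_lnorm_le)
  have out: "\<gamma> k = 0" if "k \<notin> S" for k using that forcing_large by (simp add: S_def)
  obtain \<Gamma> where \<Gamma>: "\<Gamma> \<ge> 0" "\<And>k. (lnorm k * cmod (\<gamma> k))\<^sup>2 \<le> \<Gamma>" using forcing_bound[of 0] by auto
  define G where "G = real (card S) * (sqrt E * sqrt \<Gamma>)"
  have "\<exists>d. (en has_real_derivative d) (at t) \<and> d \<le> 2 * G - 2 * phi t" for t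
  proof -
    have "(\<Sum>\<^sub>\<infinity>k. 1 * (lnorm k)\<^sup>2 * (z k t \<bullet> \<gamma> k)) = (\<Sum>k\<in>S. 1 * (lnorm k)\<^sup>2 * (z k t \<bullet> \<gamma> k))"
    proof -
      have "(\<Sum>\<^sub>\<infinity>k. 1 * (lnorm k)\<^sup>2 * (z k t \<bullet> \<gamma> k)) = (\<Sum>\<^sub>\<infinity>k\<in>S. 1 * (lnorm k)\<^sup>2 * (z k t \<bullet> \<gamma> k))"
        by (rule infsum_cong_neutral) (simp_all add: out)
      then show ?thesis using fS by simp
    qed
    also have "\<dots> \<le> (\<Sum>k\<in>S. sqrt E * sqrt \<Gamma>)"
    proof (rule sum_mono)
      fix k
      have "z k t \<bullet> \<gamma> k \<le> cmod (z k t) * cmod (\<gamma> k)" by (rule norm_cauchy_schwarz)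
      then have "1 * (lnorm k)\<^sup>2 * (z k t \<bullet> \<gamma> k) \<le> 1 * (lnorm k)\<^sup>2 * (cmod (z k t) * cmod (\<gamma> k))" by (intro mult_left_mono) auto
      also have "\<dots> = U k t * (lnorm k * cmod (\<gamma> k))" by (simp add: U_def power2_eq_square)
      also have "\<dots> \<le> sqrt E * sqrt \<Gamma>" using \<Gamma> E_nonneg by (intro mult_mono U_le real_le_rsqrt) auto
      finally show "1 * (lnorm k)\<^sup>2 * (z k t \<bullet> \<gamma> k) \<le> sqrt E * sqrt \<Gamma>" .
    qed
    finally have 1: "(\<Sum>\<^sub>\<infinity>k. 1 * (lnorm k)\<^sup>2 * (z k t \<bullet> \<gamma> k)) \<le> G" by (simp add: G_def)
    have "1 * (\<alpha> * (lnorm k)\<^sup>2) * (U k t)\<^sup>2 = gap k * (U k t)\<^sup>2 + \<Lambda> * (U k t)\<^sup>2" for k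
      by (simp add: gap_def algebra_simps)
    then have "(\<Sum>\<^sub>\<infinity>k. 1 * (\<alpha> * (lnorm k)\<^sup>2) * (U k t)\<^sup>2) = phi t + \<Lambda> * en t"
      unfolding en_def phi_def
      by (simp only: infsum_add[OF phi_summable summable_on_cmult_right[OF en_summable]] infsum_cmult_right')
    moreover have "\<Lambda> * en t \<ge> 0" using \<Lambda> en_bounds by simp
    moreover have "((\<lambda>t. \<Sum>\<^sub>\<infinity>k. 1 * (U k t)\<^sup>2) has_real_derivative
      (2 * (\<Sum>\<^sub>\<infinity>k. 1 * (lnorm k)\<^sup>2 * (z k t \<bullet> \<gamma> k)) - 2 * (\<Sum>\<^sub>\<infinity>k. 1 * (\<alpha> * (lnorm k)\<^sup>2) * (U k t)\<^sup>2))) (at t)"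
      by (rule weighted_sum_derivative(1)[of _ 1 0]) simp
    then have "(en has_real_derivative
      (2 * (\<Sum>\<^sub>\<infinity>k. 1 * (lnorm k)\<^sup>2 * (z k t \<bullet> \<gamma> k)) - 2 * (\<Sum>\<^sub>\<infinity>k. 1 * (\<alpha> * (lnorm k)\<^sup>2) * (U k t)\<^sup>2))) (at t)"
      unfolding en_def[abs_def] by simp
    ultimately show ?thesis using 1 by (intro exI[of _ "2 * (\<Sum>\<^sub>\<infinity>k. 1 * (lnorm k)\<^sup>2 * (z k t \<bullet> \<gamma> k)) - 2 * (\<Sum>\<^sub>\<infinity>k. 1 * (\<alpha> * (lnorm k)\<^sup>2) * (U k t)\<^sup>2)"]) auto
  qed
  then show ?thesis using that by blast
qed

text \<open>The sign comes first: \<open>\<psi>\<close> is nonincreasing with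
  \<open>\<psi> 0 = 0\<close>, so \<open>phi \<ge> 0\<close> on the negative axis, and there
  \<open>phi\<close> is itself nonincreasing. This monotonicity lets a bound on the integral of
  \<open>phi\<close> over \<open>{s-1..s}\<close> control the value \<open>phi s\<close>, uniformly
  in \<open>s\<close>.\<close>

lemma phi_zero: assumes "t \<le> 0" shows "phi t = 0"
proof -
  define \<psi> where "\<psi> t = exp (2 * \<Lambda> * t) * phi t" for t
  have \<psi>': "(\<psi> has_real_derivative (- 2 * exp (2 * \<Lambda> * t) * diss t)) (at t)" for t
    unfolding \<psi>_def[abs_def]
    by (rule derivative_eq_intros phi_derivative refl | simp)+ (simp add: algebra_simps)
  have mono: "\<psi> b \<le> \<psi> a" if "a \<le> b" for a b
  proof (rule DERIV_nonpos_imp_nonincreasing[OF that, of \<psi>])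
    fix x show "\<exists>y. (\<psi> has_real_derivative y) (at x) \<and> y \<le> 0"
      using \<psi>'[of x] diss_nonneg[of x] by (intro exI[of _ "- 2 * exp (2 * \<Lambda> * x) * diss x"]) (auto simp: mult_nonneg_nonneg)
  qed
  have "phi 0 = 0" unfolding phi_def U_def by (simp add: initial)
  then have "\<psi> 0 = 0" by (simp add: \<psi>_def)
  then have \<psi>0: "\<psi> t \<ge> 0" if "t \<le> 0" for t using mono[OF that] by simp
  then have phi0: "phi t \<ge> 0" if "t \<le> 0" for t using that by (simp add: \<psi>_def zero_le_mult_iff)
  obtain G where G: "\<And>t. \<exists>d. (en has_real_derivative d) (at t) \<and> d \<le> 2 * G - 2 * phi t" by (rule en_derivative, rule that)
  have bound: "phi s \<le> E / 2 + \<bar>G\<bar>" if s: "s \<le> 0" for s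
  proof -
    define r where "r = s - 1"
    txt \<open>Uniform Gronwall: the energy inequality bounds the time integral of \<open>phi\<close>, hence \<open>phi\<close> itself.\<close>
    define W where "W t = (t - r) * phi t + en t / 2 - \<bar>G\<bar> * t" for t
    have "W s \<le> W r"
    proof (rule DERIV_nonpos_imp_nonincreasing[of r s W])
      show "r \<le> s" by (simp add: r_def)
      fix x assume x: "r \<le> x" "x \<le> s"
      obtain d where d: "(en has_real_derivative d) (at x)" "d \<le> 2 * G - 2 * phi x" using G by blast
      define q where "q = phi x + (x - r) * (- 2 * \<Lambda> * phi x - 2 * diss x) + d / 2 - \<bar>G\<bar>"
      have "(W has_real_derivative (phi x + (x - r) * (- 2 * \<Lambda> * phi x - 2 * diss x) + d / 2 - \<bar>G\<bar>)) (at x)"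
        unfolding W_def[abs_def] by (rule derivative_eq_intros phi_derivative d refl | simp)+
      moreover have "(x - r) * (- 2 * \<Lambda> * phi x - 2 * diss x) \<le> 0"
        using x s mult_nonneg_nonneg[OF less_imp_le[OF \<Lambda>] phi0[of x]] diss_nonneg[of x] by (intro mult_nonneg_nonpos) auto
      ultimately show "\<exists>y. (W has_real_derivative y) (at x) \<and> y \<le> 0"
        using d(2) unfolding q_def[symmetric] by (intro exI[of _ q]) (auto simp: q_def)
    qed
    then have "phi s + en s / 2 \<le> en r / 2 + \<bar>G\<bar>" by (simp add: W_def r_def algebra_simps)
    then show ?thesis using en_bounds[of s] en_bounds[of r] by linarith
  qed
  have "\<psi> t \<le> 0"
  proof (rule tendsto_lowerbound)
    show "((\<lambda>s. exp (2 * \<Lambda> * s) * (E / 2 + \<bar>G\<bar>)) \<longlongrightarrow> 0) at_bot"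
    proof (intro tendsto_mult_left_zero)
      have "filterlim (\<lambda>s. 2 * \<Lambda> * s) at_bot at_bot"
        using \<Lambda> by (intro filterlim_tendsto_pos_mult_at_bot[OF tendsto_const]) (auto simp: filterlim_ident)
      then show "((\<lambda>s. exp (2 * \<Lambda> * s)) \<longlongrightarrow> 0) at_bot" by (rule filterlim_compose[OF exp_at_bot])
    qed
    show "\<forall>\<^sub>F s in at_bot. \<psi> t \<le> exp (2 * \<Lambda> * s) * (E / 2 + \<bar>G\<bar>)"
      unfolding eventually_at_bot_linorder
    proof (intro exI[of _ t] allI impI)
      fix s assume "s \<le> t"
      then have "\<psi> t \<le> \<psi> s" by (rule mono)
      also have "\<dots> \<le> exp (2 * \<Lambda> * s) * (E / 2 + \<bar>G\<bar>)" unfolding \<psi>_def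
        using bound[of s] \<open>s \<le> t\<close> assms by (intro mult_left_mono) auto
      finally show "\<psi> t \<le> exp (2 * \<Lambda> * s) * (E / 2 + \<bar>G\<bar>)" .
    qed
  qed (simp_all)
  then show ?thesis using phi0[OF assms] by (simp add: \<psi>_def mult_le_0_iff)
qed

text \<open>\<open>phi\<close> vanishes in a neighbourhood of \<open>t\<close>, so its derivative
  formula forces \<open>diss t = 0\<close>, and with it every term of this nonnegative series.
  Strict negativity of \<open>t\<close> provides the neighbourhood.\<close>

lemma off_shell_zero:
  assumes t: "t < 0" and k: "\<alpha> * (lnorm k)\<^sup>2 \<noteq> \<Lambda>"
  shows "z k t = 0"
proof (cases "k = 0")
  case True then show ?thesis by (simp add: z0)
next
  case False
  have "(phi has_real_derivative 0) (at t)"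
    by (rule has_field_derivative_transform_within_open[of "\<lambda>_. 0" _ _ "{..<0}"]) (use t phi_zero in auto)
  then have "- 2 * \<Lambda> * phi t - 2 * diss t = 0" using phi_derivative DERIV_unique by blast
  then have "diss t = 0" using phi_zero t by simp
  moreover have "(gap k)\<^sup>2 * (U k t)\<^sup>2 \<le> diss t"
    unfolding diss_def using finite_sum_le_infsum[OF diss_summable[of t], of "{k}"] by simp
  ultimately have "(gap k)\<^sup>2 * (U k t)\<^sup>2 \<le> 0" by simp
  then have "gap k = 0 \<or> U k t = 0" by (metis mult_nonneg_nonneg mult_eq_0_iff order_antisym power_eq_0_iff zero_le_power2)
  then show ?thesis using k lnorm_pos[OF False] by (auto simp: gap_def U_def)
qed

text \<open>Under the reflection of \<open>l\<close> to \<open>k - l\<close> the surviving terms,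
  which have \<open>lnorm l = lnorm (k - l)\<close>, keep their \<open>dot2\<close> with
  \<open>k\<close> while \<open>cross2\<close> changes sign. The sum thus equals its own
  negative.\<close>

lemma NL_zero:
  assumes "t < 0" "\<alpha> * (lnorm k)\<^sup>2 = \<Lambda>"
  shows "NL k t = 0"
proof -
  have k0: "lnorm k \<noteq> 0" using assms(2) \<Lambda> by auto
  define f where "f l = triad l (k - l) *\<^sub>R (z l t * z (k - l) t)" for l
  have fs: "f summable_on UNIV" unfolding f_def by (rule abs_summable_summable[OF NL_abs_summable])
  have bij: "bij (\<lambda>l. k - l)" by (rule o_bij[of "\<lambda>l. k - l"]) auto
  have fs': "(\<lambda>l. f (k - l)) summable_on UNIV" using summable_on_reindex_bij_betw[OF bij, of f] fs by simp
  have i: "infsum (\<lambda>l. f (k - l)) UNIV = infsum f UNIV" by (rule infsum_reindex_bij_betw[OF bij])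
  have "f l + f (k - l) = 0" for l
  proof (cases "z l t = 0 \<or> z (k - l) t = 0")
    case True then show ?thesis by (auto simp: f_def)
  next
    case False
    then have "\<alpha> * (lnorm l)\<^sup>2 = \<Lambda>" "\<alpha> * (lnorm (k - l))\<^sup>2 = \<Lambda>" using off_shell_zero[OF assms(1)] by blast+
    then have "(lnorm l)\<^sup>2 = (lnorm (k - l))\<^sup>2" using \<alpha> by (metis mult_left_cancel less_irrefl)
    then have "dot2 l k = dot2 (k - l) k"
      unfolding lnorm_power2 dot2_def by (simp add: power2_eq_square algebra_simps)
    moreover have "cross2 (k - l) l = - cross2 l (k - l)" by (simp add: cross2_def algebra_simps)
    ultimately have "triad (k - l) l = - triad l (k - l)" by (simp add: triad_def)
    then show ?thesis by (simp add: f_def mult.commute)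
  qed
  then have "infsum (\<lambda>l. f l + f (k - l)) UNIV = 0" by simp
  then have "2 * infsum f UNIV = 0" using infsum_add[OF fs fs'] i by simp
  then show ?thesis by (simp add: NL_def f_def[abs_def])
qed

theorem forcing_zero: "\<gamma> k = 0"
proof (rule ccontr)
  assume "\<gamma> k \<noteq> 0"
  then have a: "\<alpha> * (lnorm k)\<^sup>2 = \<Lambda>" by (rule forcing)
  then have k: "k \<noteq> 0" using \<Lambda> by auto
  define w where "w = \<gamma> k /\<^sub>R \<Lambda>"
  define y where "y t = exp (\<Lambda> * t) *\<^sub>R (z k t - w)" for t
  have d0: "(y has_vector_derivative 0) (at t)" if "t < 0" for t
  proof -
    have "(z k has_vector_derivative (\<gamma> k - \<Lambda> *\<^sub>R z k t)) (at t)"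
      using z_derivative[OF k, of t] NL_zero[OF that a] by (simp add: zd_def a)
    then have "((\<lambda>t. z k t - w) has_vector_derivative (\<gamma> k - \<Lambda> *\<^sub>R z k t)) (at t)"
      by (auto intro!: derivative_eq_intros)
    moreover have "((\<lambda>t. exp (\<Lambda> * t)) has_real_derivative (\<Lambda> * exp (\<Lambda> * t))) (at t)"
      by (auto intro!: derivative_eq_intros)
    ultimately have "(y has_vector_derivative (exp (\<Lambda> * t) *\<^sub>R (\<gamma> k - \<Lambda> *\<^sub>R z k t) + (\<Lambda> * exp (\<Lambda> * t)) *\<^sub>R (z k t - w))) (at t)"
      unfolding y_def[abs_def] by (intro has_vector_derivative_scaleR)
    moreover have "exp (\<Lambda> * t) *\<^sub>R (\<gamma> k - \<Lambda> *\<^sub>R z k t) + (\<Lambda> * exp (\<Lambda> * t)) *\<^sub>R (z k t - w) = 0"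
      using \<Lambda> by (simp add: w_def algebra_simps)
    ultimately show ?thesis by simp
  qed
  have cy: "continuous_on S y" for S unfolding y_def by (intro continuous_intros continuous_z)
  have const: "y t = y 0" if "t < 0" for t
  proof -
    have "y 0 = y t"
    proof (rule has_derivative_zero_unique_strong_interval[of "{0}" t 0 y])
      fix x assume "x \<in> {t..0} - {0}"
      then have "(y has_vector_derivative 0) (at x)" using d0 by auto
      then show "(y has_derivative (\<lambda>h. 0)) (at x within {t..0})"
        by (simp add: has_vector_derivative_def has_derivative_at_withinI)
    qed (use that cy in auto)
    then show ?thesis by simp
  qed
  have zb: "cmod (z k t) \<le> sqrt E" for t
  proof -
    have "1 * cmod (z k t) \<le> lnorm k * cmod (z k t)" using lnorm_ge_1[OF k] by (intro mult_right_mono) auto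
    then show ?thesis using U_le[of k t] by (simp add: U_def)
  qed
  have "cmod (y 0) \<le> 0"
  proof (rule tendsto_lowerbound)
    show "((\<lambda>s. exp (\<Lambda> * s) * (sqrt E + cmod w)) \<longlongrightarrow> 0) at_bot"
    proof (intro tendsto_mult_left_zero)
      have "filterlim (\<lambda>s. \<Lambda> * s) at_bot at_bot"
        using \<Lambda> by (intro filterlim_tendsto_pos_mult_at_bot[OF tendsto_const]) (auto simp: filterlim_ident)
      then show "((\<lambda>s. exp (\<Lambda> * s)) \<longlongrightarrow> 0) at_bot" by (rule filterlim_compose[OF exp_at_bot])
    qed
    show "\<forall>\<^sub>F s in at_bot. cmod (y 0) \<le> exp (\<Lambda> * s) * (sqrt E + cmod w)"
      unfolding eventually_at_bot_linorder
    proof (intro exI[of _ "-1"] allI impI)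
      fix s :: real assume "s \<le> -1"
      then have "cmod (y 0) = cmod (y s)" using const[of s] by simp
      also have "\<dots> = exp (\<Lambda> * s) * cmod (z k s - w)" by (simp add: y_def)
      also have "\<dots> \<le> exp (\<Lambda> * s) * (sqrt E + cmod w)"
        using zb[of s] norm_triangle_ineq4[of "z k s" w] by (intro mult_left_mono) auto
      finally show "cmod (y 0) \<le> exp (\<Lambda> * s) * (sqrt E + cmod w)" .
    qed
  qed simp_all
  then have "w = 0" by (simp add: y_def initial)
  then show False using \<open>\<gamma> k \<noteq> 0\<close> \<Lambda> by (simp add: w_def)
qed

end

section \<open>Fourier series on the torus\<close>

text \<open>Lebesgue measure is the image of the product measure over \<open>Basis\<close>, so
  Fubini reduces the integral to one-dimensional ones.\<close>

lemma integral_lborel_prod: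
  fixes f :: "'a::euclidean_space \<Rightarrow> real \<Rightarrow> complex"
  assumes "\<And>b. b \<in> Basis \<Longrightarrow> integrable lborel (f b)"
  shows "(\<integral>x. (\<Prod>b\<in>Basis. f b (x \<bullet> b)) \<partial>lborel) = (\<Prod>b\<in>Basis. \<integral>x. f b x \<partial>lborel)"
proof -
  interpret product_sigma_finite "\<lambda>_::'a. lborel :: real measure"
    by standard
  have [measurable]: "f b \<in> borel_measurable borel" if "b \<in> Basis" for b
    using borel_measurable_integrable[OF assms[OF that]] by simp
  have "(\<integral>x. (\<Prod>b\<in>Basis. f b (x \<bullet> b)) \<partial>lborel) =
        (\<integral>y. (\<Prod>b\<in>Basis. f b ((\<Sum>c\<in>Basis. y c *\<^sub>R c) \<bullet> b)) \<partial>(\<Pi>\<^sub>M b\<in>(Basis::'a set). lborel))"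
    by (subst lborel_eq) (rule integral_distr; measurable)
  also have "\<dots> = (\<integral>y. (\<Prod>b\<in>Basis. f b (y b)) \<partial>(\<Pi>\<^sub>M b\<in>(Basis::'a set). lborel))"
    by (intro Bochner_Integration.integral_cong refl prod.cong) simp
  also have "\<dots> = (\<Prod>b\<in>Basis. \<integral>x. f b x \<partial>lborel)"
    by (rule product_integral_prod) (use assms in auto)
  finally show ?thesis .
qed

text \<open>The phase indexed by pairs of integers, the index type of the lattice sums;
  \<open>ivec\<close> and \<open>pvec\<close> translate from and to \<open>int^2\<close>.\<close>

definition ph :: "real \<Rightarrow> int \<times> int \<Rightarrow> real^2 \<Rightarrow> real" where
  "ph L k x = 2 * pi / L * (real_of_int (fst k) * x $ 1 + real_of_int (snd k) * x $ 2)"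

definition ivec :: "int \<times> int \<Rightarrow> int^2" where
  "ivec k = (\<chi> i. if i = 1 then fst k else snd k)"

definition pvec :: "int^2 \<Rightarrow> int \<times> int" where "pvec q = (q $ 1, q $ 2)"

definition cmp :: "int \<times> int \<Rightarrow> 2 \<Rightarrow> real" where
  "cmp k i = real_of_int (if i = 1 then fst k else snd k)"

definition perp :: "int \<times> int \<Rightarrow> real^2" where
  "perp k = (\<chi> i. if i = 1 then - real_of_int (snd k) else real_of_int (fst k))"

lemma two_cases: "(i::2) = 1 \<or> i = 2" using exhaust_2 by blast

lemma phase_pvec: "phase L q x = ph L (pvec q) x"
  by (simp add: phase_def ph_def pvec_def sum_2)

lemma phase_ivec: "phase L (ivec k) x = ph L k x"
  by (simp add: phase_def ph_def ivec_def sum_2)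

lemma ph_add: "ph L (k + l) x = ph L k x + ph L l x"
  by (simp add: ph_def algebra_simps)

lemma ph_minus: "ph L (- k) x = - ph L k x"
  by (simp add: ph_def algebra_simps)

lemma ph_axis: "ph L k (axis j 1) = 2 * pi / L * cmp k j"
  using two_cases[of j] by (auto simp: ph_def cmp_def axis_def)

lemma ph_linear: "bounded_linear (ph L k)"
proof -
  have "linear (ph L k)" unfolding ph_def by (intro linearI) (simp_all add: algebra_simps)
  then show ?thesis using linear_conv_bounded_linear by blast
qed

lemma continuous_ph: "continuous_on S (ph L k)"
  using linear_continuous_on ph_linear by blast

lemma ph_derivative: "(ph L k has_derivative ph L k) (at x)"
  using bounded_linear_imp_has_derivative ph_linear by blast

lemma Basis_2: "(Basis :: (real^2) set) = {axis 1 1, axis 2 1}"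
  by (auto simp: Basis_vec_def UNIV_2)

lemma cis_integral_1d:
  assumes "L > 0"
  shows "(\<integral>y. indicator {0..L} y *\<^sub>R cis (2 * pi / L * real_of_int n * y) \<partial>lborel) = (if n = 0 then of_real L else 0)"
proof -
  have cont: "continuous_on {0..L} (\<lambda>y. cis (2 * pi / L * real_of_int n * y))"
    by (intro continuous_intros)
  have si: "set_integrable lborel {0..L} (\<lambda>y. cis (2 * pi / L * real_of_int n * y))"
    by (rule borel_integrable_atLeastAtMost') (rule cont)
  have eq: "(\<integral>y. indicator {0..L} y *\<^sub>R cis (2 * pi / L * real_of_int n * y) \<partial>lborel) = integral {0..L} (\<lambda>y. cis (2 * pi / L * real_of_int n * y))"
    using set_borel_integral_eq_integral(2)[OF si] by (simp add: set_lebesgue_integral_def)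
  show ?thesis
  proof (cases "n = 0")
    case True
    then show ?thesis using eq assms by (simp add: scaleR_conv_of_real)
  next
    case False
    define w where "w = 2 * pi / L * real_of_int n"
    have w: "w \<noteq> 0" using False assms by (simp add: w_def)
    have "((\<lambda>y. cis (w * y)) has_integral (cis (w * L) / (\<i> * of_real w) - cis (w * 0) / (\<i> * of_real w))) {0..L}"
    proof (rule fundamental_theorem_of_calculus)
      fix y
      have "((\<lambda>y. exp (\<i> * of_real w * of_real y) / (\<i> * of_real w)) has_vector_derivative exp (\<i> * of_real w * of_real y)) (at y within {0..L})"
        by (rule has_vector_derivative_real_field) (use w in \<open>auto intro!: derivative_eq_intros\<close>)
      moreover have "cis (w * u) = exp (\<i> * of_real w * of_real u)" for u by (simp add: cis_conv_exp mult.assoc)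
      ultimately show "((\<lambda>y. cis (w * y) / (\<i> * of_real w)) has_vector_derivative cis (w * y)) (at y within {0..L})" by simp
    qed (use assms in simp)
    moreover have "w * L = 2 * pi * of_int n" using assms by (simp add: w_def)
    then have "cis (w * L) = 1" by (simp add: cis_multiple_2pi)
    ultimately show ?thesis using eq False by (simp add: w_def integral_unique)
  qed
qed

lemma Omega_measurable: "Omega L \<in> sets borel" "Omega L \<in> sets lebesgue" by (auto simp: Omega_def)

lemma mem_Omega: "x \<in> Omega L \<longleftrightarrow> 0 \<le> x $ 1 \<and> x $ 1 \<le> L \<and> 0 \<le> x $ 2 \<and> x $ 2 \<le> L"
  by (auto simp: Omega_def mem_box_cart forall_2)

lemma integrable_Omega_continuous:
  fixes f :: "real^2 \<Rightarrow> 'a::euclidean_space"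
  assumes "continuous_on UNIV f"
  shows "integrable (Omega_measure L) f"
proof -
  have "f absolutely_integrable_on Omega L"
    unfolding Omega_def by (rule absolutely_integrable_continuous) (rule continuous_on_subset[OF assms]; simp)
  then show ?thesis
    by (subst integrable_restrict_space) (auto simp: Omega_def set_integrable_def)
qed

lemma continuous_cis_ph: "continuous_on S (\<lambda>x. cis (ph L k x))"
  by (intro continuous_intros continuous_ph)

lemma cis_ph_integral:
  assumes "L > 0"
  shows "(LINT x|Omega_measure L. cis (ph L k x)) = (if k = 0 then of_real (L\<^sup>2) else 0)"
proof -
  define f where "f b y = indicator {0..L} y *\<^sub>R cis (2 * pi / L * real_of_int (if b = axis 1 1 then fst k else snd k) * y)" for b :: "real^2" and y
  have ne: "axis 2 (1::real) \<noteq> (axis 1 1 :: real^2)" by (simp add: axis_eq_axis)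
  have fi: "integrable lborel (f b)" for b
    unfolding f_def[abs_def] set_integrable_def[symmetric]
    by (rule borel_integrable_atLeastAtMost') (intro continuous_intros)
  have 1: "indicator (Omega L) x *\<^sub>R cis (ph L k x) = (\<Prod>b\<in>Basis. f b (x \<bullet> b))" for x
    unfolding Basis_2 using ne
    by (auto simp: f_def mem_Omega ph_def inner_axis indicator_def cis_mult algebra_simps)
  have "(LINT x|Omega_measure L. cis (ph L k x)) = (\<integral>x. indicator (Omega L) x *\<^sub>R cis (ph L k x) \<partial>lebesgue)"
    by (rule integral_restrict_space) (simp add: Omega_measurable)
  also have "\<dots> = (\<integral>x. indicator (Omega L) x *\<^sub>R cis (ph L k x) \<partial>lborel)"
  proof (rule integral_completion)
    have "(\<lambda>x. cis (ph L k x)) \<in> borel_measurable borel"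
      by (rule borel_measurable_continuous_onI[OF continuous_cis_ph])
    then show "(\<lambda>x. indicator (Omega L) x *\<^sub>R cis (ph L k x)) \<in> borel_measurable lborel"
      using Omega_measurable(1)[of L] by simp
  qed
  also have "\<dots> = (\<Prod>b\<in>Basis. \<integral>y. f b y \<partial>lborel)" unfolding 1 by (rule integral_lborel_prod) (rule fi)
  also have "\<dots> = (if fst k = 0 then of_real L else 0) * (if snd k = 0 then of_real L else 0)"
  proof -
    have "f (axis 1 1) = (\<lambda>y. indicator {0..L} y *\<^sub>R cis (2 * pi / L * real_of_int (fst k) * y))"
      "f (axis 2 1) = (\<lambda>y. indicator {0..L} y *\<^sub>R cis (2 * pi / L * real_of_int (snd k) * y))"
      using ne by (simp_all add: f_def fun_eq_iff)
    then have "integral\<^sup>L lborel (f (axis 1 1)) = (if fst k = 0 then of_real L else 0)"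
      "integral\<^sup>L lborel (f (axis 2 1)) = (if snd k = 0 then of_real L else 0)"
      by (simp_all only: cis_integral_1d[OF assms])
    then show ?thesis unfolding Basis_2 using ne by simp
  qed
  also have "\<dots> = (if k = 0 then of_real (L\<^sup>2) else 0)"
    by (auto simp: power2_eq_square prod_eq_iff)
  finally show ?thesis .
qed

section \<open>Orthogonality and Parseval for complex trigonometric polynomials\<close>

definition tpoly :: "real \<Rightarrow> (int \<times> int) set \<Rightarrow> (int \<times> int \<Rightarrow> complex) \<Rightarrow> real^2 \<Rightarrow> complex" where
  "tpoly L F d x = (\<Sum>k\<in>F. d k * cis (ph L k x))"

lemma continuous_tpoly: "continuous_on S (tpoly L F d)"
  unfolding tpoly_def by (intro continuous_intros continuous_cis_ph)

lemma tpoly_coeff: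
  assumes "L > 0" "finite F"
  shows "(LINT x|Omega_measure L. tpoly L F d x * cis (- ph L k x)) = (if k \<in> F then of_real (L\<^sup>2) * d k else 0)"
proof -
  have "tpoly L F d x * cis (- ph L k x) = (\<Sum>l\<in>F. d l * cis (ph L (l - k) x))" for x
    using ph_add[of L _ "- k" x] by (simp add: tpoly_def sum_distrib_right mult.assoc cis_mult ph_minus)
  then have "(LINT x|Omega_measure L. tpoly L F d x * cis (- ph L k x)) = (LINT x|Omega_measure L. (\<Sum>l\<in>F. d l * cis (ph L (l - k) x)))"
    by simp
  also have "\<dots> = (\<Sum>l\<in>F. d l * (LINT x|Omega_measure L. cis (ph L (l - k) x)))"
    by (subst Bochner_Integration.integral_sum)
      (auto intro!: integrable_Omega_continuous continuous_intros continuous_cis_ph)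
  also have "\<dots> = (\<Sum>l\<in>F. if l = k then of_real (L\<^sup>2) * d k else 0)"
    by (rule sum.cong) (auto simp: cis_ph_integral[OF assms(1)])
  also have "\<dots> = (if k \<in> F then of_real (L\<^sup>2) * d k else 0)" using assms(2) by (simp add: sum.delta)
  finally show ?thesis .
qed

lemma tpoly_parseval:
  assumes "L > 0" "finite F"
  shows "(LINT x|Omega_measure L. (cmod (tpoly L F d x))\<^sup>2) = L\<^sup>2 * (\<Sum>k\<in>F. (cmod (d k))\<^sup>2)"
proof -
  have "complex_of_real ((cmod (tpoly L F d x))\<^sup>2) = (\<Sum>k\<in>F. cnj (d k) * (tpoly L F d x * cis (- ph L k x)))" for x
  proof -
    have "complex_of_real ((cmod (tpoly L F d x))\<^sup>2) = tpoly L F d x * cnj (tpoly L F d x)"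
      by (simp only: complex_norm_square)
    also have "cnj (tpoly L F d x) = (\<Sum>k\<in>F. cnj (d k) * cis (- ph L k x))"
      by (simp add: tpoly_def cis_cnj)
    finally show ?thesis by (simp add: sum_distrib_left mult_ac)
  qed
  then have "(LINT x|Omega_measure L. complex_of_real ((cmod (tpoly L F d x))\<^sup>2)) =
      (LINT x|Omega_measure L. (\<Sum>k\<in>F. cnj (d k) * (tpoly L F d x * cis (- ph L k x))))" by simp
  also have "\<dots> = (\<Sum>k\<in>F. cnj (d k) * (LINT x|Omega_measure L. tpoly L F d x * cis (- ph L k x)))"
    by (subst Bochner_Integration.integral_sum)
      (auto intro!: integrable_Omega_continuous continuous_intros continuous_tpoly continuous_ph)
  also have "\<dots> = (\<Sum>k\<in>F. complex_of_real (L\<^sup>2 * (cmod (d k))\<^sup>2))"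
    by (rule sum.cong) (auto simp: tpoly_coeff[OF assms] complex_norm_square mult_ac simp del: of_real_power)
  finally have "complex_of_real (LINT x|Omega_measure L. (cmod (tpoly L F d x))\<^sup>2) = complex_of_real (L\<^sup>2 * (\<Sum>k\<in>F. (cmod (d k))\<^sup>2))"
    by (simp only: integral_complex_of_real sum_distrib_left of_real_sum)
  then show ?thesis by (simp only: of_real_eq_iff)
qed

section \<open>Square-integrable fields and their inner product\<close>

lemma L2_space_measurable: "f \<in> L2_space L \<Longrightarrow> f \<in> borel_measurable (Omega_measure L)"
  by (simp add: L2_space_def)

lemma L2_space_integrable: "f \<in> L2_space L \<Longrightarrow> integrable (Omega_measure L) (\<lambda>x. (norm (f x))\<^sup>2)"
  by (simp add: L2_space_def)

lemma L2_space_dominated: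
  assumes "f \<in> borel_measurable (Omega_measure L)" "h \<in> L2_space L" "\<And>x. norm (f x) \<le> C * norm (h x)"
  shows "f \<in> L2_space L"
proof -
  have "integrable (Omega_measure L) (\<lambda>x. (norm (f x))\<^sup>2)"
  proof (rule Bochner_Integration.integrable_bound)
    show "integrable (Omega_measure L) (\<lambda>x. C\<^sup>2 * (norm (h x))\<^sup>2)"
      using L2_space_integrable[OF assms(2)] by simp
    show "AE x in Omega_measure L. norm ((norm (f x))\<^sup>2) \<le> norm (C\<^sup>2 * (norm (h x))\<^sup>2)"
    proof (rule AE_I2)
      fix x
      have "(norm (f x))\<^sup>2 \<le> (C * norm (h x))\<^sup>2" by (intro power_mono assms(3)) auto
      then show "norm ((norm (f x))\<^sup>2) \<le> norm (C\<^sup>2 * (norm (h x))\<^sup>2)" by (simp add: power_mult_distrib)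
    qed
  qed (use assms(1) in measurable)
  then show ?thesis using assms(1) by (simp add: L2_space_def)
qed

lemma L2_space_diff:
  assumes "f \<in> L2_space L" "h \<in> L2_space L"
  shows "(\<lambda>x. f x - h x) \<in> L2_space L"
proof -
  have m: "(\<lambda>x. f x - h x) \<in> borel_measurable (Omega_measure L)"
    using assms[THEN L2_space_measurable] by measurable
  have "integrable (Omega_measure L) (\<lambda>x. (norm (f x - h x))\<^sup>2)"
  proof (rule Bochner_Integration.integrable_bound)
    show "integrable (Omega_measure L) (\<lambda>x. 2 * (norm (f x))\<^sup>2 + 2 * (norm (h x))\<^sup>2)"
      using assms[THEN L2_space_integrable] by simp
    show "AE x in Omega_measure L. norm ((norm (f x - h x))\<^sup>2) \<le> norm (2 * (norm (f x))\<^sup>2 + 2 * (norm (h x))\<^sup>2)"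
    proof (rule AE_I2)
      fix x
      have "(norm (f x - h x))\<^sup>2 \<le> (norm (f x) + norm (h x))\<^sup>2" by (intro power_mono norm_triangle_ineq4) auto
      also have "\<dots> \<le> 2 * (norm (f x))\<^sup>2 + 2 * (norm (h x))\<^sup>2"
        using sum_squares_bound[of "norm (f x)" "norm (h x)"] by (simp add: power2_sum)
      finally show "norm ((norm (f x - h x))\<^sup>2) \<le> norm (2 * (norm (f x))\<^sup>2 + 2 * (norm (h x))\<^sup>2)" by simp
    qed
  qed (use m in measurable)
  then show ?thesis using m by (simp add: L2_space_def)
qed

lemma L2_space_scaleR:
  assumes "f \<in> L2_space L"
  shows "(\<lambda>x. a *\<^sub>R f x) \<in> L2_space L"
proof (rule L2_space_dominated[where h=f and C="\<bar>a\<bar>"])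
  show "(\<lambda>x. a *\<^sub>R f x) \<in> borel_measurable (Omega_measure L)"
    by (rule borel_measurable_scaleR[OF borel_measurable_const L2_space_measurable[OF assms]])
qed (simp_all add: assms)

lemma L2_space_uminus: "f \<in> L2_space L \<Longrightarrow> (\<lambda>x. - f x) \<in> L2_space L"
  using L2_space_scaleR[of f L "-1"] by simp

lemma L2_norm_nonneg [simp]: "0 \<le> L2_norm L f" by (simp add: L2_norm_def)

lemma L2_norm_power2: "(L2_norm L f)\<^sup>2 = (LINT x|Omega_measure L. (norm (f x))\<^sup>2)"
  by (simp add: L2_norm_def)

lemma L2_inner_self: "L2_inner L f f = (L2_norm L f)\<^sup>2"
  unfolding L2_norm_power2 L2_inner_def by (simp add: dot_square_norm)

lemma L2_inner_diff_left:
  assumes "f \<in> L2_space L" "h \<in> L2_space L" "w \<in> L2_space L"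
  shows "L2_inner L (\<lambda>x. f x - h x) w = L2_inner L f w - L2_inner L h w"
  using assms by (simp add: L2_inner_def inner_diff_left L2_inner_integrable)

lemma L2_inner_diff_right:
  assumes "f \<in> L2_space L" "h \<in> L2_space L" "w \<in> L2_space L"
  shows "L2_inner L w (\<lambda>x. f x - h x) = L2_inner L w f - L2_inner L w h"
  using assms by (simp add: L2_inner_def inner_diff_right L2_inner_integrable)

lemma L2_inner_scaleR_right: "L2_inner L w (\<lambda>x. a *\<^sub>R f x) = a * L2_inner L w f"
  by (simp add: L2_inner_def)

lemma L2_inner_scaleR_left: "L2_inner L (\<lambda>x. a *\<^sub>R f x) w = a * L2_inner L f w"
  by (simp add: L2_inner_def)

lemma L2_inner_commute: "L2_inner L f h = L2_inner L h f"
  by (simp add: L2_inner_def inner_commute)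

lemma L2_Cauchy_Schwarz:
  assumes f: "f \<in> L2_space L" and h: "h \<in> L2_space L"
  shows "\<bar>L2_inner L f h\<bar> \<le> L2_norm L f * L2_norm L h"
proof -
  define a b c where "a = (L2_norm L f)\<^sup>2" and "b = L2_inner L f h" and "c = (L2_norm L h)\<^sup>2"
  have q: "0 \<le> a - 2 * t * b + t\<^sup>2 * c" for t
  proof -
    have th: "(\<lambda>x. t *\<^sub>R h x) \<in> L2_space L" by (rule L2_space_scaleR[OF h])
    have "(L2_norm L (\<lambda>x. f x - t *\<^sub>R h x))\<^sup>2 = a - 2 * t * b + t\<^sup>2 * c"
      unfolding L2_inner_self[symmetric] a_def b_def c_def
      by (simp add: L2_inner_diff_left[OF f th L2_space_diff[OF f th]] L2_inner_diff_right[OF f th f] L2_inner_diff_right[OF f th h]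
          L2_inner_scaleR_right L2_inner_scaleR_left L2_inner_commute[of L h f] power2_eq_square algebra_simps)
    then show ?thesis by (metis zero_le_power2)
  qed
  have a0: "a \<ge> 0" "c \<ge> 0" by (simp_all add: a_def c_def)
  have "b\<^sup>2 \<le> a * c"
  proof (cases "c = 0")
    case True
    have "b = 0"
    proof (rule ccontr)
      assume "b \<noteq> 0"
      \<comment> \<open>For \<open>c = 0\<close> the expression in \<open>q\<close> is affine in
        \<open>t\<close>, and this \<open>t\<close> gives it the value
        \<open>a - (a + 1) = -1\<close>.\<close>
      then show False using q[of "(a + 1) / (2 * b)"] a0 True by simp
    qed
    then show ?thesis using True by simp
  next
    case False
    then have "c > 0" using a0 by simp
    have "0 \<le> c * (a - 2 * (b / c) * b + (b / c)\<^sup>2 * c)" using \<open>c > 0\<close> by (intro mult_nonneg_nonneg q) simp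
    also have "\<dots> = a * c - b\<^sup>2" using False by (simp add: field_simps power2_eq_square)
    finally show ?thesis by simp
  qed
  then have "b\<^sup>2 \<le> (L2_norm L f * L2_norm L h)\<^sup>2" by (simp add: a_def c_def power_mult_distrib)
  then show ?thesis using abs_le_square_iff[of b "L2_norm L f * L2_norm L h"] by (simp add: b_def abs_mult)
qed

lemma L2_norm_triangle:
  assumes f: "f \<in> L2_space L" and h: "h \<in> L2_space L"
  shows "L2_norm L f \<le> L2_norm L h + L2_norm L (\<lambda>x. f x - h x)"
proof -
  have d: "(\<lambda>x. f x - h x) \<in> L2_space L" by (rule L2_space_diff[OF f h])
  have "(L2_norm L f)\<^sup>2 = L2_inner L f h + L2_inner L f (\<lambda>x. f x - h x)"
    unfolding L2_inner_self[symmetric] by (simp add: L2_inner_diff_right[OF f h f])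
  also have "\<dots> \<le> L2_norm L f * L2_norm L h + L2_norm L f * L2_norm L (\<lambda>x. f x - h x)"
    using L2_Cauchy_Schwarz[OF f h] L2_Cauchy_Schwarz[OF f d] by linarith
  finally have *: "L2_norm L f * L2_norm L f \<le> L2_norm L f * (L2_norm L h + L2_norm L (\<lambda>x. f x - h x))"
    by (simp add: power2_eq_square algebra_simps)
  show ?thesis
  proof (cases "L2_norm L f = 0")
    case False
    then have "L2_norm L f > 0" using L2_norm_nonneg[of L f] by linarith
    then show ?thesis using * by simp
  qed simp
qed

lemma L2_norm_minus: "L2_norm L (\<lambda>x. f x - h x) = L2_norm L (\<lambda>x. h x - f x)"
  by (simp add: L2_norm_def norm_minus_commute)

section \<open>Divergence-free trigonometric polynomials\<close>

text \<open>Together with \<open>tsin\<close> the real and imaginary parts of a divergence-free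
  exponential mode. Both are test fields and Laplace eigenfunctions, and the equation is tested
  against them.\<close>

definition tcos :: "real \<Rightarrow> int \<times> int \<Rightarrow> real^2 \<Rightarrow> real^2" where
  "tcos L k x = cos (ph L k x) *\<^sub>R perp k"

definition tsin :: "real \<Rightarrow> int \<times> int \<Rightarrow> real^2 \<Rightarrow> real^2" where
  "tsin L k x = sin (ph L k x) *\<^sub>R perp k"

lemma perp_nth: "perp k $ 1 = - real_of_int (snd k)" "perp k $ 2 = real_of_int (fst k)"
  by (simp_all add: perp_def)

lemma norm_perp: "norm (perp k) = lnorm k"
proof -
  have "(norm (perp k))\<^sup>2 = (lnorm k)\<^sup>2"
    unfolding power2_norm_eq_inner lnorm_power2 by (simp add: inner_vec_def sum_2 perp_nth power2_eq_square)
  then show ?thesis by (metis lnorm_nonneg norm_ge_zero power2_eq_iff_nonneg)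
qed

lemma perp_inner: "perp k \<bullet> perp l = dot2 k l"
  by (simp add: inner_vec_def sum_2 perp_nth dot2_def)

lemma dot2_self: "dot2 k k = (lnorm k)\<^sup>2"
  unfolding lnorm_power2 by (simp add: dot2_def power2_eq_square)

lemma cmp_sum: "(\<Sum>j\<in>UNIV. cmp m j * perp l $ j) = cross2 l m"
  by (simp add: sum_2 cmp_def perp_nth cross2_def)

lemma cmp_perp_orth: "(\<Sum>j\<in>UNIV. cmp k j * perp k $ j) = 0"
  by (simp add: sum_2 cmp_def perp_nth)

lemma cmp_square_sum: "(\<Sum>j\<in>UNIV. (cmp k j)\<^sup>2) = (lnorm k)\<^sup>2"
  unfolding lnorm_power2 by (simp add: sum_2 cmp_def)

lemma perp_square_sum: "(\<Sum>i\<in>UNIV. (perp k $ i)\<^sup>2) = (lnorm k)\<^sup>2"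
  unfolding lnorm_power2 by (simp add: sum_2 perp_nth)

lemma tcos_derivative: "(tcos L k has_derivative (\<lambda>h. (- sin (ph L k x) * ph L k h) *\<^sub>R perp k)) (at x)"
  unfolding tcos_def[abs_def] by (auto intro!: derivative_eq_intros ph_derivative)

lemma tsin_derivative: "(tsin L k has_derivative (\<lambda>h. (cos (ph L k x) * ph L k h) *\<^sub>R perp k)) (at x)"
  unfolding tsin_def[abs_def] by (auto intro!: derivative_eq_intros ph_derivative)

lemma jacobian_nth:
  assumes "(v has_derivative D) (at x)"
  shows "jacobian v (at x) $ i $ j = D (axis j 1) $ i"
  using frechet_derivative_at[OF assms] by (simp add: jacobian_def matrix_def)

lemma jacobian_tcos: "jacobian (tcos L k) (at x) $ i $ j = - sin (ph L k x) * (2 * pi / L * cmp k j) * perp k $ i"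
  by (simp add: jacobian_nth[OF tcos_derivative] ph_axis)

lemma jacobian_tsin: "jacobian (tsin L k) (at x) $ i $ j = cos (ph L k x) * (2 * pi / L * cmp k j) * perp k $ i"
  by (simp add: jacobian_nth[OF tsin_derivative] ph_axis)

lemma continuous_jacobian_tcos: "continuous_on S (\<lambda>x. jacobian (tcos L k) (at x))"
proof -
  have "(\<lambda>x. jacobian (tcos L k) (at x)) = (\<lambda>x. \<chi> i j. - sin (ph L k x) * (2 * pi / L * cmp k j) * perp k $ i)"
    by (simp add: fun_eq_iff vec_eq_iff jacobian_tcos)
  then show ?thesis by (simp only:) (intro continuous_intros continuous_ph)
qed

lemma continuous_jacobian_tsin: "continuous_on S (\<lambda>x. jacobian (tsin L k) (at x))"
proof -
  have "(\<lambda>x. jacobian (tsin L k) (at x)) = (\<lambda>x. \<chi> i j. cos (ph L k x) * (2 * pi / L * cmp k j) * perp k $ i)"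
    by (simp add: fun_eq_iff vec_eq_iff jacobian_tsin)
  then show ?thesis by (simp only:) (intro continuous_intros continuous_ph)
qed

lemma trig_poly_tcos: "trig_poly L (tcos L k)"
  unfolding trig_poly_def
  by (intro exI[of _ "{ivec k}"] exI[of _ "\<lambda>_. perp k"] exI[of _ "\<lambda>_. 0"])
    (auto simp: tcos_def phase_ivec)

lemma trig_poly_tsin: "trig_poly L (tsin L k)"
  unfolding trig_poly_def
  by (intro exI[of _ "{ivec k}"] exI[of _ "\<lambda>_. 0"] exI[of _ "\<lambda>_. perp k"])
    (auto simp: tsin_def phase_ivec)

lemma perp_zero: "perp 0 = 0"
  by (simp add: perp_def vec_eq_iff)

lemma cos_sin_ph_integral:
  assumes "L > 0" "k \<noteq> 0"
  shows "(LINT x|Omega_measure L. cos (ph L k x)) = 0" "(LINT x|Omega_measure L. sin (ph L k x)) = 0"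
proof -
  have i: "integrable (Omega_measure L) (\<lambda>x. cis (ph L k x))"
    by (rule integrable_Omega_continuous[OF continuous_cis_ph])
  have "(LINT x|Omega_measure L. cis (ph L k x)) = 0" using cis_ph_integral[OF assms(1)] assms(2) by simp
  then show "(LINT x|Omega_measure L. cos (ph L k x)) = 0" "(LINT x|Omega_measure L. sin (ph L k x)) = 0"
    using integral_Re[OF i] integral_Im[OF i] by simp_all
qed

lemma tcos_test: assumes "L > 0" shows "tcos L k \<in> test_fields L"
proof -
  have "divergence (tcos L k) x = 0" for x
  proof -
    have "divergence (tcos L k) x = (\<Sum>j\<in>UNIV. - sin (ph L k x) * (2 * pi / L) * (cmp k j * perp k $ j))"
      unfolding divergence_def trace_def jacobian_tcos by (simp add: mult_ac)
    also have "\<dots> = 0" by (simp only: sum_distrib_left[symmetric] cmp_perp_orth mult_zero_right)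
    finally show ?thesis .
  qed
  moreover have "(LINT x|Omega_measure L. tcos L k x) = 0"
  proof (cases "k = 0")
    case False
    have "integrable (Omega_measure L) (\<lambda>x. cos (ph L k x))"
      by (intro integrable_Omega_continuous continuous_intros continuous_ph)
    then show ?thesis unfolding tcos_def using cos_sin_ph_integral[OF assms False] by simp
  qed (simp add: tcos_def perp_zero)
  ultimately show ?thesis using trig_poly_tcos by (simp add: test_fields_def)
qed

lemma tsin_test: assumes "L > 0" shows "tsin L k \<in> test_fields L"
proof -
  have "divergence (tsin L k) x = 0" for x
  proof -
    have "divergence (tsin L k) x = (\<Sum>j\<in>UNIV. cos (ph L k x) * (2 * pi / L) * (cmp k j * perp k $ j))"
      unfolding divergence_def trace_def jacobian_tsin by (simp add: mult_ac)
    also have "\<dots> = 0" by (simp only: sum_distrib_left[symmetric] cmp_perp_orth mult_zero_right)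
    finally show ?thesis .
  qed
  moreover have "(LINT x|Omega_measure L. tsin L k x) = 0"
  proof (cases "k = 0")
    case False
    have "integrable (Omega_measure L) (\<lambda>x. sin (ph L k x))"
      by (intro integrable_Omega_continuous continuous_intros continuous_ph)
    then show ?thesis unfolding tsin_def using cos_sin_ph_integral[OF assms False] by simp
  qed (simp add: tsin_def perp_zero)
  ultimately show ?thesis using trig_poly_tsin by (simp add: test_fields_def)
qed

lemma ph_Basis_square: "(\<Sum>e\<in>Basis. (ph L k e)\<^sup>2) = (2 * pi / L)\<^sup>2 * (lnorm k)\<^sup>2"
proof -
  have ne: "axis 1 (1::real) \<noteq> (axis 2 1 :: real^2)" by (simp add: axis_eq_axis)
  have "(\<Sum>e\<in>Basis. (ph L k e)\<^sup>2) = (ph L k (axis 1 1))\<^sup>2 + (ph L k (axis 2 1))\<^sup>2"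
    unfolding Basis_2 using ne by simp
  also have "\<dots> = (2 * pi / L)\<^sup>2 * (lnorm k)\<^sup>2"
    unfolding ph_axis power_mult_distrib lnorm_power2 by (simp add: cmp_def algebra_simps)
  finally show ?thesis .
qed

lemma laplacian_tcos: "laplacian (tcos L k) = (\<lambda>x. (- ((2 * pi / L)\<^sup>2 * (lnorm k)\<^sup>2)) *\<^sub>R tcos L k x)"
proof
  fix x
  have 1: "frechet_derivative (tcos L k) (at y) = (\<lambda>h. (- sin (ph L k y) * ph L k h) *\<^sub>R perp k)" for y
    using frechet_derivative_at[OF tcos_derivative] by simp
  have "((\<lambda>y. (- sin (ph L k y) * ph L k e) *\<^sub>R perp k) has_derivative (\<lambda>h. (- cos (ph L k x) * ph L k h * ph L k e) *\<^sub>R perp k)) (at x)" for e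
    by (auto intro!: derivative_eq_intros ph_derivative)
  from frechet_derivative_at[OF this]
  have 2: "frechet_derivative (\<lambda>y. (- sin (ph L k y) * ph L k e) *\<^sub>R perp k) (at x) e = (- cos (ph L k x) * ph L k e * ph L k e) *\<^sub>R perp k" for e
    by metis
  have "laplacian (tcos L k) x = (\<Sum>e\<in>Basis. (- cos (ph L k x) * (ph L k e)\<^sup>2) *\<^sub>R perp k)"
    unfolding laplacian_def 1 2 by (simp add: power2_eq_square mult.assoc)
  also have "\<dots> = (- cos (ph L k x) * (\<Sum>e\<in>Basis. (ph L k e)\<^sup>2)) *\<^sub>R perp k"
    by (simp only: scaleR_left.sum[symmetric] sum_distrib_left)
  finally show "laplacian (tcos L k) x = (- ((2 * pi / L)\<^sup>2 * (lnorm k)\<^sup>2)) *\<^sub>R tcos L k x"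
    unfolding ph_Basis_square by (simp add: tcos_def mult_ac)
qed

lemma laplacian_tsin: "laplacian (tsin L k) = (\<lambda>x. (- ((2 * pi / L)\<^sup>2 * (lnorm k)\<^sup>2)) *\<^sub>R tsin L k x)"
proof
  fix x
  have 1: "frechet_derivative (tsin L k) (at y) = (\<lambda>h. (cos (ph L k y) * ph L k h) *\<^sub>R perp k)" for y
    using frechet_derivative_at[OF tsin_derivative] by simp
  have "((\<lambda>y. (cos (ph L k y) * ph L k e) *\<^sub>R perp k) has_derivative (\<lambda>h. (- sin (ph L k x) * ph L k h * ph L k e) *\<^sub>R perp k)) (at x)" for e
    by (auto intro!: derivative_eq_intros ph_derivative)
  from frechet_derivative_at[OF this]
  have 2: "frechet_derivative (\<lambda>y. (cos (ph L k y) * ph L k e) *\<^sub>R perp k) (at x) e = (- sin (ph L k x) * ph L k e * ph L k e) *\<^sub>R perp k" for e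
    by metis
  have "laplacian (tsin L k) x = (\<Sum>e\<in>Basis. (- sin (ph L k x) * (ph L k e)\<^sup>2) *\<^sub>R perp k)"
    unfolding laplacian_def 1 2 by (simp add: power2_eq_square mult.assoc)
  also have "\<dots> = (- sin (ph L k x) * (\<Sum>e\<in>Basis. (ph L k e)\<^sup>2)) *\<^sub>R perp k"
    by (simp only: scaleR_left.sum[symmetric] sum_distrib_left)
  finally show "laplacian (tsin L k) x = (- ((2 * pi / L)\<^sup>2 * (lnorm k)\<^sup>2)) *\<^sub>R tsin L k x"
    unfolding ph_Basis_square by (simp add: tsin_def mult_ac)
qed

lemma tpoly_derivative: "(tpoly L F d has_derivative (\<lambda>h. \<Sum>k\<in>F. d k * (\<i> * of_real (ph L k h) * cis (ph L k x)))) (at x)"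
proof -
  have cisd: "((\<lambda>x. cis (ph L k x)) has_derivative (\<lambda>h. \<i> * of_real (ph L k h) * cis (ph L k x))) (at x)" for k
  proof -
    have "((\<lambda>x. \<i> * complex_of_real (ph L k x)) has_derivative (\<lambda>h. \<i> * of_real (ph L k h))) (at x)"
      by (intro has_derivative_mult_right has_derivative_of_real ph_derivative)
    from has_derivative_compose[OF this DERIV_exp[unfolded has_field_derivative_def]]
    show ?thesis by (simp add: cis_conv_exp mult_ac)
  qed
  show ?thesis unfolding tpoly_def[abs_def] by (intro has_derivative_sum has_derivative_mult_right cisd)
qed

text \<open>Representation of a field by a stream function. Coefficients vanish off
  \<open>F\<close>, so index sets can be enlarged freely, and \<open>\<psi> 0 = 0\<close> fixes the
  one coefficient that the field leaves undetermined because \<open>perp 0 = 0\<close>.\<close>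

definition field_rep :: "real \<Rightarrow> (real^2 \<Rightarrow> real^2) \<Rightarrow> (int \<times> int) set \<Rightarrow> (int \<times> int \<Rightarrow> complex) \<Rightarrow> bool" where
  "field_rep L v F \<psi> \<longleftrightarrow> finite F \<and> (\<forall>k. k \<notin> F \<longrightarrow> \<psi> k = 0) \<and> \<psi> 0 = 0 \<and>
     (\<forall>x i. complex_of_real (v x $ i) = tpoly L F (\<lambda>k. \<i> * \<psi> k * of_real (perp k $ i)) x)"

text \<open>Each cosine and sine splits into exponentials at \<open>k\<close> and \<open>-k\<close>,
  so the index set is symmetrised. The contributions \<open>p\<close> and \<open>m\<close> of the
  two halves are added, since \<open>k\<close> and \<open>-k\<close> may both occur in the given
  polynomial.\<close>

lemma trig_poly_rep:
  assumes "trig_poly L v"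
  obtains F c where "finite F" "\<And>x i. complex_of_real (v x $ i) = tpoly L F (\<lambda>k. c k i) x"
    "\<And>x. v differentiable (at x)"
proof -
  obtain K a b where K: "finite K" and v: "v = (\<lambda>x. \<Sum>k\<in>K. cos (phase L k x) *\<^sub>R a k + sin (phase L k x) *\<^sub>R b k)"
    using assms unfolding trig_poly_def by blast
  define F1 where "F1 = pvec ` K"
  define F where "F = F1 \<union> uminus ` F1"
  have fF1: "finite F1" and fF: "finite F" using K by (auto simp: F1_def F_def)
  have inj: "inj_on pvec K" by (auto simp: inj_on_def pvec_def vec_eq_iff forall_2)
  have ip: "ivec (pvec q) = q" for q using two_cases by (auto simp: ivec_def pvec_def vec_eq_iff)
  define p where "p k i = (if k \<in> F1 then (complex_of_real (a (ivec k) $ i) - \<i> * of_real (b (ivec k) $ i)) / 2 else 0)" for k i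
  define m where "m k i = (if - k \<in> F1 then (complex_of_real (a (ivec (- k)) $ i) + \<i> * of_real (b (ivec (- k)) $ i)) / 2 else 0)" for k i
  have "complex_of_real (v x $ i) = tpoly L F (\<lambda>k. p k i + m k i) x" for x i
  proof -
    have "complex_of_real (v x $ i) = (\<Sum>q\<in>K. of_real (cos (phase L q x)) * of_real (a q $ i) + of_real (sin (phase L q x)) * of_real (b q $ i))"
      unfolding v by (simp add: sum_component)
    also have "\<dots> = (\<Sum>k\<in>F1. of_real (cos (ph L k x)) * of_real (a (ivec k) $ i) + of_real (sin (ph L k x)) * of_real (b (ivec k) $ i))"
      unfolding F1_def by (subst sum.reindex[OF inj]) (simp add: phase_pvec ip)
    also have "\<dots> = (\<Sum>k\<in>F1. p k i * cis (ph L k x) + m (- k) i * cis (ph L (- k) x))"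
    proof (rule sum.cong[OF refl])
      fix k assume "k \<in> F1"
      then show "of_real (cos (ph L k x)) * of_real (a (ivec k) $ i) + of_real (sin (ph L k x)) * of_real (b (ivec k) $ i) =
        p k i * cis (ph L k x) + m (- k) i * cis (ph L (- k) x)"
        by (simp add: p_def m_def ph_minus complex_eq_iff field_simps)
    qed
    also have "\<dots> = (\<Sum>k\<in>F1. p k i * cis (ph L k x)) + (\<Sum>k\<in>uminus ` F1. m k i * cis (ph L k x))"
      by (subst sum.reindex) (auto simp: inj_on_def sum.distrib)
    also have "(\<Sum>k\<in>F1. p k i * cis (ph L k x)) = (\<Sum>k\<in>F. p k i * cis (ph L k x))"
      using fF by (intro sum.mono_neutral_left) (auto simp: F_def p_def)
    also have "(\<Sum>k\<in>uminus ` F1. m k i * cis (ph L k x)) = (\<Sum>k\<in>F. m k i * cis (ph L k x))"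
    proof (rule sum.mono_neutral_left[OF fF])
      show "\<forall>k\<in>F - uminus ` F1. m k i * cis (ph L k x) = 0"
      proof
        fix k assume k: "k \<in> F - uminus ` F1"
        have "- k \<notin> F1" using imageI[of "- k" F1 uminus] k by (simp only: minus_minus Diff_iff) blast
        then show "m k i * cis (ph L k x) = 0" by (simp add: m_def)
      qed
    qed (auto simp: F_def)
    finally show ?thesis by (simp add: tpoly_def sum.distrib distrib_right)
  qed
  moreover have "v differentiable (at x)" for x
  proof -
    have "((\<lambda>x. cos (ph L k x) *\<^sub>R w) has_derivative (\<lambda>h. (- sin (ph L k x) * ph L k h) *\<^sub>R w)) (at x)"
      "((\<lambda>x. sin (ph L k x) *\<^sub>R w) has_derivative (\<lambda>h. (cos (ph L k x) * ph L k h) *\<^sub>R w)) (at x)" for k and w :: "real^2"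
      by (auto intro!: derivative_eq_intros ph_derivative)
    then have "(\<lambda>x. cos (ph L k x) *\<^sub>R w) differentiable (at x)" "(\<lambda>x. sin (ph L k x) *\<^sub>R w) differentiable (at x)" for k and w :: "real^2"
      unfolding differentiable_def by blast+
    then show ?thesis unfolding v phase_pvec using K by (intro differentiable_sum differentiable_add) auto
  qed
  ultimately show ?thesis using that[OF fF, of "\<lambda>k i. p k i + m k i"] by blast
qed

lemma tpoly_eq_zero:
  assumes "L > 0" "finite F" "\<And>x. tpoly L F d x = 0" "k \<in> F"
  shows "d k = 0"
  using tpoly_coeff[OF assms(1,2), of d k] assms by simp

lemma derivative_rep:
  assumes F: "\<And>x i. complex_of_real (v x $ i) = tpoly L F (\<lambda>k. c k i) x" and d: "v differentiable (at x)"
  shows "complex_of_real (jacobian v (at x) $ i $ j) = tpoly L F (\<lambda>k. c k i * (\<i> * of_real (2 * pi / L * cmp k j))) x"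
proof -
  obtain D where D: "(v has_derivative D) (at x)" using d unfolding differentiable_def by blast
  have "((\<lambda>x. complex_of_real (v x $ i)) has_derivative (\<lambda>h. complex_of_real (D h $ i))) (at x)"
    by (rule bounded_linear.has_derivative[OF bounded_linear_compose[OF bounded_linear_of_real bounded_linear_vec_nth] D])
  moreover have "((\<lambda>x. complex_of_real (v x $ i)) has_derivative (\<lambda>h. \<Sum>k\<in>F. c k i * (\<i> * of_real (ph L k h) * cis (ph L k x)))) (at x)"
    unfolding F by (rule tpoly_derivative)
  ultimately have "(\<lambda>h. complex_of_real (D h $ i)) = (\<lambda>h. \<Sum>k\<in>F. c k i * (\<i> * of_real (ph L k h) * cis (ph L k x)))"
    by (rule has_derivative_unique)
  then have "complex_of_real (D (axis j 1) $ i) = (\<Sum>k\<in>F. c k i * (\<i> * of_real (ph L k (axis j 1)) * cis (ph L k x)))" by metis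
  then show ?thesis unfolding jacobian_nth[OF D] tpoly_def ph_axis by (simp add: mult_ac)
qed

text \<open>Zero divergence makes each coefficient vector orthogonal to its wave vector, and in the
  plane this means a multiple of \<open>perp k\<close>. At \<open>k = 0\<close> orthogonality is
  void, and the vanishing mean takes its place.\<close>

lemma test_field_rep:
  assumes L: "L > 0" and v: "v \<in> test_fields L"
  obtains F \<psi> where "field_rep L v F \<psi>"
    "\<And>x i j. complex_of_real (jacobian v (at x) $ i $ j) = tpoly L F (\<lambda>k. - of_real (2 * pi / L * cmp k j * perp k $ i) * \<psi> k) x"
proof -
  have tp: "trig_poly L v" and div: "\<And>x. divergence v x = 0" and mean: "(LINT x|Omega_measure L. v x) = 0"
    using v by (auto simp: test_fields_def)
  obtain F c where fF: "finite F" and rep: "\<And>x i. complex_of_real (v x $ i) = tpoly L F (\<lambda>k. c k i) x"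
    and diff: "\<And>x. v differentiable (at x)" using trig_poly_rep[OF tp] by blast
  note drep = derivative_rep[OF rep diff]
  have orth: "(\<Sum>j\<in>UNIV. c k j * of_real (cmp k j)) = 0" if "k \<in> F" for k
  proof -
    have "tpoly L F (\<lambda>k. \<Sum>j\<in>UNIV. c k j * (\<i> * of_real (2 * pi / L * cmp k j))) x = complex_of_real (divergence v x)" for x
    proof -
      have "complex_of_real (divergence v x) = (\<Sum>j\<in>UNIV. tpoly L F (\<lambda>k. c k j * (\<i> * of_real (2 * pi / L * cmp k j))) x)"
        unfolding divergence_def trace_def of_real_sum drep ..
      also have "\<dots> = tpoly L F (\<lambda>k. \<Sum>j\<in>UNIV. c k j * (\<i> * of_real (2 * pi / L * cmp k j))) x"
        unfolding tpoly_def by (subst sum.swap) (simp add: sum_distrib_right)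
      finally show ?thesis ..
    qed
    then have "tpoly L F (\<lambda>k. \<Sum>j\<in>UNIV. c k j * (\<i> * of_real (2 * pi / L * cmp k j))) x = 0" for x
      by (simp only: div of_real_0)
    then have "(\<Sum>j\<in>UNIV. c k j * (\<i> * of_real (2 * pi / L * cmp k j))) = 0"
      using tpoly_eq_zero[OF L fF _ that, where d="\<lambda>k. \<Sum>j\<in>UNIV. c k j * (\<i> * of_real (2 * pi / L * cmp k j))"] by blast
    moreover have "(\<Sum>j\<in>UNIV. c k j * (\<i> * of_real (2 * pi / L * cmp k j))) = (\<i> * of_real (2 * pi / L)) * (\<Sum>j\<in>UNIV. c k j * of_real (cmp k j))"
      by (simp add: sum_2 algebra_simps)
    ultimately show ?thesis using L by simp
  qed
  have c0: "c 0 i = 0" if "0 \<in> F" for i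
  proof -
    have "integrable (Omega_measure L) v" by (rule integrable_Omega_continuous[OF trig_poly_continuous[OF tp]])
    then have "(LINT x|Omega_measure L. v x $ i) = (LINT x|Omega_measure L. v x) $ i"
      by (rule integral_bounded_linear[OF bounded_linear_vec_nth])
    then have "(LINT x|Omega_measure L. complex_of_real (v x $ i)) = 0" using mean by simp
    then have "(LINT x|Omega_measure L. tpoly L F (\<lambda>k. c k i) x * cis (- ph L 0 x)) = 0"
      unfolding rep by (simp add: ph_def)
    then show ?thesis using tpoly_coeff[OF L fF, of "\<lambda>k. c k i" 0] that L by simp
  qed
  \<comment> \<open>The component of the coefficient vector along \<open>perp k\<close>, divided by
    the \<open>\<i>\<close> of \<open>field_rep\<close>.\<close>
  define \<psi> where "\<psi> k = (if k \<in> F then - \<i> * (\<Sum>j\<in>UNIV. c k j * of_real (perp k $ j)) / of_real ((lnorm k)\<^sup>2) else 0)" for k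
  have cpsi: "c k i = \<i> * \<psi> k * of_real (perp k $ i)" if k: "k \<in> F" for k i
  proof (cases "k = 0")
    case True then show ?thesis using c0[of i] k by (simp add: perp_zero)
  next
    case False
    define x y where "x = complex_of_real (of_int (fst k))" and "y = complex_of_real (of_int (snd k))"
    have n: "complex_of_real ((lnorm k)\<^sup>2) = x * x + y * y" unfolding lnorm_power2 by (simp add: x_def y_def power2_eq_square)
    have n0: "x * x + y * y \<noteq> 0" unfolding n[symmetric] using lnorm_pos[OF False] by simp
    have o: "c k 1 * x + c k 2 * y = 0" using orth[OF k] by (simp add: sum_2 cmp_def x_def y_def)
    have "\<i> * \<psi> k = - ((c k 1 * y - c k 2 * x) / (x * x + y * y))"
      unfolding \<psi>_def n using k by (simp add: sum_2 perp_nth x_def y_def)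
    then have ps: "\<i> * \<psi> k = (c k 2 * x - c k 1 * y) / (x * x + y * y)"
      unfolding minus_divide_left minus_diff_eq .
    have "c k 1 * (x * x + y * y) = (c k 2 * x - c k 1 * y) * (- y)" using o by algebra
    moreover have "c k 2 * (x * x + y * y) = (c k 2 * x - c k 1 * y) * x" using o by algebra
    ultimately have "c k 1 = \<i> * \<psi> k * (- y)" "c k 2 = \<i> * \<psi> k * x" unfolding ps using n0 by (simp_all add: field_simps)
    then show ?thesis using two_cases[of i] by (auto simp: perp_nth x_def y_def)
  qed
  have "complex_of_real (v x $ i) = tpoly L F (\<lambda>k. \<i> * \<psi> k * of_real (perp k $ i)) x" for x i
    unfolding rep tpoly_def by (rule sum.cong) (auto simp: cpsi)
  then have "field_rep L v F \<psi>"
    unfolding field_rep_def using fF by (auto simp: \<psi>_def)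
  moreover have "complex_of_real (jacobian v (at x) $ i $ j) = tpoly L F (\<lambda>k. - of_real (2 * pi / L * cmp k j * perp k $ i) * \<psi> k) x" for x i j
    unfolding drep tpoly_def
  proof (rule sum.cong[OF refl])
    fix k assume "k \<in> F"
    have "\<i> * \<psi> k * of_real (perp k $ i) * (\<i> * of_real (2 * pi / L * cmp k j)) = (\<i> * \<i>) * (of_real (2 * pi / L * cmp k j * perp k $ i) * \<psi> k)"
      by (simp only: of_real_mult mult_ac)
    then show "c k i * (\<i> * of_real (2 * pi / L * cmp k j)) * cis (ph L k x) = - of_real (2 * pi / L * cmp k j * perp k $ i) * \<psi> k * cis (ph L k x)"
      unfolding cpsi[OF \<open>k \<in> F\<close>] by simp
  qed
  ultimately show ?thesis using that by blast
qed

text \<open>\<open>cpl \<Phi> L k\<close> is \<open>\<Phi>\<close> extended complex linearly and applied to \<open>exp(- \<i> \<kappa> k\<cdot>x) k\<^sup>\<bottom>\<close>.\<close>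

definition cpl :: "((real^2 \<Rightarrow> real^2) \<Rightarrow> real) \<Rightarrow> real \<Rightarrow> int \<times> int \<Rightarrow> complex" where
  "cpl \<Phi> L k = complex_of_real (\<Phi> (tcos L k)) - \<i> * complex_of_real (\<Phi> (tsin L k))"

text \<open>The prefactor inverts \<open>cpl_field_rep\<close>, so that a test field gets back its
  own coefficients. At \<open>k = 0\<close> the division by zero yields 0, in agreement with
  \<open>field_rep\<close>.\<close>

definition psi :: "real \<Rightarrow> (real^2 \<Rightarrow> real^2) \<Rightarrow> int \<times> int \<Rightarrow> complex" where
  "psi L f k = - \<i> / of_real (L\<^sup>2 * (lnorm k)\<^sup>2) * cpl (L2_inner L f) L k"

lemma continuous_tcos: "continuous_on S (tcos L k)" and continuous_tsin: "continuous_on S (tsin L k)"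
  unfolding tcos_def tsin_def by (intro continuous_intros continuous_ph)+

lemma tcos_L2: "tcos L k \<in> L2_space L" and tsin_L2: "tsin L k \<in> L2_space L"
  by (rule L2_space_continuous, rule continuous_tcos, rule L2_space_continuous, rule continuous_tsin)

lemma complex_integral_cos_sin:
  fixes p q :: "real^2 \<Rightarrow> real"
  assumes "continuous_on UNIV p" "continuous_on UNIV q"
  shows "complex_of_real (LINT x|Omega_measure L. p x) - \<i> * complex_of_real (LINT x|Omega_measure L. q x)
       = (LINT x|Omega_measure L. complex_of_real (p x) - \<i> * complex_of_real (q x))"
proof -
  have "integrable (Omega_measure L) (\<lambda>x. complex_of_real (p x))" "integrable (Omega_measure L) (\<lambda>x. \<i> * complex_of_real (q x))"
    using assms by (auto intro!: integrable_Omega_continuous continuous_intros)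
  then show ?thesis by (simp add: Bochner_Integration.integral_diff)
qed

lemma field_rep_continuous:
  assumes "field_rep L v F \<psi>"
  shows "continuous_on S v"
proof -
  have "v x $ i = Re (tpoly L F (\<lambda>k. \<i> * \<psi> k * of_real (perp k $ i)) x)" for x i
    using assms unfolding field_rep_def by (metis Re_complex_of_real)
  then have "v = (\<lambda>x. \<chi> i. Re (tpoly L F (\<lambda>k. \<i> * \<psi> k * of_real (perp k $ i)) x))"
    by (simp add: fun_eq_iff vec_eq_iff)
  moreover have "continuous_on S (\<lambda>x. (\<chi> i. Re (tpoly L F (\<lambda>k. \<i> * \<psi> k * of_real (perp k $ i)) x)) :: real^2)"
    by (intro continuous_intros continuous_tpoly)
  ultimately show ?thesis by simp
qed

lemma tpoly_sum: "(\<Sum>i\<in>I. tpoly L F (d i) x) = tpoly L F (\<lambda>k. \<Sum>i\<in>I. d i k) x"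
  unfolding tpoly_def by (subst sum.swap) (simp add: sum_distrib_right)

lemma tpoly_cmult: "a * tpoly L F d x = tpoly L F (\<lambda>k. a * d k) x"
  by (simp add: tpoly_def sum_distrib_left mult.assoc)

lemma of_real_dot2: "(\<Sum>i\<in>UNIV. complex_of_real (perp l $ i) * complex_of_real (perp k $ i)) = of_real (dot2 l k)"
  unfolding perp_inner[symmetric] inner_vec_def by simp

lemma cpl_field_rep:
  assumes L: "L > 0" and rep: "field_rep L v F \<psi>"
  shows "cpl (L2_inner L v) L k = \<i> * of_real (L\<^sup>2 * (lnorm k)\<^sup>2) * \<psi> k"
proof -
  have fF: "finite F" and out: "\<And>k. k \<notin> F \<Longrightarrow> \<psi> k = 0"
    and r: "\<And>x i. complex_of_real (v x $ i) = tpoly L F (\<lambda>k. \<i> * \<psi> k * of_real (perp k $ i)) x"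
    using rep unfolding field_rep_def by auto
  have cv: "continuous_on UNIV v" by (rule field_rep_continuous[OF rep])
  have "cpl (L2_inner L v) L k = (LINT x|Omega_measure L. complex_of_real (v x \<bullet> tcos L k x) - \<i> * complex_of_real (v x \<bullet> tsin L k x))"
    unfolding cpl_def L2_inner_def
    by (intro complex_integral_cos_sin continuous_intros cv continuous_tcos continuous_tsin)
  also have "\<dots> = (LINT x|Omega_measure L. tpoly L F (\<lambda>l. \<i> * \<psi> l * of_real (dot2 l k)) x * cis (- ph L k x))"
  proof (rule Bochner_Integration.integral_cong[OF refl])
    fix x
    have "complex_of_real (v x \<bullet> perp k) = (\<Sum>i\<in>UNIV. complex_of_real (perp k $ i) * complex_of_real (v x $ i))"
      by (simp add: inner_vec_def mult.commute)
    also have "\<dots> = tpoly L F (\<lambda>l. \<Sum>i\<in>UNIV. complex_of_real (perp k $ i) * (\<i> * \<psi> l * of_real (perp l $ i))) x"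
      unfolding r tpoly_cmult tpoly_sum ..
    also have "(\<lambda>l. \<Sum>i\<in>UNIV. complex_of_real (perp k $ i) * (\<i> * \<psi> l * of_real (perp l $ i))) = (\<lambda>l. \<i> * \<psi> l * of_real (dot2 l k))"
      unfolding of_real_dot2[symmetric] by (simp add: sum_distrib_left mult_ac)
    finally have "complex_of_real (v x \<bullet> perp k) = tpoly L F (\<lambda>l. \<i> * \<psi> l * of_real (dot2 l k)) x" .
    moreover have "complex_of_real (v x \<bullet> tcos L k x) - \<i> * complex_of_real (v x \<bullet> tsin L k x) = complex_of_real (v x \<bullet> perp k) * cis (- ph L k x)"
      unfolding tcos_def tsin_def by (simp add: complex_eq_iff)
    ultimately show "complex_of_real (v x \<bullet> tcos L k x) - \<i> * complex_of_real (v x \<bullet> tsin L k x) =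
       tpoly L F (\<lambda>l. \<i> * \<psi> l * of_real (dot2 l k)) x * cis (- ph L k x)" by simp
  qed
  also have "\<dots> = \<i> * of_real (L\<^sup>2 * (lnorm k)\<^sup>2) * \<psi> k"
    unfolding tpoly_coeff[OF L fF] using out[of k] by (simp add: dot2_self)
  finally show ?thesis .
qed

lemma psi_field_rep:
  assumes L: "L > 0" and rep: "field_rep L v F \<psi>"
  shows "psi L v k = \<psi> k"
proof (cases "k = 0")
  case True then show ?thesis using rep by (simp add: psi_def field_rep_def)
next
  case False
  have "- \<i> / w * (\<i> * w * p) = p" if "w \<noteq> 0" for w p :: complex
    using that by simp
  moreover have "complex_of_real (L\<^sup>2 * (lnorm k)\<^sup>2) \<noteq> 0" using L lnorm_pos[OF False] by simp
  ultimately show ?thesis unfolding psi_def cpl_field_rep[OF assms] by blast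
qed

lemma field_rep_diff:
  assumes "field_rep L v F \<psi>" "field_rep L w G \<zeta>"
  shows "field_rep L (\<lambda>x. v x - w x) (F \<union> G) (\<lambda>k. \<psi> k - \<zeta> k)"
proof -
  have 1: "finite F" "finite G" "\<And>k. k \<notin> F \<Longrightarrow> \<psi> k = 0" "\<And>k. k \<notin> G \<Longrightarrow> \<zeta> k = 0" "\<psi> 0 = 0" "\<zeta> 0 = 0"
    "\<And>x i. complex_of_real (v x $ i) = tpoly L F (\<lambda>k. \<i> * \<psi> k * of_real (perp k $ i)) x"
    "\<And>x i. complex_of_real (w x $ i) = tpoly L G (\<lambda>k. \<i> * \<zeta> k * of_real (perp k $ i)) x"
    using assms unfolding field_rep_def by auto
  have "tpoly L F (\<lambda>k. \<i> * \<psi> k * of_real (perp k $ i)) x = tpoly L (F \<union> G) (\<lambda>k. \<i> * \<psi> k * of_real (perp k $ i)) x" for x i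
    unfolding tpoly_def using 1(1-3) by (intro sum.mono_neutral_left) auto
  moreover have "tpoly L G (\<lambda>k. \<i> * \<zeta> k * of_real (perp k $ i)) x = tpoly L (F \<union> G) (\<lambda>k. \<i> * \<zeta> k * of_real (perp k $ i)) x" for x i
    unfolding tpoly_def using 1(1,2,4) by (intro sum.mono_neutral_left) auto
  ultimately have "complex_of_real ((v x - w x) $ i) = tpoly L (F \<union> G) (\<lambda>k. \<i> * (\<psi> k - \<zeta> k) * of_real (perp k $ i)) x" for x i
    by (simp add: 1 tpoly_def sum_subtractf[symmetric] algebra_simps)
  then show ?thesis using 1 by (auto simp: field_rep_def)
qed

lemma field_rep_norm:
  assumes L: "L > 0" and rep: "field_rep L v F \<psi>"
  shows "(L2_norm L v)\<^sup>2 = L\<^sup>2 * (\<Sum>k\<in>F. (lnorm k * cmod (\<psi> k))\<^sup>2)"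
proof -
  have fF: "finite F"
    and r: "\<And>x i. complex_of_real (v x $ i) = tpoly L F (\<lambda>k. \<i> * \<psi> k * of_real (perp k $ i)) x"
    using rep unfolding field_rep_def by auto
  have "(norm (v x))\<^sup>2 = (\<Sum>i\<in>UNIV. (cmod (tpoly L F (\<lambda>k. \<i> * \<psi> k * of_real (perp k $ i)) x))\<^sup>2)" for x
    unfolding r[symmetric] power2_norm_eq_inner by (simp add: inner_vec_def inner_complex_def)
  then have "(L2_norm L v)\<^sup>2 = (LINT x|Omega_measure L. (\<Sum>i\<in>UNIV. (cmod (tpoly L F (\<lambda>k. \<i> * \<psi> k * of_real (perp k $ i)) x))\<^sup>2))"
    unfolding L2_norm_power2 by simp
  also have "\<dots> = (\<Sum>i\<in>UNIV. (LINT x|Omega_measure L. (cmod (tpoly L F (\<lambda>k. \<i> * \<psi> k * of_real (perp k $ i)) x))\<^sup>2))"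
    by (intro Bochner_Integration.integral_sum integrable_Omega_continuous continuous_intros continuous_tpoly)
  also have "\<dots> = (\<Sum>i\<in>UNIV. L\<^sup>2 * (\<Sum>k\<in>F. (cmod (\<psi> k))\<^sup>2 * (perp k $ i)\<^sup>2))"
    unfolding tpoly_parseval[OF L fF] by (simp add: norm_mult power_mult_distrib)
  also have "\<dots> = L\<^sup>2 * (\<Sum>k\<in>F. (cmod (\<psi> k))\<^sup>2 * (\<Sum>i\<in>UNIV. (perp k $ i)\<^sup>2))"
    by (simp only: sum_distrib_left[symmetric] sum.swap[of _ F UNIV])
  finally show ?thesis unfolding perp_square_sum by (simp add: power_mult_distrib mult.commute)
qed

lemma field_rep_bessel:
  assumes L: "L > 0" and rep: "field_rep L v F \<psi>" and F': "finite F'"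
  shows "(\<Sum>k\<in>F'. (lnorm k * cmod (\<psi> k))\<^sup>2) \<le> (L2_norm L v)\<^sup>2 / L\<^sup>2"
proof -
  have fF: "finite F" and out: "\<And>k. k \<notin> F \<Longrightarrow> \<psi> k = 0" using rep unfolding field_rep_def by auto
  have "(\<Sum>k\<in>F'. (lnorm k * cmod (\<psi> k))\<^sup>2) = (\<Sum>k\<in>F' \<inter> F. (lnorm k * cmod (\<psi> k))\<^sup>2)"
    using F' out by (intro sum.mono_neutral_right) auto
  also have "\<dots> \<le> (\<Sum>k\<in>F. (lnorm k * cmod (\<psi> k))\<^sup>2)" using fF by (intro sum_mono2) auto
  also have "\<dots> = (L2_norm L v)\<^sup>2 / L\<^sup>2" unfolding field_rep_norm[OF L rep] using L by simp
  finally show ?thesis .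
qed

lemma jacobian_test_continuous:
  fixes v :: "real^2 \<Rightarrow> real^2"
  assumes "\<And>x i j. complex_of_real (jacobian v (at x) $ i $ j) = tpoly L F (\<lambda>k. d k i j) x"
  shows "continuous_on S (\<lambda>x. jacobian v (at x))"
proof -
  have "jacobian v (at x) $ i $ j = Re (tpoly L F (\<lambda>k. d k i j) x)" for x i j
    using assms by (metis Re_complex_of_real)
  then have "(\<lambda>x. jacobian v (at x)) = (\<lambda>x. \<chi> i j. Re (tpoly L F (\<lambda>k. d k i j) x))"
    by (simp add: fun_eq_iff vec_eq_iff)
  moreover have "continuous_on S (\<lambda>x. (\<chi> i j. Re (tpoly L F (\<lambda>k. d k i j) x)) :: real^2^2)"
    by (intro continuous_intros continuous_tpoly)
  ultimately show ?thesis by (simp only:)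
qed

lemma jacobian_norm:
  assumes L: "L > 0" and fF: "finite F"
    and r: "\<And>x i j. complex_of_real (jacobian v (at x) $ i $ j) = tpoly L F (\<lambda>k. - of_real (2 * pi / L * cmp k j * perp k $ i) * \<psi> k) x"
  shows "(L2_norm L (\<lambda>x. jacobian v (at x)))\<^sup>2 = L\<^sup>2 * ((2 * pi / L)\<^sup>2 * (\<Sum>k\<in>F. ((lnorm k)\<^sup>2 * cmod (\<psi> k))\<^sup>2))"
proof -
  let ?d = "\<lambda>i j k. - of_real (2 * pi / L * cmp k j * perp k $ i) * \<psi> k"
  have "(norm (jacobian v (at x)))\<^sup>2 = (\<Sum>i\<in>UNIV. \<Sum>j\<in>UNIV. (cmod (tpoly L F (?d i j) x))\<^sup>2)" for x
    unfolding r[symmetric] power2_norm_eq_inner by (simp add: inner_vec_def inner_complex_def)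
  then have "(L2_norm L (\<lambda>x. jacobian v (at x)))\<^sup>2 = (LINT x|Omega_measure L. (\<Sum>i\<in>UNIV. \<Sum>j\<in>UNIV. (cmod (tpoly L F (?d i j) x))\<^sup>2))"
    unfolding L2_norm_power2 by simp
  also have "\<dots> = (\<Sum>i\<in>UNIV. \<Sum>j\<in>UNIV. (LINT x|Omega_measure L. (cmod (tpoly L F (?d i j) x))\<^sup>2))"
    by (subst Bochner_Integration.integral_sum, intro integrable_Omega_continuous continuous_intros continuous_tpoly)
      (intro sum.cong refl Bochner_Integration.integral_sum integrable_Omega_continuous continuous_intros continuous_tpoly)
  also have "\<dots> = (\<Sum>i\<in>UNIV. \<Sum>j\<in>UNIV. L\<^sup>2 * (\<Sum>k\<in>F. ((2 * pi / L)\<^sup>2 * (cmod (\<psi> k))\<^sup>2) * ((perp k $ i)\<^sup>2 * (cmp k j)\<^sup>2)))"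
  proof (intro sum.cong refl)
    fix i j
    show "(LINT x|Omega_measure L. (cmod (tpoly L F (?d i j) x))\<^sup>2) = L\<^sup>2 * (\<Sum>k\<in>F. ((2 * pi / L)\<^sup>2 * (cmod (\<psi> k))\<^sup>2) * ((perp k $ i)\<^sup>2 * (cmp k j)\<^sup>2))"
      unfolding tpoly_parseval[OF L fF]
      by (intro arg_cong[where f="\<lambda>u. L\<^sup>2 * u"] sum.cong refl)
        (simp only: norm_mult norm_minus_cancel norm_of_real power_mult_distrib power2_abs mult_ac)
  qed
  also have "\<dots> = L\<^sup>2 * (\<Sum>k\<in>F. ((2 * pi / L)\<^sup>2 * (cmod (\<psi> k))\<^sup>2) * ((\<Sum>i\<in>UNIV. (perp k $ i)\<^sup>2) * (\<Sum>j\<in>UNIV. (cmp k j)\<^sup>2)))"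
    by (simp add: sum_2 sum_distrib_left sum.distrib[symmetric] algebra_simps)
  also have "\<dots> = L\<^sup>2 * ((2 * pi / L)\<^sup>2 * (\<Sum>k\<in>F. ((lnorm k)\<^sup>2 * cmod (\<psi> k))\<^sup>2))"
    unfolding perp_square_sum cmp_square_sum sum_distrib_left
    by (intro sum.cong refl) (simp add: power_mult_distrib power2_eq_square mult_ac)
  finally show ?thesis .
qed

text \<open>Contracting two Jacobians pairs the velocity directions and the wave vectors separately;
  each pairing gives \<open>dot2 l k\<close>, hence the square. Orthogonality selects
  \<open>l = k\<close> and leaves \<open>lnorm k ^ 4\<close>.\<close>

lemma cpl_A_test:
  assumes L: "L > 0" and fF: "finite F" and out: "\<And>k. k \<notin> F \<Longrightarrow> \<psi> k = 0"
    and r: "\<And>x i j. complex_of_real (jacobian v (at x) $ i $ j) = tpoly L F (\<lambda>k. - of_real (2 * pi / L * cmp k j * perp k $ i) * \<psi> k) x"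
  shows "cpl (A_pairing L (\<lambda>x. jacobian v (at x))) L k = \<i> * of_real (L\<^sup>2 * (2 * pi / L)\<^sup>2 * (lnorm k) ^ 4) * \<psi> k"
proof -
  define \<kappa> where "\<kappa> = 2 * pi / L"
  let ?J = "\<lambda>x. jacobian v (at x)"
  have cJ: "continuous_on UNIV ?J" by (rule jacobian_test_continuous[OF r])
  have "cpl (A_pairing L ?J) L k = (LINT x|Omega_measure L. complex_of_real (?J x \<bullet> jacobian (tcos L k) (at x)) - \<i> * complex_of_real (?J x \<bullet> jacobian (tsin L k) (at x)))"
    unfolding cpl_def A_pairing_def L2_inner_def
    by (intro complex_integral_cos_sin continuous_on_inner cJ continuous_jacobian_tcos continuous_jacobian_tsin)
  also have "\<dots> = (LINT x|Omega_measure L. tpoly L F (\<lambda>l. (\<i> * of_real (\<kappa>\<^sup>2)) * (of_real ((dot2 l k)\<^sup>2) * \<psi> l)) x * cis (- ph L k x))"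
  proof (rule Bochner_Integration.integral_cong[OF refl])
    fix x
    define S where "S = (\<Sum>i\<in>UNIV. \<Sum>j\<in>UNIV. ?J x $ i $ j * (cmp k j * perp k $ i))"
    have S1: "?J x \<bullet> jacobian (tcos L k) (at x) = - sin (ph L k x) * \<kappa> * S"
      unfolding S_def inner_vec_def jacobian_tcos \<kappa>_def by (simp add: sum_2 algebra_simps)
    have S2: "?J x \<bullet> jacobian (tsin L k) (at x) = cos (ph L k x) * \<kappa> * S"
      unfolding S_def inner_vec_def jacobian_tsin \<kappa>_def by (simp add: sum_2 algebra_simps)
    have "complex_of_real S = (\<Sum>i\<in>UNIV. \<Sum>j\<in>UNIV. complex_of_real (cmp k j * perp k $ i) * complex_of_real (?J x $ i $ j))"
      unfolding S_def by (simp add: mult.commute)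
    also have "\<dots> = tpoly L F (\<lambda>l. \<Sum>i\<in>UNIV. \<Sum>j\<in>UNIV. complex_of_real (cmp k j * perp k $ i) * (- of_real (2 * pi / L * cmp l j * perp l $ i) * \<psi> l)) x"
      unfolding r tpoly_cmult tpoly_sum ..
    also have "(\<lambda>l. \<Sum>i\<in>UNIV. \<Sum>j\<in>UNIV. complex_of_real (cmp k j * perp k $ i) * (- of_real (2 * pi / L * cmp l j * perp l $ i) * \<psi> l))
       = (\<lambda>l. - of_real \<kappa> * (of_real ((dot2 l k)\<^sup>2) * \<psi> l))"
    proof
      fix l
      have "(dot2 l k)\<^sup>2 = (\<Sum>i\<in>UNIV. perp l $ i * perp k $ i) * (\<Sum>j\<in>UNIV. cmp l j * cmp k j)"
        by (simp add: sum_2 perp_nth cmp_def dot2_def power2_eq_square algebra_simps)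
      then have d: "(dot2 l k)\<^sup>2 = (\<Sum>i\<in>UNIV. \<Sum>j\<in>UNIV. (perp l $ i * perp k $ i) * (cmp l j * cmp k j))"
        by (simp only: sum_product)
      show "(\<Sum>i\<in>UNIV. \<Sum>j\<in>UNIV. complex_of_real (cmp k j * perp k $ i) * (- of_real (2 * pi / L * cmp l j * perp l $ i) * \<psi> l)) = - of_real \<kappa> * (of_real ((dot2 l k)\<^sup>2) * \<psi> l)"
        unfolding d \<kappa>_def[symmetric] by (simp add: sum_2 algebra_simps)
    qed
    finally have S3: "complex_of_real S = tpoly L F (\<lambda>l. - of_real \<kappa> * (of_real ((dot2 l k)\<^sup>2) * \<psi> l)) x" .
    have "complex_of_real (?J x \<bullet> jacobian (tcos L k) (at x)) - \<i> * complex_of_real (?J x \<bullet> jacobian (tsin L k) (at x))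
        = (- \<i> * of_real \<kappa>) * complex_of_real S * cis (- ph L k x)"
      unfolding S1 S2 by (simp add: complex_eq_iff)
    also have "(- \<i> * of_real \<kappa>) * complex_of_real S = tpoly L F (\<lambda>l. (\<i> * of_real (\<kappa>\<^sup>2)) * (of_real ((dot2 l k)\<^sup>2) * \<psi> l)) x"
      unfolding S3 tpoly_cmult by (simp add: power2_eq_square mult_ac)
    finally show "complex_of_real (?J x \<bullet> jacobian (tcos L k) (at x)) - \<i> * complex_of_real (?J x \<bullet> jacobian (tsin L k) (at x)) =
      tpoly L F (\<lambda>l. (\<i> * of_real (\<kappa>\<^sup>2)) * (of_real ((dot2 l k)\<^sup>2) * \<psi> l)) x * cis (- ph L k x)" .
  qed
  also have "\<dots> = \<i> * of_real (L\<^sup>2 * \<kappa>\<^sup>2 * (lnorm k) ^ 4) * \<psi> k"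
    unfolding tpoly_coeff[OF L fF] using out[of k]
    by (simp add: dot2_self power_mult[symmetric] mult_ac)
  finally show ?thesis unfolding \<kappa>_def .
qed

text \<open>Only the advecting velocity is expanded into modes \<open>l\<close>. What remains for
  each \<open>l\<close> is a Fourier coefficient of a single polynomial at the frequency
  \<open>k - l\<close>, so \<open>tpoly_coeff\<close> evaluates it directly.\<close>

lemma cpl_B_test:
  assumes L: "L > 0" and rep: "field_rep L v F \<psi>"
    and r: "\<And>x i j. complex_of_real (jacobian v (at x) $ i $ j) = tpoly L F (\<lambda>k. - of_real (2 * pi / L * cmp k j * perp k $ i) * \<psi> k) x"
  shows "cpl (B_pairing L v (\<lambda>x. jacobian v (at x))) L k =
    - \<i> * of_real (2 * pi / L * L\<^sup>2) * (\<Sum>l\<in>F. of_real (cross2 l (k - l) * dot2 (k - l) k) * (\<psi> l * \<psi> (k - l)))"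
proof -
  define \<kappa> where "\<kappa> = 2 * pi / L"
  have fF: "finite F" and out: "\<And>k. k \<notin> F \<Longrightarrow> \<psi> k = 0"
    and rv: "\<And>x i. complex_of_real (v x $ i) = tpoly L F (\<lambda>k. \<i> * \<psi> k * of_real (perp k $ i)) x"
    using rep unfolding field_rep_def by auto
  let ?J = "\<lambda>x. jacobian v (at x)"
  have cJ: "continuous_on UNIV ?J" by (rule jacobian_test_continuous[OF r])
  have cv: "continuous_on UNIV v" by (rule field_rep_continuous[OF rep])
  have ca: "continuous_on UNIV (advection v ?J)"
  proof -
    have "advection v ?J = (\<lambda>x. \<chi> i. \<Sum>j\<in>UNIV. ?J x $ i $ j * v x $ j)"
      by (simp add: fun_eq_iff advection_def matrix_vector_mult_def)
    then show ?thesis by (simp only:) (intro continuous_intros cJ cv)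
  qed
  have "cpl (B_pairing L v ?J) L k = (LINT x|Omega_measure L. complex_of_real (advection v ?J x \<bullet> tcos L k x) - \<i> * complex_of_real (advection v ?J x \<bullet> tsin L k x))"
    unfolding cpl_def B_pairing_def L2_inner_def
    by (intro complex_integral_cos_sin continuous_on_inner ca continuous_tcos continuous_tsin)
  also have "\<dots> = (LINT x|Omega_measure L. (\<Sum>l\<in>F. (\<i> * \<psi> l) * (tpoly L F (\<lambda>m. - of_real \<kappa> * of_real (cross2 l m * dot2 m k) * \<psi> m) x * cis (- ph L (k - l) x))))"
  proof (rule Bochner_Integration.integral_cong[OF refl])
    fix x
    have "complex_of_real (advection v ?J x \<bullet> perp k) = (\<Sum>j\<in>UNIV. complex_of_real (v x $ j) * (\<Sum>i\<in>UNIV. complex_of_real (perp k $ i) * complex_of_real (?J x $ i $ j)))"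
      unfolding advection_def inner_vec_def matrix_vector_mult_def by (simp add: sum_2 algebra_simps)
    also have "\<dots> = (\<Sum>j\<in>UNIV. (\<Sum>l\<in>F. \<i> * \<psi> l * of_real (perp l $ j) * cis (ph L l x)) * tpoly L F (\<lambda>m. \<Sum>i\<in>UNIV. complex_of_real (perp k $ i) * (- of_real (2 * pi / L * cmp m j * perp m $ i) * \<psi> m)) x)"
      unfolding r rv tpoly_cmult tpoly_sum by (simp add: tpoly_def)
    also have "\<dots> = (\<Sum>j\<in>UNIV. \<Sum>l\<in>F. \<i> * \<psi> l * cis (ph L l x) * tpoly L F (\<lambda>m. of_real (perp l $ j) * (\<Sum>i\<in>UNIV. complex_of_real (perp k $ i) * (- of_real (2 * pi / L * cmp m j * perp m $ i) * \<psi> m))) x)"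
      unfolding tpoly_cmult[symmetric] by (simp add: sum_distrib_right mult_ac)
    also have "\<dots> = (\<Sum>l\<in>F. \<i> * \<psi> l * cis (ph L l x) * (\<Sum>j\<in>UNIV. tpoly L F (\<lambda>m. of_real (perp l $ j) * (\<Sum>i\<in>UNIV. complex_of_real (perp k $ i) * (- of_real (2 * pi / L * cmp m j * perp m $ i) * \<psi> m))) x))"
      by (subst sum.swap) (simp only: sum_distrib_left)
    also have "\<dots> = (\<Sum>l\<in>F. \<i> * \<psi> l * cis (ph L l x) * tpoly L F (\<lambda>m. - of_real \<kappa> * of_real (cross2 l m * dot2 m k) * \<psi> m) x)"
    proof -
      have "(\<Sum>j\<in>UNIV. of_real (perp l $ j) * (\<Sum>i\<in>UNIV. complex_of_real (perp k $ i) * (- of_real (2 * pi / L * cmp m j * perp m $ i) * \<psi> m))) = - of_real \<kappa> * of_real (cross2 l m * dot2 m k) * \<psi> m" for l m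
      proof -
        have "cross2 l m * dot2 m k = (\<Sum>j\<in>UNIV. \<Sum>i\<in>UNIV. (cmp m j * perp l $ j) * (perp m $ i * perp k $ i))"
          unfolding cmp_sum[symmetric] perp_inner[symmetric] inner_vec_def by (simp add: sum_product)
        then show ?thesis unfolding \<kappa>_def[symmetric] by (simp add: sum_2 algebra_simps)
      qed
      then show ?thesis unfolding tpoly_sum by simp
    qed
    finally have A: "complex_of_real (advection v ?J x \<bullet> perp k) = (\<Sum>l\<in>F. \<i> * \<psi> l * cis (ph L l x) * tpoly L F (\<lambda>m. - of_real \<kappa> * of_real (cross2 l m * dot2 m k) * \<psi> m) x)" .
    have "complex_of_real (advection v ?J x \<bullet> tcos L k x) - \<i> * complex_of_real (advection v ?J x \<bullet> tsin L k x) = complex_of_real (advection v ?J x \<bullet> perp k) * cis (- ph L k x)"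
      unfolding tcos_def tsin_def by (simp add: complex_eq_iff)
    also have "\<dots> = (\<Sum>l\<in>F. (\<i> * \<psi> l) * (tpoly L F (\<lambda>m. - of_real \<kappa> * of_real (cross2 l m * dot2 m k) * \<psi> m) x * (cis (ph L l x) * cis (- ph L k x))))"
    proof -
      have "p * a * q * b = p * (q * (a * b))" for p a q b :: complex by (simp add: mult_ac)
      then show ?thesis unfolding A sum_distrib_right by (intro sum.cong refl)
    qed
    also have "\<dots> = (\<Sum>l\<in>F. (\<i> * \<psi> l) * (tpoly L F (\<lambda>m. - of_real \<kappa> * of_real (cross2 l m * dot2 m k) * \<psi> m) x * cis (- ph L (k - l) x)))"
    proof -
      have "cis (ph L l x) * cis (- ph L k x) = cis (- ph L (k - l) x)" for l
        using ph_add[of L "k - l" l x] by (simp add: cis_mult)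
      then show ?thesis by simp
    qed
    finally show "complex_of_real (advection v ?J x \<bullet> tcos L k x) - \<i> * complex_of_real (advection v ?J x \<bullet> tsin L k x) = (\<Sum>l\<in>F. (\<i> * \<psi> l) * (tpoly L F (\<lambda>m. - of_real \<kappa> * of_real (cross2 l m * dot2 m k) * \<psi> m) x * cis (- ph L (k - l) x)))" .
  qed
  also have "\<dots> = (\<Sum>l\<in>F. (\<i> * \<psi> l) * (LINT x|Omega_measure L. tpoly L F (\<lambda>m. - of_real \<kappa> * of_real (cross2 l m * dot2 m k) * \<psi> m) x * cis (- ph L (k - l) x)))"
    by (subst Bochner_Integration.integral_sum)
      (auto intro!: integrable_Omega_continuous continuous_intros continuous_tpoly continuous_ph)
  also have "\<dots> = (\<Sum>l\<in>F. - \<i> * of_real (\<kappa> * L\<^sup>2) * (of_real (cross2 l (k - l) * dot2 (k - l) k) * (\<psi> l * \<psi> (k - l))))"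
    unfolding tpoly_coeff[OF L fF] using out by (intro sum.cong refl) (auto simp: mult_ac)
  finally show ?thesis unfolding sum_distrib_left \<kappa>_def .
qed

section \<open>Passage to weak solutions\<close>

lemma L2_inner_tendsto:
  assumes "\<And>n. f n \<in> L2_space L" "f0 \<in> L2_space L" "h \<in> L2_space L"
    and "(\<lambda>n. L2_norm L (\<lambda>x. f0 x - f n x)) \<longlonglongrightarrow> 0"
  shows "(\<lambda>n. L2_inner L (f n) h) \<longlonglongrightarrow> L2_inner L f0 h"
proof -
  have "(\<lambda>n. L2_inner L f0 h - L2_inner L (f n) h) \<longlonglongrightarrow> 0"
  proof (rule Lim_null_comparison)
    have "norm (L2_inner L f0 h - L2_inner L (f n) h) \<le> L2_norm L (\<lambda>x. f0 x - f n x) * L2_norm L h" for n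
      using L2_Cauchy_Schwarz[OF L2_space_diff[OF assms(2) assms(1)] assms(3), of n] L2_inner_diff_left[OF assms(2) assms(1) assms(3), of n]
      by simp
    then show "\<forall>\<^sub>F n in sequentially. norm (L2_inner L f0 h - L2_inner L (f n) h) \<le> L2_norm L (\<lambda>x. f0 x - f n x) * L2_norm L h"
      by simp
    show "(\<lambda>n. L2_norm L (\<lambda>x. f0 x - f n x) * L2_norm L h) \<longlonglongrightarrow> 0"
      using tendsto_mult_left_zero[OF assms(4)] .
  qed
  from tendsto_diff[OF tendsto_const[of "L2_inner L f0 h"] this] show ?thesis by simp
qed

lemma L2_norm_tendsto:
  assumes "\<And>n. f n \<in> L2_space L" "f0 \<in> L2_space L"
    and "(\<lambda>n. L2_norm L (\<lambda>x. f0 x - f n x)) \<longlonglongrightarrow> 0"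
  shows "(\<lambda>n. L2_norm L (f n)) \<longlonglongrightarrow> L2_norm L f0"
proof -
  have "(\<lambda>n. L2_norm L f0 - L2_norm L (f n)) \<longlonglongrightarrow> 0"
  proof (rule Lim_null_comparison[OF always_eventually assms(3)], rule allI)
    fix n
    show "norm (L2_norm L f0 - L2_norm L (f n)) \<le> L2_norm L (\<lambda>x. f0 x - f n x)"
      using L2_norm_triangle[OF assms(2) assms(1), of n] L2_norm_triangle[OF assms(1) assms(2), of n] L2_norm_minus[of L f0 "f n"]
      by simp
  qed
  from tendsto_diff[OF tendsto_const[of "L2_norm L f0"] this] show ?thesis by simp
qed

lemma psi_tendsto:
  assumes "\<And>n. f n \<in> L2_space L" "f0 \<in> L2_space L"
    and "(\<lambda>n. L2_norm L (\<lambda>x. f0 x - f n x)) \<longlonglongrightarrow> 0"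
  shows "(\<lambda>n. psi L (f n) k) \<longlonglongrightarrow> psi L f0 k"
  unfolding psi_def cpl_def
  by (intro tendsto_intros L2_inner_tendsto assms tcos_L2 tsin_L2)

lemma test_L2: "v \<in> test_fields L \<Longrightarrow> v \<in> L2_space L"
  using test_fields_subset_H by (auto simp: H_space_def)

lemma H_L2: "u \<in> H_space L \<Longrightarrow> u \<in> L2_space L"
  by (simp add: H_space_def)

lemma tendsto_inverse_Suc:
  fixes f :: "nat \<Rightarrow> real"
  assumes "\<And>n. 0 \<le> f n" "\<And>n. f n < inverse (real (Suc n))"
  shows "f \<longlonglongrightarrow> 0"
  by (rule tendsto_sandwich[OF always_eventually[OF allI[OF assms(1)]]
        always_eventually[OF allI[OF less_imp_le[OF assms(2)]]] tendsto_const LIMSEQ_inverse_real_of_nat])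

lemma H_approx:
  assumes "u \<in> H_space L"
  obtains w where "\<And>n::nat. w n \<in> test_fields L" "(\<lambda>n. L2_norm L (\<lambda>x. u x - w n x)) \<longlonglongrightarrow> 0"
proof -
  have "\<exists>v\<in>test_fields L. L2_norm L (\<lambda>x. u x - v x) < inverse (real (Suc n))" for n
    using assms unfolding H_space_def by auto
  then obtain w where w: "\<And>n. w n \<in> test_fields L" "\<And>n. L2_norm L (\<lambda>x. u x - w n x) < inverse (real (Suc n))"
    by metis
  show ?thesis by (rule that[OF w(1)]) (rule tendsto_inverse_Suc[OF L2_norm_nonneg w(2)])
qed

text \<open>For two test fields this follows from Parseval for their difference; \<open>u\<close> is
  reached by approximation. With \<open>v = 0\<close> it is Bessel's inequality, and with
  approximants of \<open>u\<close> it gives the continuity of the convolution in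
  \<open>triad_sum_tendsto\<close>.\<close>

lemma bessel_diff:
  assumes L: "L > 0" and u: "u \<in> H_space L" and v: "v \<in> test_fields L" and F: "finite F"
  shows "(\<Sum>k\<in>F. (lnorm k * cmod (psi L u k - psi L v k))\<^sup>2) \<le> (L2_norm L (\<lambda>x. u x - v x))\<^sup>2 / L\<^sup>2"
proof -
  obtain w where w: "\<And>n::nat. w n \<in> test_fields L" "(\<lambda>n. L2_norm L (\<lambda>x. u x - w n x)) \<longlonglongrightarrow> 0"
    using H_approx[OF u] by blast
  have wl: "w n \<in> L2_space L" for n by (rule test_L2[OF w(1)])
  have ul: "u \<in> L2_space L" and vl: "v \<in> L2_space L" using H_L2[OF u] test_L2[OF v] by auto
  have "(\<Sum>k\<in>F. (lnorm k * cmod (psi L (w n) k - psi L v k))\<^sup>2) \<le> (L2_norm L (\<lambda>x. w n x - v x))\<^sup>2 / L\<^sup>2" for n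
  proof -
    obtain F1 p1 where r1: "field_rep L (w n) F1 p1" using test_field_rep[OF L w(1)] by metis
    obtain F2 p2 where r2: "field_rep L v F2 p2" using test_field_rep[OF L v] by metis
    show ?thesis
      unfolding psi_field_rep[OF L r1] psi_field_rep[OF L r2]
      by (rule field_rep_bessel[OF L field_rep_diff[OF r1 r2] F])
  qed
  moreover have "(\<lambda>n. \<Sum>k\<in>F. (lnorm k * cmod (psi L (w n) k - psi L v k))\<^sup>2) \<longlonglongrightarrow> (\<Sum>k\<in>F. (lnorm k * cmod (psi L u k - psi L v k))\<^sup>2)"
    by (intro tendsto_intros psi_tendsto wl ul w(2))
  moreover have "(\<lambda>n. L2_norm L (\<lambda>x. w n x - v x)) \<longlonglongrightarrow> L2_norm L (\<lambda>x. u x - v x)"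
    by (rule L2_norm_tendsto) (use wl ul vl w(2) in \<open>auto intro: L2_space_diff\<close>)
  then have "(\<lambda>n. (L2_norm L (\<lambda>x. w n x - v x))\<^sup>2 / L\<^sup>2) \<longlonglongrightarrow> (L2_norm L (\<lambda>x. u x - v x))\<^sup>2 / L\<^sup>2"
    using L by (intro tendsto_intros) auto
  ultimately show ?thesis by (intro LIMSEQ_le) auto
qed

lemma zero_field_rep: "field_rep L (\<lambda>x. 0) {} (\<lambda>_. 0)"
  by (simp add: field_rep_def tpoly_def)

lemma zero_test: "(\<lambda>x. 0) \<in> test_fields L"
proof -
  have "trig_poly L (\<lambda>x. 0)" unfolding trig_poly_def by (rule exI[of _ "{}"]) auto
  moreover have "divergence (\<lambda>x. 0) x = 0" for x
    unfolding divergence_def trace_def by (simp add: jacobian_nth[OF has_derivative_const])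
  ultimately show ?thesis by (simp add: test_fields_def)
qed

lemma bessel:
  assumes L: "L > 0" and u: "u \<in> H_space L" and F: "finite F"
  shows "(\<Sum>k\<in>F. (lnorm k * cmod (psi L u k))\<^sup>2) \<le> (L2_norm L u)\<^sup>2 / L\<^sup>2"
  using bessel_diff[OF L u zero_test F] by (simp add: psi_field_rep[OF L zero_field_rep])

text \<open>The tensor product of a test field and a velocity. By \<open>B_pairing_outer\<close> it
  rewrites the advection pairing as an inner product against \<open>G\<close>, so that both
  arguments are square integrable although the advection term itself need not be.\<close>

definition outer :: "(real^2 \<Rightarrow> real^2) \<Rightarrow> (real^2 \<Rightarrow> real^2) \<Rightarrow> real^2 \<Rightarrow> real^2^2" where
  "outer \<phi> w x = (\<chi> i. (\<phi> x $ i) *\<^sub>R w x)"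

lemma B_pairing_outer: "B_pairing L u G \<phi> = L2_inner L G (outer \<phi> u)"
  unfolding B_pairing_def L2_inner_def
  by (intro Bochner_Integration.integral_cong refl)
    (simp add: advection_def outer_def inner_vec_def matrix_vector_mult_def sum_2 algebra_simps)

lemma norm_outer: "norm (outer \<phi> w x) = norm (\<phi> x) * norm (w x)"
proof -
  have "(norm (outer \<phi> w x))\<^sup>2 = (norm (\<phi> x) * norm (w x))\<^sup>2"
    unfolding power_mult_distrib power2_norm_eq_inner
    by (simp add: outer_def inner_vec_def sum_2 algebra_simps)
  then show ?thesis by (metis norm_ge_zero power2_eq_iff_nonneg zero_le_mult_iff)
qed

lemma outer_L2:
  assumes "\<phi> \<in> L2_space L" "w \<in> L2_space L" "\<And>x. norm (\<phi> x) \<le> C"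
  shows "outer \<phi> w \<in> L2_space L"
proof (rule L2_space_dominated[OF _ assms(2)])
  have "(\<lambda>x. (\<lambda>a b. (\<chi> i. (a $ i) *\<^sub>R b) :: real^2^2) (\<phi> x) (w x)) \<in> borel_measurable (Omega_measure L)"
    by (rule borel_measurable_continuous_Pair[OF L2_space_measurable[OF assms(1)] L2_space_measurable[OF assms(2)]])
      (intro continuous_intros)
  then show "outer \<phi> w \<in> borel_measurable (Omega_measure L)" unfolding outer_def[abs_def] .
  show "norm (outer \<phi> w x) \<le> C * norm (w x)" for x
    unfolding norm_outer using assms(3) by (intro mult_right_mono) auto
qed

lemma outer_norm_le:
  assumes "\<phi> \<in> L2_space L" "w \<in> L2_space L" "\<And>x. norm (\<phi> x) \<le> C" "C \<ge> 0"
  shows "L2_norm L (outer \<phi> w) \<le> C * L2_norm L w"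
proof -
  have "(L2_norm L (outer \<phi> w))\<^sup>2 \<le> (LINT x|Omega_measure L. C\<^sup>2 * (norm (w x))\<^sup>2)"
    unfolding L2_norm_power2
  proof (rule integral_mono)
    show "integrable (Omega_measure L) (\<lambda>x. (norm (outer \<phi> w x))\<^sup>2)"
      by (rule L2_space_integrable[OF outer_L2[OF assms(1-3)]])
    show "integrable (Omega_measure L) (\<lambda>x. C\<^sup>2 * (norm (w x))\<^sup>2)" using L2_space_integrable[OF assms(2)] by simp
    show "(norm (outer \<phi> w x))\<^sup>2 \<le> C\<^sup>2 * (norm (w x))\<^sup>2" for x
      unfolding norm_outer power_mult_distrib using assms(3) by (intro mult_right_mono power_mono) auto
  qed
  also have "\<dots> = (C * L2_norm L w)\<^sup>2" by (simp add: power_mult_distrib L2_norm_power2)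
  finally have "(L2_norm L (outer \<phi> w))\<^sup>2 \<le> (C * L2_norm L w)\<^sup>2" .
  then show ?thesis by (rule power2_le_imp_le) (rule mult_nonneg_nonneg[OF assms(4) L2_norm_nonneg])
qed

text \<open>The difference splits into a change of \<open>G\<close> and a change of
  \<open>u\<close>; boundedness of \<open>\<phi>\<close> makes \<open>outer \<phi>\<close>
  continuous in the square-integrable norm.\<close>

lemma B_pairing_tendsto:
  assumes v: "\<And>n. v n \<in> L2_space L" and u: "u \<in> L2_space L" and J: "\<And>n. J n \<in> L2_space L" and G: "G \<in> L2_space L"
    and vu: "(\<lambda>n. L2_norm L (\<lambda>x. u x - v n x)) \<longlonglongrightarrow> 0" and JG: "(\<lambda>n. L2_norm L (\<lambda>x. G x - J n x)) \<longlonglongrightarrow> 0"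
    and \<phi>: "\<phi> \<in> L2_space L" "\<And>x. norm (\<phi> x) \<le> C" "C \<ge> 0"
  shows "(\<lambda>n. B_pairing L (v n) (J n) \<phi>) \<longlonglongrightarrow> B_pairing L u G \<phi>"
proof -
  note ou = outer_L2[OF \<phi>(1) u \<phi>(2)] and ov = outer_L2[OF \<phi>(1) v \<phi>(2)]
  note od = outer_L2[OF \<phi>(1) L2_space_diff[OF u v] \<phi>(2)]
  have bd: "norm (B_pairing L u G \<phi> - B_pairing L (v n) (J n) \<phi>) \<le> L2_norm L (\<lambda>x. G x - J n x) * L2_norm L (outer \<phi> u) + L2_norm L (J n) * (C * L2_norm L (\<lambda>x. u x - v n x))" for n
  proof -
    have "B_pairing L u G \<phi> - B_pairing L (v n) (J n) \<phi> = L2_inner L (\<lambda>x. G x - J n x) (outer \<phi> u) + L2_inner L (J n) (\<lambda>x. outer \<phi> u x - outer \<phi> (v n) x)"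
      unfolding B_pairing_outer L2_inner_diff_left[OF G J ou] L2_inner_diff_right[OF ou ov J] by simp
    also have "(\<lambda>x. outer \<phi> u x - outer \<phi> (v n) x) = outer \<phi> (\<lambda>x. u x - v n x)"
      by (simp add: fun_eq_iff outer_def vec_eq_iff algebra_simps)
    finally have "norm (B_pairing L u G \<phi> - B_pairing L (v n) (J n) \<phi>) \<le> \<bar>L2_inner L (\<lambda>x. G x - J n x) (outer \<phi> u)\<bar> + \<bar>L2_inner L (J n) (outer \<phi> (\<lambda>x. u x - v n x))\<bar>"
      by simp
    also have "\<bar>L2_inner L (\<lambda>x. G x - J n x) (outer \<phi> u)\<bar> \<le> L2_norm L (\<lambda>x. G x - J n x) * L2_norm L (outer \<phi> u)"
      by (rule L2_Cauchy_Schwarz[OF L2_space_diff[OF G J] ou])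
    also have "\<bar>L2_inner L (J n) (outer \<phi> (\<lambda>x. u x - v n x))\<bar> \<le> L2_norm L (J n) * L2_norm L (outer \<phi> (\<lambda>x. u x - v n x))"
      by (rule L2_Cauchy_Schwarz[OF J od])
    also have "\<dots> \<le> L2_norm L (J n) * (C * L2_norm L (\<lambda>x. u x - v n x))"
      by (intro mult_left_mono outer_norm_le[OF \<phi>(1) L2_space_diff[OF u v] \<phi>(2,3)]) simp
    finally show ?thesis by simp
  qed
  have "(\<lambda>n. L2_norm L (\<lambda>x. G x - J n x) * L2_norm L (outer \<phi> u) + L2_norm L (J n) * (C * L2_norm L (\<lambda>x. u x - v n x)))
      \<longlonglongrightarrow> 0 * L2_norm L (outer \<phi> u) + L2_norm L G * (C * 0)"
    by (intro tendsto_intros JG vu L2_norm_tendsto[OF J G JG])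
  then have "(\<lambda>n. B_pairing L u G \<phi> - B_pairing L (v n) (J n) \<phi>) \<longlonglongrightarrow> 0"
    by (intro Lim_null_comparison[OF always_eventually[OF allI[OF bd]]]) simp
  from tendsto_diff[OF tendsto_const[of "B_pairing L u G \<phi>"] this] show ?thesis by simp
qed

lemma norm_tcos_le: "norm (tcos L k x) \<le> lnorm k" and norm_tsin_le: "norm (tsin L k x) \<le> lnorm k"
  unfolding tcos_def tsin_def by (simp_all add: norm_perp mult_left_le_one_le)

lemma jacobian_tcos_L2: "(\<lambda>x. jacobian (tcos L k) (at x)) \<in> L2_space L"
  by (rule L2_space_continuous[OF continuous_jacobian_tcos])

lemma jacobian_tsin_L2: "(\<lambda>x. jacobian (tsin L k) (at x)) \<in> L2_space L"
  by (rule L2_space_continuous[OF continuous_jacobian_tsin])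

lemma triad_convolution_bound:
  assumes a: "\<And>F. finite F \<Longrightarrow> (\<Sum>k\<in>F. (lnorm k * cmod (a k))\<^sup>2) \<le> A\<^sup>2" and b: "\<And>F. finite F \<Longrightarrow> (\<Sum>k\<in>F. (lnorm k * cmod (b k))\<^sup>2) \<le> B\<^sup>2"
    and AB: "A \<ge> 0" "B \<ge> 0"
  shows "(\<lambda>l. triad l (k - l) *\<^sub>R (a l * b (k - l))) summable_on UNIV"
    and "norm (\<Sum>\<^sub>\<infinity>l. triad l (k - l) *\<^sub>R (a l * b (k - l))) \<le> A * B"
proof -
  note cs = convolution_summable[of "\<lambda>k. lnorm k * cmod (a k)" "\<lambda>k. lnorm k * cmod (b k)", OF _ _ a b]
  have t: "norm (triad l (k - l) *\<^sub>R (a l * b (k - l))) \<le> (lnorm l * cmod (a l)) * (lnorm (k - l) * cmod (b (k - l)))" for l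
  proof -
    have "\<bar>triad l (k - l)\<bar> * (cmod (a l) * cmod (b (k - l))) \<le> (lnorm l * lnorm (k - l)) * (cmod (a l) * cmod (b (k - l)))"
      by (intro mult_right_mono triad_le) auto
    then show ?thesis by (simp add: norm_mult mult_ac)
  qed
  have s: "(\<lambda>l. (lnorm l * cmod (a l)) * (lnorm (k - l) * cmod (b (k - l)))) summable_on UNIV"
    by (rule cs(2)) auto
  have abs: "(\<lambda>l. norm (triad l (k - l) *\<^sub>R (a l * b (k - l)))) summable_on UNIV"
    by (rule summable_on_comparison_test[OF s]) (use t in auto)
  then show "(\<lambda>l. triad l (k - l) *\<^sub>R (a l * b (k - l))) summable_on UNIV" by (rule abs_summable_summable)
  have "norm (\<Sum>\<^sub>\<infinity>l. triad l (k - l) *\<^sub>R (a l * b (k - l))) \<le> (\<Sum>\<^sub>\<infinity>l. norm (triad l (k - l) *\<^sub>R (a l * b (k - l))))"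
    by (rule norm_infsum_bound[OF abs])
  also have "\<dots> \<le> (\<Sum>\<^sub>\<infinity>l. (lnorm l * cmod (a l)) * (lnorm (k - l) * cmod (b (k - l))))"
    by (rule infsum_mono[OF abs s t])
  also have "\<dots> \<le> sqrt (A\<^sup>2) * sqrt (B\<^sup>2)" by (rule cs(3)) auto
  finally show "norm (\<Sum>\<^sub>\<infinity>l. triad l (k - l) *\<^sub>R (a l * b (k - l))) \<le> A * B" using AB by simp
qed

text \<open>Continuity of a bounded quadratic map: with \<open>d = a - b\<close> the difference of
  the two sums is the mixed term of \<open>d\<close> and \<open>a\<close> plus that of
  \<open>b\<close> and \<open>d\<close>, and \<open>triad_convolution_bound\<close> estimates
  each.\<close>

lemma triad_sum_tendsto:
  assumes L: "L > 0" and u: "u \<in> H_space L" and v: "\<And>n::nat. v n \<in> test_fields L"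
    and vu: "(\<lambda>n. L2_norm L (\<lambda>x. u x - v n x)) \<longlonglongrightarrow> 0"
  shows "(\<lambda>n. \<Sum>\<^sub>\<infinity>l. triad l (k - l) *\<^sub>R (psi L (v n) l * psi L (v n) (k - l)))
      \<longlonglongrightarrow> (\<Sum>\<^sub>\<infinity>l. triad l (k - l) *\<^sub>R (psi L u l * psi L u (k - l)))"
proof -
  define a where "a = psi L u"
  define b where "b n = psi L (v n)" for n
  define d where "d n l = a l - b n l" for n l
  define D where "D n = L2_norm L (\<lambda>x. u x - v n x) / L" for n
  define A where "A = L2_norm L u / L"
  define B where "B n = L2_norm L (v n) / L" for n
  have nn: "D n \<ge> 0" "A \<ge> 0" "B n \<ge> 0" for n using L by (auto simp: D_def A_def B_def)
  have bd: "(\<Sum>k\<in>F. (lnorm k * cmod (d n k))\<^sup>2) \<le> (D n)\<^sup>2" if "finite F" for F n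
    unfolding d_def a_def b_def D_def power_divide by (rule bessel_diff[OF L u v that])
  have ba: "(\<Sum>k\<in>F. (lnorm k * cmod (a k))\<^sup>2) \<le> A\<^sup>2" if "finite F" for F
    unfolding a_def A_def power_divide by (rule bessel[OF L u that])
  have bb: "(\<Sum>k\<in>F. (lnorm k * cmod (b n k))\<^sup>2) \<le> (B n)\<^sup>2" if "finite F" for F n
    unfolding b_def B_def power_divide by (rule bessel[OF L subsetD[OF test_fields_subset_H v] that])
  let ?T = "\<lambda>p q. \<Sum>\<^sub>\<infinity>l. triad l (k - l) *\<^sub>R (p l * q (k - l))"
  have N1: "norm (?T a a - ?T (b n) (b n)) \<le> D n * A + B n * D n" for n
  proof -
    note s1 = triad_convolution_bound[where a="d n" and b=a and k=k, OF bd ba nn(1) nn(2)]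
    note s2 = triad_convolution_bound[where a="b n" and b="d n" and k=k, OF bb bd nn(3) nn(1)]
    note s3 = triad_convolution_bound(1)[where a="b n" and b="b n" and k=k, OF bb bb nn(3) nn(3)]
    have "?T a a = (\<Sum>\<^sub>\<infinity>l. (triad l (k - l) *\<^sub>R (d n l * a (k - l)) + triad l (k - l) *\<^sub>R (b n l * d n (k - l))) + triad l (k - l) *\<^sub>R (b n l * b n (k - l)))"
      by (rule infsum_cong) (simp add: d_def algebra_simps scaleR_conv_of_real)
    also have "\<dots> = (?T (d n) a + ?T (b n) (d n)) + ?T (b n) (b n)"
      by (simp only: infsum_add[OF summable_on_add[OF s1(1) s2(1)] s3] infsum_add[OF s1(1) s2(1)])
    finally have "?T a a - ?T (b n) (b n) = ?T (d n) a + ?T (b n) (d n)" by simp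
    then show ?thesis using norm_triangle_mono[OF s1(2) s2(2)] by simp
  qed
  have "(\<lambda>n. D n * A + B n * D n) \<longlonglongrightarrow> 0 * A + (L2_norm L u / L) * 0"
  proof -
    have D0: "D \<longlonglongrightarrow> 0" unfolding D_def[abs_def] using tendsto_divide_zero[OF vu] .
    have "B \<longlonglongrightarrow> L2_norm L u / L" unfolding B_def[abs_def]
      using L by (intro tendsto_divide L2_norm_tendsto[OF test_L2[OF v] H_L2[OF u] vu] tendsto_const) auto
    then show ?thesis by (intro tendsto_intros D0)
  qed
  then have N2: "(\<lambda>n. D n * A + B n * D n) \<longlonglongrightarrow> 0" by simp
  have "(\<lambda>n. ?T a a - ?T (b n) (b n)) \<longlonglongrightarrow> 0"
    by (rule Lim_null_comparison[OF always_eventually[OF allI[OF N1]] N2])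
  from tendsto_diff[OF tendsto_const[of "?T a a"] this] show ?thesis by (simp add: a_def b_def)
qed

lemma has_gradient_H: "has_gradient L u G \<Longrightarrow> u \<in> H_space L"
  unfolding has_gradient_def H_space_def by blast

lemma gradient_approx:
  assumes "has_gradient L u G"
  obtains v where "\<And>n::nat. v n \<in> test_fields L" "(\<lambda>n. L2_norm L (\<lambda>x. u x - v n x)) \<longlonglongrightarrow> 0"
    "(\<lambda>n. L2_norm L (\<lambda>x. G x - jacobian (v n) (at x))) \<longlonglongrightarrow> 0"
proof -
  have "\<forall>n. \<exists>v. v \<in> test_fields L \<and> L2_norm L (\<lambda>x. u x - v x) < inverse (real (Suc n))
      \<and> L2_norm L (\<lambda>x. G x - jacobian v (at x)) < inverse (real (Suc n))"
  proof
    fix n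
    have "inverse (real (Suc n)) > 0" by simp
    then show "\<exists>v. v \<in> test_fields L \<and> L2_norm L (\<lambda>x. u x - v x) < inverse (real (Suc n))
      \<and> L2_norm L (\<lambda>x. G x - jacobian v (at x)) < inverse (real (Suc n))"
      using assms unfolding has_gradient_def by blast
  qed
  from choice[OF this] obtain v where v': "\<forall>n. v n \<in> test_fields L \<and> L2_norm L (\<lambda>x. u x - v n x) < inverse (real (Suc n))
      \<and> L2_norm L (\<lambda>x. G x - jacobian (v n) (at x)) < inverse (real (Suc n))" by (rule exE)
  have v: "v n \<in> test_fields L" "L2_norm L (\<lambda>x. u x - v n x) < inverse (real (Suc n))"
     "L2_norm L (\<lambda>x. G x - jacobian (v n) (at x)) < inverse (real (Suc n))" for n
    using v' by blast+
  show ?thesis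
    by (rule that[OF v(1)]) (rule tendsto_inverse_Suc[OF L2_norm_nonneg v(2)], rule tendsto_inverse_Suc[OF L2_norm_nonneg v(3)])
qed

text \<open>All three claims hold for the approximating test fields and survive simultaneous
  convergence of fields and Jacobians. For \<open>k \<noteq> 0\<close> the factor
  \<open>(lnorm k)\<^sup>2\<close> can be pulled out of the coefficients of
  \<open>cpl_B_test\<close>, which leaves \<open>triad\<close>.\<close>

lemma gradient_pairings:
  assumes L: "L > 0" and G: "has_gradient L u G" and k: "k \<noteq> 0"
  shows "cpl (A_pairing L G) L k = \<i> * of_real (L\<^sup>2 * (2 * pi / L)\<^sup>2 * (lnorm k) ^ 4) * psi L u k"
    and "cpl (B_pairing L u G) L k = - \<i> * of_real (2 * pi / L * L\<^sup>2 * (lnorm k)\<^sup>2) * (\<Sum>\<^sub>\<infinity>l. triad l (k - l) *\<^sub>R (psi L u l * psi L u (k - l)))"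
    and "finite F \<Longrightarrow> (\<Sum>k\<in>F. ((lnorm k)\<^sup>2 * cmod (psi L u k))\<^sup>2) \<le> (L2_norm L G)\<^sup>2 / (L\<^sup>2 * (2 * pi / L)\<^sup>2)"
proof -
  obtain v where v: "\<And>n::nat. v n \<in> test_fields L" and vu: "(\<lambda>n. L2_norm L (\<lambda>x. u x - v n x)) \<longlonglongrightarrow> 0"
    and JG: "(\<lambda>n. L2_norm L (\<lambda>x. G x - jacobian (v n) (at x))) \<longlonglongrightarrow> 0" using gradient_approx[OF G] by blast
  have uH: "u \<in> H_space L" by (rule has_gradient_H[OF G])
  have uL: "u \<in> L2_space L" by (rule H_L2[OF uH])
  have GL: "G \<in> L2_space L" using G by (simp add: has_gradient_def)
  have vL: "v n \<in> L2_space L" for n by (rule test_L2[OF v])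
  have "\<forall>n. \<exists>q. field_rep L (v n) (fst q) (snd q) \<and> (\<forall>x i j. complex_of_real (jacobian (v n) (at x) $ i $ j) = tpoly L (fst q) (\<lambda>k. - of_real (2 * pi / L * cmp k j * perp k $ i) * snd q k) x)"
  proof
    fix n
    show "\<exists>q. field_rep L (v n) (fst q) (snd q) \<and> (\<forall>x i j. complex_of_real (jacobian (v n) (at x) $ i $ j) = tpoly L (fst q) (\<lambda>k. - of_real (2 * pi / L * cmp k j * perp k $ i) * snd q k) x)"
    proof (rule test_field_rep[OF L v[of n]])
      fix F \<psi> assume "field_rep L (v n) F \<psi>"
        "\<And>x i j. complex_of_real (jacobian (v n) (at x) $ i $ j) = tpoly L F (\<lambda>k. - of_real (2 * pi / L * cmp k j * perp k $ i) * \<psi> k) x"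
      then show ?thesis unfolding fst_conv snd_conv by (intro exI[of _ "(F, \<psi>)"]) (simp only: fst_conv snd_conv simp_thms)
    qed
  qed
  from choice[OF this] obtain q where q: "\<forall>n. field_rep L (v n) (fst (q n)) (snd (q n)) \<and> (\<forall>x i j. complex_of_real (jacobian (v n) (at x) $ i $ j) = tpoly L (fst (q n)) (\<lambda>k. - of_real (2 * pi / L * cmp k j * perp k $ i) * snd (q n) k) x)"
    by (rule exE)
  define Fn where "Fn n = fst (q n)" for n
  define p where "p n = snd (q n)" for n
  have r: "field_rep L (v n) (Fn n) (p n)" for n
    using q unfolding Fn_def p_def by blast
  have rJ: "complex_of_real (jacobian (v n) (at x) $ i $ j) = tpoly L (Fn n) (\<lambda>k. - of_real (2 * pi / L * cmp k j * perp k $ i) * p n k) x" for n x i j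
    using q unfolding Fn_def p_def by blast
  have fin: "finite (Fn n)" and out: "k \<notin> Fn n \<Longrightarrow> p n k = 0" for n k using r[of n] unfolding field_rep_def by blast+
  have pp: "psi L (v n) = p n" for n using psi_field_rep[OF L r] by blast
  let ?J = "\<lambda>n x. jacobian (v n) (at x)"
  have JL: "?J n \<in> L2_space L" for n by (rule L2_space_continuous[OF jacobian_test_continuous[OF rJ]])
  have pt: "(\<lambda>n. psi L (v n) k) \<longlonglongrightarrow> psi L u k" for k by (rule psi_tendsto[OF vL uL vu])
  have "(\<lambda>n. cpl (A_pairing L (?J n)) L k) \<longlonglongrightarrow> cpl (A_pairing L G) L k"
    unfolding cpl_def A_pairing_def
    by (intro tendsto_intros L2_inner_tendsto JL GL JG jacobian_tcos_L2 jacobian_tsin_L2)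
  moreover have "(\<lambda>n. cpl (A_pairing L (?J n)) L k) \<longlonglongrightarrow> \<i> * of_real (L\<^sup>2 * (2 * pi / L)\<^sup>2 * (lnorm k) ^ 4) * psi L u k"
  proof -
    have "cpl (A_pairing L (?J n)) L k = \<i> * of_real (L\<^sup>2 * (2 * pi / L)\<^sup>2 * (lnorm k) ^ 4) * psi L (v n) k" for n
      unfolding pp by (rule cpl_A_test[OF L fin out rJ])
    then show ?thesis by (simp only:) (intro tendsto_intros pt)
  qed
  ultimately show "cpl (A_pairing L G) L k = \<i> * of_real (L\<^sup>2 * (2 * pi / L)\<^sup>2 * (lnorm k) ^ 4) * psi L u k"
    by (rule LIMSEQ_unique)
  have "(\<lambda>n. cpl (B_pairing L (v n) (?J n)) L k) \<longlonglongrightarrow> cpl (B_pairing L u G) L k"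
    unfolding cpl_def
    by (intro tendsto_intros B_pairing_tendsto[OF vL uL JL GL vu JG tcos_L2 norm_tcos_le lnorm_nonneg]
        B_pairing_tendsto[OF vL uL JL GL vu JG tsin_L2 norm_tsin_le lnorm_nonneg])
  moreover have "(\<lambda>n. cpl (B_pairing L (v n) (?J n)) L k) \<longlonglongrightarrow> - \<i> * of_real (2 * pi / L * L\<^sup>2 * (lnorm k)\<^sup>2) * (\<Sum>\<^sub>\<infinity>l. triad l (k - l) *\<^sub>R (psi L u l * psi L u (k - l)))"
  proof -
    have "cpl (B_pairing L (v n) (?J n)) L k = - \<i> * of_real (2 * pi / L * L\<^sup>2 * (lnorm k)\<^sup>2) * (\<Sum>\<^sub>\<infinity>l. triad l (k - l) *\<^sub>R (psi L (v n) l * psi L (v n) (k - l)))" for n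
    proof -
      have "(\<Sum>\<^sub>\<infinity>l. triad l (k - l) *\<^sub>R (p n l * p n (k - l))) = (\<Sum>\<^sub>\<infinity>l\<in>Fn n. triad l (k - l) *\<^sub>R (p n l * p n (k - l)))"
        by (rule infsum_cong_neutral) (simp_all add: out)
      also have "\<dots> = (\<Sum>l\<in>Fn n. triad l (k - l) *\<^sub>R (p n l * p n (k - l)))" using fin by simp
      finally have s: "of_real ((lnorm k)\<^sup>2) * (\<Sum>\<^sub>\<infinity>l. triad l (k - l) *\<^sub>R (p n l * p n (k - l))) =
          (\<Sum>l\<in>Fn n. of_real ((lnorm k)\<^sup>2) * (triad l (k - l) *\<^sub>R (p n l * p n (k - l))))"
        by (simp only: sum_distrib_left)
      also have "\<dots> = (\<Sum>l\<in>Fn n. of_real (cross2 l (k - l) * dot2 (k - l) k) * (p n l * p n (k - l)))"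
      proof (rule sum.cong[OF refl])
        fix l
        have e: "cross2 l (k - l) * dot2 (k - l) k = (lnorm k)\<^sup>2 * triad l (k - l)"
          unfolding triad_def using lnorm_pos[OF k] by simp
        show "complex_of_real ((lnorm k)\<^sup>2) * (triad l (k - l) *\<^sub>R (p n l * p n (k - l))) = of_real (cross2 l (k - l) * dot2 (k - l) k) * (p n l * p n (k - l))"
          unfolding e scaleR_conv_of_real by (simp only: of_real_mult mult.assoc)
      qed
      finally show ?thesis unfolding pp cpl_B_test[OF L r rJ]
        by (simp only: of_real_mult mult.assoc)
    qed
    then show ?thesis by (simp only:) (intro tendsto_intros triad_sum_tendsto[OF L uH v vu])
  qed
  ultimately show "cpl (B_pairing L u G) L k = - \<i> * of_real (2 * pi / L * L\<^sup>2 * (lnorm k)\<^sup>2) * (\<Sum>\<^sub>\<infinity>l. triad l (k - l) *\<^sub>R (psi L u l * psi L u (k - l)))"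
    by (rule LIMSEQ_unique)
  show "(\<Sum>k\<in>F. ((lnorm k)\<^sup>2 * cmod (psi L u k))\<^sup>2) \<le> (L2_norm L G)\<^sup>2 / (L\<^sup>2 * (2 * pi / L)\<^sup>2)" if F: "finite F"
  proof (rule LIMSEQ_le)
    show "(\<lambda>n. \<Sum>k\<in>F. ((lnorm k)\<^sup>2 * cmod (psi L (v n) k))\<^sup>2) \<longlonglongrightarrow> (\<Sum>k\<in>F. ((lnorm k)\<^sup>2 * cmod (psi L u k))\<^sup>2)"
      by (intro tendsto_intros pt)
    show "(\<lambda>n. (L2_norm L (?J n))\<^sup>2 / (L\<^sup>2 * (2 * pi / L)\<^sup>2)) \<longlonglongrightarrow> (L2_norm L G)\<^sup>2 / (L\<^sup>2 * (2 * pi / L)\<^sup>2)"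
      using L by (intro tendsto_divide tendsto_power tendsto_const L2_norm_tendsto[OF JL GL JG]) auto
    have "(\<Sum>k\<in>F. ((lnorm k)\<^sup>2 * cmod (psi L (v n) k))\<^sup>2) \<le> (L2_norm L (?J n))\<^sup>2 / (L\<^sup>2 * (2 * pi / L)\<^sup>2)" for n
    proof -
      have "(\<Sum>k\<in>F. ((lnorm k)\<^sup>2 * cmod (p n k))\<^sup>2) = (\<Sum>k\<in>F \<inter> Fn n. ((lnorm k)\<^sup>2 * cmod (p n k))\<^sup>2)"
        using F out by (intro sum.mono_neutral_right) auto
      also have "\<dots> \<le> (\<Sum>k\<in>Fn n. ((lnorm k)\<^sup>2 * cmod (p n k))\<^sup>2)" using fin by (intro sum_mono2) auto
      also have "\<dots> = (L2_norm L (?J n))\<^sup>2 / (L\<^sup>2 * (2 * pi / L)\<^sup>2)"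
        unfolding jacobian_norm[OF L fin rJ] using L by simp
      finally show ?thesis by (simp only: pp)
    qed
    then show "\<exists>N. \<forall>n\<ge>N. (\<Sum>k\<in>F. ((lnorm k)\<^sup>2 * cmod (psi L (v n) k))\<^sup>2) \<le> (L2_norm L (?J n))\<^sup>2 / (L\<^sup>2 * (2 * pi / L)\<^sup>2)" by blast
  qed
qed

section \<open>From the weak formulation to the system of modes\<close>

lemma perp_minus: "perp (- k) = - perp k"
  by (simp add: perp_def vec_eq_iff)

lemma psi_minus: "psi L f (- k) = cnj (psi L f k)"
proof -
  have c: "tcos L (- k) = (\<lambda>x. (- 1) *\<^sub>R tcos L k x)" and s: "tsin L (- k) = tsin L k"
    by (simp_all add: fun_eq_iff tcos_def tsin_def ph_minus perp_minus)
  have "L2_inner L f (tcos L (- k)) = - L2_inner L f (tcos L k)"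
    unfolding c L2_inner_scaleR_right by simp
  then show ?thesis unfolding psi_def cpl_def s by (simp add: complex_eq_iff)
qed

lemma psi_zero: "psi L f 0 = 0"
  by (simp add: psi_def)

lemma AE_lborel_negligible:
  assumes "AE t in lborel. P t"
  obtains N where "negligible N" "\<And>t::real. t \<notin> N \<Longrightarrow> P t"
proof -
  obtain N where N: "N \<in> null_sets lborel" "{t \<in> space lborel. \<not> P t} \<subseteq> N"
    using assms unfolding eventually_ae_filter by blast
  have "negligible N" using null_sets_completionI[OF N(1)] by (simp add: negligible_iff_null_sets)
  then show ?thesis using that N(2) by auto
qed

lemma cpl_diff3:
  "cpl (\<lambda>\<phi>. X \<phi> - \<nu> * Y \<phi> - Z \<phi>) L k = cpl X L k - of_real \<nu> * cpl Y L k - cpl Z L k"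
  by (simp add: cpl_def algebra_simps)

lemma cpl_has_integral:
  assumes "\<And>\<phi>. \<phi> \<in> test_fields L \<Longrightarrow> ((\<lambda>\<tau>. \<Phi> \<tau> \<phi>) has_integral (I \<phi>)) S" and "L > 0"
  shows "((\<lambda>\<tau>. cpl (\<Phi> \<tau>) L k) has_integral (cpl I L k)) S"
  unfolding cpl_def
  by (intro has_integral_diff has_integral_mult_right has_integral_of_real assms(1) tcos_test tsin_test assms(2))

text \<open>Vanishing coefficients make \<open>g\<close> orthogonal to all \<open>tcos\<close> and
  \<open>tsin\<close>, hence to every test field by its representation. Test fields approximate
  \<open>g\<close>, so \<open>g\<close> is orthogonal to itself.\<close>

lemma psi_all_zero_imp_AE_zero:
  assumes L: "L > 0" and g: "g \<in> H_space L" and z: "\<And>k. psi L g k = 0"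
  shows "AE x in Omega_measure L. g x = 0"
proof -
  have gL: "g \<in> L2_space L" by (rule H_L2[OF g])
  have i0: "L2_inner L g (tcos L k) = 0 \<and> L2_inner L g (tsin L k) = 0" for k
  proof (cases "k = 0")
    case True then show ?thesis by (simp add: tcos_def tsin_def perp_zero L2_inner_def)
  next
    case False
    then have "cpl (L2_inner L g) L k = 0" using z[of k] L lnorm_pos[OF False] by (simp add: psi_def)
    then show ?thesis unfolding cpl_def by (simp add: complex_eq_iff)
  qed
  have orth: "L2_inner L g v = 0" if v: "v \<in> test_fields L" for v
  proof -
    obtain F \<psi> where r: "field_rep L v F \<psi>" using test_field_rep[OF L v] by metis
    have fF: "finite F" and rv: "\<And>x i. complex_of_real (v x $ i) = tpoly L F (\<lambda>k. \<i> * \<psi> k * of_real (perp k $ i)) x"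
      using r unfolding field_rep_def by auto
    have v': "v x = (\<Sum>k\<in>F. (- Im (\<psi> k)) *\<^sub>R tcos L k x + (- Re (\<psi> k)) *\<^sub>R tsin L k x)" for x
    proof (simp only: vec_eq_iff, rule allI)
      fix i
      have "v x $ i = Re (complex_of_real (v x $ i))" by simp
      also have "\<dots> = (\<Sum>k\<in>F. - Im (\<psi> k) * cos (ph L k x) * perp k $ i + (- Re (\<psi> k)) * sin (ph L k x) * perp k $ i)"
        unfolding rv tpoly_def Re_sum by (intro sum.cong refl) (simp add: algebra_simps)
      finally show "v x $ i = (\<Sum>k\<in>F. (- Im (\<psi> k)) *\<^sub>R tcos L k x + (- Re (\<psi> k)) *\<^sub>R tsin L k x) $ i"
        by (simp add: tcos_def tsin_def sum_component algebra_simps)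
    qed
    have "L2_inner L g v = (LINT x|Omega_measure L. (\<Sum>k\<in>F. (- Im (\<psi> k)) * (g x \<bullet> tcos L k x) + (- Re (\<psi> k)) * (g x \<bullet> tsin L k x)))"
      unfolding L2_inner_def v' by (simp add: inner_sum_right inner_diff_right)
    also have "\<dots> = (\<Sum>k\<in>F. (- Im (\<psi> k)) * L2_inner L g (tcos L k) + (- Re (\<psi> k)) * L2_inner L g (tsin L k))"
      unfolding L2_inner_def using L2_inner_integrable[OF gL tcos_L2] L2_inner_integrable[OF gL tsin_L2]
      by (subst Bochner_Integration.integral_sum) auto
    also have "\<dots> = 0" using i0 by simp
    finally show ?thesis .
  qed
  have "(L2_norm L g)\<^sup>2 = 0"
  proof -
    obtain w where w: "\<And>n::nat. w n \<in> test_fields L" "(\<lambda>n. L2_norm L (\<lambda>x. g x - w n x)) \<longlonglongrightarrow> 0"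
      using H_approx[OF g] by blast
    have "(\<lambda>n. L2_inner L (w n) g) \<longlonglongrightarrow> L2_inner L g g"
      by (rule L2_inner_tendsto[OF test_L2[OF w(1)] gL gL w(2)])
    moreover have "L2_inner L (w n) g = 0" for n using orth[OF w(1)] by (simp add: L2_inner_commute)
    ultimately have "(\<lambda>n::nat. 0::real) \<longlonglongrightarrow> L2_inner L g g" by simp
    then have "L2_inner L g g = 0" using LIMSEQ_const_iff by metis
    then show ?thesis by (simp add: L2_inner_self)
  qed
  then have "(LINT x|Omega_measure L. (norm (g x))\<^sup>2) = 0" by (simp add: L2_norm_power2)
  then have "AE x in Omega_measure L. (norm (g x))\<^sup>2 = 0"
    using integral_nonneg_eq_0_iff_AE[OF L2_space_integrable[OF gL]] by simp
  then show ?thesis by simp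
qed

text \<open>Against a single mode \<open>\<phi>\<close> with eigenvalue \<open>-q\<close> the
  Laplacian moves from \<open>g\<close> to \<open>\<phi>\<close>, and the projection disappears
  because \<open>\<phi>\<close> lies in \<open>H_space\<close>. Both sides become multiples of the
  same inner product, so \<open>q = lam\<close> unless it vanishes.\<close>

lemma eigenfield_psi:
  assumes L: "L > 0" and st: "stokes_op L g (\<lambda>x. lam *\<^sub>R g x)" and p: "psi L g k \<noteq> 0"
  shows "(2 * pi / L)\<^sup>2 * (lnorm k)\<^sup>2 = lam"
proof -
  obtain f where hl: "has_laplacian L g f" and lp: "leray_proj L (\<lambda>x. - f x) (\<lambda>x. lam *\<^sub>R g x)"
    using st unfolding stokes_op_def by blast
  have gL: "g \<in> L2_space L" and fL: "f \<in> L2_space L" using hl by (auto simp: has_laplacian_def)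
  define q where "q = (2 * pi / L)\<^sup>2 * (lnorm k)\<^sup>2"
  have key: "(q - lam) * L2_inner L g \<phi> = 0"
    if tp: "trig_poly L \<phi>" and t: "\<phi> \<in> test_fields L" and lap: "laplacian \<phi> = (\<lambda>x. (- q) *\<^sub>R \<phi> x)" for \<phi>
  proof -
    have \<phi>L: "\<phi> \<in> L2_space L" by (rule test_L2[OF t])
    have "L2_inner L (\<lambda>x. - f x - lam *\<^sub>R g x) \<phi> = 0"
      using lp t test_fields_subset_H unfolding leray_proj_def by blast
    then have "- L2_inner L f \<phi> - lam * L2_inner L g \<phi> = 0"
      unfolding L2_inner_diff_left[OF L2_space_uminus[OF fL] L2_space_scaleR[OF gL] \<phi>L] L2_inner_scaleR_left
      by (simp add: L2_inner_def)
    moreover have "L2_inner L g (laplacian \<phi>) = L2_inner L f \<phi>" using hl tp unfolding has_laplacian_def by blast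
    then have "- q * L2_inner L g \<phi> = L2_inner L f \<phi>" unfolding lap L2_inner_scaleR_right .
    ultimately show ?thesis unfolding left_diff_distrib by linarith
  qed
  have "(q - lam) * L2_inner L g (tcos L k) = 0"
    using trig_poly_tcos tcos_test[OF L] by (rule key) (simp add: laplacian_tcos q_def)
  moreover have "(q - lam) * L2_inner L g (tsin L k) = 0"
    using trig_poly_tsin tsin_test[OF L] by (rule key) (simp add: laplacian_tsin q_def)
  moreover have "L2_inner L g (tcos L k) \<noteq> 0 \<or> L2_inner L g (tsin L k) \<noteq> 0"
    using p by (auto simp: psi_def cpl_def)
  ultimately show ?thesis by (auto simp: q_def)
qed

theorem mainTheorem5:
  fixes L \<nu> lam :: real and g :: "real^2 \<Rightarrow> real^2"
  assumes "L > 0" and "\<nu> > 0"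
    and "g \<in> H_space L"
    and "\<not> (AE x in Omega_measure L. g x = 0)"
    and "lam > 0"
    and "stokes_op L g (\<lambda>x. lam *\<^sub>R g x)"
  shows "(\<lambda>x. 0) \<notin> global_attractor L \<nu> g"
proof
  assume "(\<lambda>x. 0) \<in> global_attractor L \<nu> g"
  then obtain u where sol: "nse_solution L \<nu> g u" and u0: "AE x in Omega_measure L. u 0 x = 0"
    and bdd: "bdd_above (range (\<lambda>t. L2_norm L (u t)))"
    unfolding global_attractor_def by blast
  note L = \<open>L > 0\<close>
  define \<kappa> where "\<kappa> = 2 * pi / L"
  have \<kappa>: "\<kappa> > 0" using L by (simp add: \<kappa>_def)
  have uH: "u t \<in> H_space L" for t using sol unfolding nse_solution_def by blast
  obtain G where G: "AE t in lborel. has_gradient L (u t) (G t)"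
    and Gi: "\<And>a b. set_integrable lebesgue {a..b} (\<lambda>t. (L2_norm L (G t))\<^sup>2)"
    and ode: "\<And>\<phi> s t. \<phi> \<in> test_fields L \<Longrightarrow> s \<le> t \<Longrightarrow>
       ((\<lambda>\<tau>. L2_inner L g \<phi> - \<nu> * A_pairing L (G \<tau>) \<phi> - B_pairing L (u \<tau>) (G \<tau>) \<phi>)
          has_integral (L2_inner L (u t) \<phi> - L2_inner L (u s) \<phi>)) {s..t}"
    using sol unfolding nse_solution_def by blast
  obtain N where N: "negligible N" and grad: "\<And>t. t \<notin> N \<Longrightarrow> has_gradient L (u t) (G t)"
    using AE_lborel_negligible[OF G] by blast
  obtain B where B: "\<And>t. L2_norm L (u t) \<le> B" using bdd unfolding bdd_above_def by auto
  \<comment> \<open>In terms of \<open>psi\<close> the viscous term becomes multiplication by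
    \<open>\<nu> * \<kappa>\<^sup>2 * (lnorm k)\<^sup>2\<close>, and advection, brought to the right
    side, has coefficient \<open>\<kappa>\<close>.\<close>
  interpret lattice_ode "\<lambda>k t. psi L (u t) k" "psi L g" "\<nu> * \<kappa>\<^sup>2" \<kappa> "B\<^sup>2 / L\<^sup>2" "\<nu> * lam"
  proof
    show "0 < \<nu> * \<kappa>\<^sup>2" "0 < \<nu> * lam" using \<kappa> assms by auto
    show "psi L (u t) 0 = 0" for t by (rule psi_zero)
    show "psi L (u t) (- k) = cnj (psi L (u t) k)" for k t by (rule psi_minus)
    show "(\<Sum>k\<in>F. (lnorm k * cmod (psi L (u t) k))\<^sup>2) \<le> B\<^sup>2 / L\<^sup>2" if "finite F" for F t
    proof -
      have "(L2_norm L (u t))\<^sup>2 / L\<^sup>2 \<le> B\<^sup>2 / L\<^sup>2" using B by (intro divide_right_mono power_mono) auto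
      then show ?thesis using bessel[OF L uH that, of t] by linarith
    qed
    show "\<exists>D. \<forall>F. finite F \<longrightarrow> integral {s..T} (\<lambda>t. \<Sum>k\<in>F. ((lnorm k)\<^sup>2 * cmod (psi L (u t) k))\<^sup>2) \<le> D" if "s \<le> T" for s T
    proof -
      define h where "h t = (L2_norm L (G t))\<^sup>2 / (L\<^sup>2 * \<kappa>\<^sup>2)" for t
      have hi: "h integrable_on {s..T}"
        using set_lebesgue_integral_eq_integral(1)[OF Gi[of s T]] unfolding h_def[abs_def] by (rule integrable_on_divide)
      have h0: "integral {s..T} h \<ge> 0" by (rule integral_nonneg[OF hi]) (simp add: h_def)
      have "integral {s..T} (\<lambda>t. \<Sum>k\<in>F. ((lnorm k)\<^sup>2 * cmod (psi L (u t) k))\<^sup>2) \<le> integral {s..T} h" if F: "finite F" for F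
      \<comment> \<open>For a non-integrable integrand \<open>integral\<close> is 0, and
        \<open>h0\<close> suffices. Otherwise \<open>h'\<close> modifies \<open>h\<close> on the
        null set \<open>N\<close>, where no gradient is available, so that the comparison holds at
        every time.\<close>
      proof (cases "(\<lambda>t. \<Sum>k\<in>F. ((lnorm k)\<^sup>2 * cmod (psi L (u t) k))\<^sup>2) integrable_on {s..T}")
        case True
        let ?f = "\<lambda>t. \<Sum>k\<in>F. ((lnorm k)\<^sup>2 * cmod (psi L (u t) k))\<^sup>2"
        define h' where "h' t = (if t \<in> N then ?f t else h t)" for t
        have eq: "integral {s..T} h' = integral {s..T} h"
          by (rule integral_spike[OF N]) (simp add: h'_def)
        have "h' integrable_on {s..T}" by (rule integrable_spike[OF hi N]) (simp add: h'_def)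
        then have "integral {s..T} ?f \<le> integral {s..T} h'"
        proof (rule integral_le[OF True])
          fix t
          have "(1, 0) \<noteq> (0 :: int \<times> int)" by (simp add: zero_prod_def)
          then show "?f t \<le> h' t"
            using gradient_pairings(3)[OF L grad[of t] _ F] unfolding h'_def h_def \<kappa>_def by (cases "t \<in> N") auto
        qed
        then show ?thesis using eq by simp
      qed (use h0 in \<open>simp add: not_integrable_integral\<close>)
      then show ?thesis by blast
    qed
    show "((\<lambda>\<tau>. psi L g k - (\<nu> * \<kappa>\<^sup>2 * (lnorm k)\<^sup>2) *\<^sub>R psi L (u \<tau>) k
              + \<kappa> *\<^sub>R (\<Sum>\<^sub>\<infinity>l. triad l (k - l) *\<^sub>R (psi L (u \<tau>) l * psi L (u \<tau>) (k - l))))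
            has_integral (psi L (u t) k - psi L (u s) k)) {s..t}" if k: "k \<noteq> 0" and st: "s \<le> t" for k s t
    proof -
      \<comment> \<open>The prefactor of \<open>psi\<close>: multiplied by it, the equation tested
        with \<open>tcos\<close> and \<open>tsin\<close> becomes an equation for
        coefficients.\<close>
      define c where "c = - \<i> / of_real (L\<^sup>2 * (lnorm k)\<^sup>2)"
      have lk: "lnorm k > 0" by (rule lnorm_pos[OF k])
      have I: "((\<lambda>\<tau>. c * cpl (\<lambda>\<phi>. L2_inner L g \<phi> - \<nu> * A_pairing L (G \<tau>) \<phi> - B_pairing L (u \<tau>) (G \<tau>) \<phi>) L k)
          has_integral c * cpl (\<lambda>\<phi>. L2_inner L (u t) \<phi> - L2_inner L (u s) \<phi>) L k) {s..t}"
        by (intro has_integral_mult_right cpl_has_integral ode st L)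
      have e1: "c * cpl (\<lambda>\<phi>. L2_inner L (u t) \<phi> - L2_inner L (u s) \<phi>) L k = psi L (u t) k - psi L (u s) k"
        unfolding psi_def c_def[symmetric] cpl_def by (simp add: algebra_simps)
      have e2: "psi L g k - (\<nu> * \<kappa>\<^sup>2 * (lnorm k)\<^sup>2) *\<^sub>R psi L (u \<tau>) k
              + \<kappa> *\<^sub>R (\<Sum>\<^sub>\<infinity>l. triad l (k - l) *\<^sub>R (psi L (u \<tau>) l * psi L (u \<tau>) (k - l)))
          = c * cpl (\<lambda>\<phi>. L2_inner L g \<phi> - \<nu> * A_pairing L (G \<tau>) \<phi> - B_pairing L (u \<tau>) (G \<tau>) \<phi>) L k"
        if "\<tau> \<notin> N" for \<tau>
      proof -
        note gp = gradient_pairings[OF L grad[OF that] k]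
        have w: "c * (\<i> * of_real (L\<^sup>2 * \<kappa>\<^sup>2 * lnorm k ^ 4)) = of_real (\<kappa>\<^sup>2 * (lnorm k)\<^sup>2)"
          unfolding c_def using lk L by (simp add: power4_eq_xxxx power2_eq_square)
        have w': "c * (- \<i> * of_real (\<kappa> * L\<^sup>2 * (lnorm k)\<^sup>2)) = - of_real \<kappa>"
          unfolding c_def using lk L by (simp add: power2_eq_square)
        have "c * cpl (A_pairing L (G \<tau>)) L k = of_real (\<kappa>\<^sup>2 * (lnorm k)\<^sup>2) * psi L (u \<tau>) k"
          unfolding gp(1) \<kappa>_def[symmetric] mult.assoc[symmetric] w[unfolded mult.assoc[symmetric]] ..
        moreover have "c * cpl (B_pairing L (u \<tau>) (G \<tau>)) L k = - of_real \<kappa> * (\<Sum>\<^sub>\<infinity>l. triad l (k - l) *\<^sub>R (psi L (u \<tau>) l * psi L (u \<tau>) (k - l)))"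
          unfolding gp(2) \<kappa>_def[symmetric] mult.assoc[symmetric] w'[unfolded mult.assoc[symmetric]] ..
        moreover have "c * cpl (L2_inner L g) L k = psi L g k" unfolding psi_def c_def ..
        ultimately show ?thesis unfolding cpl_diff3 right_diff_distrib
          by (simp add: mult.left_commute[of c] scaleR_conv_of_real mult.assoc)
      qed
      \<comment> \<open>The two integrands agree off the null set \<open>N\<close>, which does not
        affect the integral.\<close>
      show ?thesis
        unfolding e1[symmetric] by (rule has_integral_spike[OF N _ I]) (use e2 in auto)
    qed
    show "\<nu> * \<kappa>\<^sup>2 * (lnorm k)\<^sup>2 = \<nu> * lam" if "psi L g k \<noteq> 0" for k
      using eigenfield_psi[OF L assms(6) that] by (simp add: \<kappa>_def)
    show "psi L (u 0) k = 0" for k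
    proof -
      have "L2_inner L (u 0) h = 0" for h
        unfolding L2_inner_def by (rule integral_eq_zero_AE) (use u0 in auto)
      then show ?thesis by (simp add: psi_def cpl_def)
    qed
  qed
  have "AE x in Omega_measure L. g x = 0"
    by (rule psi_all_zero_imp_AE_zero[OF L assms(3) forcing_zero])
  then show False using assms(4) by blast
qed

end
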